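(* Let $R>1$ and let $A:\mathbb{R}^2\to\mathbb{R}$ be given by $A=+1$ outside $B_R(0)$, $A=-1$ in $B_R(0)\setminus B_1(0)$, and $A=+1$ in $B_1(0)$ (radial concentric core $\Sigma=B_1(0)\subset B_R(0)$). Let $q>R^*:=R^{3/2}$ and let $f=F\,\mathcal{H}^1\lfloor\partial B_q(0)$ with $F:\partial B_q(0)\to\mathbb{R}$, $F\in L^2(\partial B_q(0))$, $\int_{\partial B_q(0)}F\,d\mathcal{H}^1=0$. Then the configuration given by $A$ and $f$ is non-resonant, i.e. $\limsup_{\eta\to0}E_\eta(u_\eta)<\infty$.
   Context: $B_r(x_0)$ is the disk of radius $r$ centered at $x_0$ in $\mathbb{R}^2$; $\mathcal{H}^1\lfloor\Gamma$ is one-dimensional Hausdorff measure restricted to the curve $\Gamma$, so that $f$ acts on test functions by $\langle f,\varphi\rangle=\int_{\partial B_q(0)}F\varphi\,d\mathcal{H}^1$. $\dot H^1(\mathbb{R}^2)=\{U\in L^2_{\mathrm{loc}}(\mathbb{R}^2): \nabla U\in L^2(\mathbb{R}^2)\}$ (real- or complex-valued functions). For $\eta>0$ set $a_\eta(x)=A(x)+i\eta$, and let $u_\eta\in\dot H^1(\mathbb{R}^2)$ be the complex-valued weak solution, unique up to an additive constant, of $\nabla\cdot(a_\eta\nabla u_\eta)=f$ on $\mathbb{R}^2$ (with $\nabla u_\eta\to0$ as $|x|\to\infty$). The energy is $E_\eta(u_\eta)=\frac{\eta}{2}\int_{\mathbb{R}^2}|\nabla u_\eta|^2\,dx$, and a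 configuration (coefficient $A$ and source $f$) is called resonant if $\limsup_{\eta\to0}E_\eta(u_\eta)=\infty$, and non-resonant otherwise. *)

theory Defs
  imports "HOL-Analysis.Analysis"
begin

definition hausdorff1_premeasure :: "real \<Rightarrow> 'a::metric_space set \<Rightarrow> ennreal" where
  "hausdorff1_premeasure \<delta> S =
    (INF U\<in>{U :: nat \<Rightarrow> 'a set. S \<subseteq> (\<Union>i. U i) \<and> (\<forall>i. bounded (U i) \<and> diameter (U i) \<le> \<delta>)}.
       \<Sum>i. ennreal (diameter (U i)))"

definition hausdorff1_outer :: "'a::metric_space set \<Rightarrow> ennreal" where
  "hausdorff1_outer S = (SUP \<delta>\<in>{0<..}. hausdorff1_premeasure \<delta> S)"

definition hausdorff1 :: "'a::metric_space measure" where
  "hausdorff1 =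
    measure_of UNIV (lambda_system UNIV UNIV hausdorff1_outer) hausdorff1_outer"

abbreviation hausdorff1_on :: "'a::metric_space set \<Rightarrow> 'a measure" where
  "hausdorff1_on \<Gamma> \<equiv> restrict_space hausdorff1 \<Gamma>"

definition L2 :: "'a measure \<Rightarrow> ('a \<Rightarrow> 'b::{banach, second_countable_topology}) set" where
  "L2 M = {f \<in> borel_measurable M. integrable M (\<lambda>x. (norm (f x))\<^sup>2)}"

primrec C_k :: "nat \<Rightarrow> ('a::real_normed_vector \<Rightarrow> 'b::real_normed_vector) \<Rightarrow> bool" where
  "C_k 0 f \<longleftrightarrow> continuous_on UNIV f"
| "C_k (Suc k) f \<longleftrightarrow>
     (\<forall>x. f differentiable (at x)) \<and> (\<forall>v. C_k k (\<lambda>x. frechet_derivative f (at x) v))"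

definition test_function :: "(real^2 \<Rightarrow> real) \<Rightarrow> bool" where
  "test_function \<phi> \<longleftrightarrow> (\<forall>k. C_k k \<phi>) \<and> compact (closure {x. \<phi> x \<noteq> 0})"

definition grad :: "(real^2 \<Rightarrow> real) \<Rightarrow> real^2 \<Rightarrow> real^2" where
  "grad \<phi> x = (\<chi> i. frechet_derivative \<phi> (at x) (axis i 1))"

definition has_weak_gradient :: "(real^2 \<Rightarrow> complex) \<Rightarrow> (real^2 \<Rightarrow> complex^2) \<Rightarrow> bool" where
  "has_weak_gradient u g \<longleftrightarrow>
     (\<forall>K. compact K \<longrightarrow> integrable (lebesgue_on K) u \<and> integrable (lebesgue_on K) g) \<and>
     (\<forall>\<phi> i. test_function \<phi> \<longrightarrow>
        (LINT x|lebesgue. (grad \<phi> x $ i) *\<^sub>R u x) = - (LINT x|lebesgue. \<phi> x *\<^sub>R (g x $ i)))"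

text \<open>A weak gradient is unique up to a null set, so the choice below is immaterial.\<close>

definition weak_grad :: "(real^2 \<Rightarrow> complex) \<Rightarrow> real^2 \<Rightarrow> complex^2" where
  "weak_grad u = (SOME g. has_weak_gradient u g)"

definition Hdot1 :: "(real^2 \<Rightarrow> complex) set" where
  "Hdot1 = {u. (\<forall>K. compact K \<longrightarrow> u \<in> L2 (lebesgue_on K)) \<and>
               (\<exists>g. has_weak_gradient u g) \<and> weak_grad u \<in> L2 lebesgue}"

definition curve_source :: "(real^2) set \<Rightarrow> (real^2 \<Rightarrow> real) \<Rightarrow> (real^2 \<Rightarrow> real) \<Rightarrow> real" where
  "curve_source \<Gamma> F \<phi> = (LINT x|hausdorff1_on \<Gamma>. F x * \<phi> x)"

text \<open>
  The equation \<open>\<nabla>\<cdot>(a\<nabla>u) = f\<close> in the sense of distributions; both sides are linear in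
  the test function, so real-valued test functions suffice. The decay of the gradient at infinity
  is an essential limit, as the weak gradient is only determined almost everywhere.
\<close>

definition weak_solution ::
  "(real^2 \<Rightarrow> complex) \<Rightarrow> ((real^2 \<Rightarrow> real) \<Rightarrow> real) \<Rightarrow> (real^2 \<Rightarrow> complex) \<Rightarrow> bool" where
  "weak_solution a f u \<longleftrightarrow>
     u \<in> Hdot1 \<and>
     (\<forall>\<phi>. test_function \<phi> \<longrightarrow>
        - (LINT x|lebesgue. a x * (\<Sum>i\<in>UNIV. weak_grad u x $ i * of_real (grad \<phi> x $ i)))
          = of_real (f \<phi>)) \<and>
     (\<forall>\<epsilon>>0. \<exists>r. AE x in lebesgue. norm x > r \<longrightarrow> norm (weak_grad u x) < \<epsilon>)"

definition energy :: "real \<Rightarrow> (real^2 \<Rightarrow> complex) \<Rightarrow> real" where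
  "energy \<eta> u = \<eta> / 2 * (LINT x|lebesgue. (norm (weak_grad u x))\<^sup>2)"

text \<open>
  The solutions \<open>u \<eta>\<close> are unique up to additive constants, which do not affect the energy;
  hence it does not matter which family of solutions is taken.
\<close>

definition resonant :: "(real^2 \<Rightarrow> real) \<Rightarrow> ((real^2 \<Rightarrow> real) \<Rightarrow> real) \<Rightarrow> bool" where
  "resonant A f \<longleftrightarrow>
     (\<exists>u. (\<forall>\<eta>>0. weak_solution (\<lambda>x. of_real (A x) + \<i> * of_real \<eta>) f (u \<eta>)) \<and>
          Limsup (at_right 0) (\<lambda>\<eta>. ereal (energy \<eta> (u \<eta>))) = \<infinity>)"

end

(*
  Since the problem with dissipation 1 is solvable, the source f is the divergence of a
  square-integrable field; its orthogonal projection P onto gradients satisfies div P = f. As f annihilates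
  test functions vanishing on the circle of radius q, P is harmonic in the ball of that radius,
  so that there P is the gradient of Re h with h' = sum b_k z^k, |b_k| = O(r^-k) for every r < q.

  For each truncation K the modes with k < K are reflected in the circles of radius R and 1:
  replacing z^k by R^(2k) / (conj z)^k in the shell and by R^(2k) z^k in the core turns P into a gradient V
  with div (A V) = f up to the modes k >= K, whose error Z lives in the shell. Testing the equation of
  u_eta with the conjugate of the difference bounds the energy by eta |V|^2 + |Z|^2 / eta, that is, by
  1 + eta (R^2/r)^(2K) + (R/r)^(2K) / eta up to a constant. With R^-K ~ eta this is bounded
  as soon as R^3 <= r^2, which is where the exponent 3/2 comes from.

  The projection is onto the closure of the gradients of test functions; that this closure contains all
  square-integrable curl-free fields, and that P is harmonic, both come from testing
  with chi(y) conj(y - x) / (|y - x|^2 + t^2) and letting t tend to 0.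
*)

theory Submission
  imports Defs "HOL-Probability.Sinc_Integral"
begin

section \<open>Smooth test functions\<close>

text \<open>Since \<open>A\<close> changes sign, the real part of the equation is not coercive, and
  the imaginary part controls the gradient only with weight eta, so an error in the equation costs a
  factor 1 / eta. Reflecting all modes would leave no error, but their size is only bounded by (R^2
  / r)^k, which is summable only for r > R^2. Between R^(3/2) and R^2 the reflection has to be cut
  off, and the cutoff must move with eta.

  The jump conditions on the two circles are never checked. Both corrections come from the one
  locally Lipschitz map \<open>prim (reflect z) - prim z\<close>: the gradient of its real part
  keeps V curl-free, and the gradient of its imaginary part, after a quarter turn, gives a
  divergence-free field that matches A V. One integration by parts for Lipschitz functions covers
  both.

  The statement is proved by contradiction: \<open>resonant\<close> supplies a solution for every
  positive eta, in particular at dissipation 1. Potentials of square-integrable fields need not be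
  square-integrable, so equations are tested with limits of gradients and no potential is ever cut
  off at infinity.\<close>

lemma C_k_SucI:
  assumes "\<And>x. (f has_derivative f' x) (at x)" and "\<And>v. C_k k (\<lambda>x. f' x v)"
  shows "C_k (Suc k) f"
proof -
  have "frechet_derivative f (at x) = f' x" for x
    using frechet_derivative_at[OF assms(1)] by simp
  then show ?thesis
    using assms by (auto simp: differentiable_def)
qed

lemma C_k_Suc_has_derivative:
  "C_k (Suc k) f \<Longrightarrow> (f has_derivative frechet_derivative f (at x)) (at x)"
  using frechet_derivative_works by auto

lemma C_k_Suc_deriv: "C_k (Suc k) f \<Longrightarrow> C_k k (\<lambda>x. frechet_derivative f (at x) v)"
  by simp

lemma C_k_SucD: "C_k (Suc k) f \<Longrightarrow> C_k k f"
proof (induction k arbitrary: f)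
  case 0
  then show ?case
    by (auto intro!: continuous_at_imp_continuous_on differentiable_imp_continuous_within)
next
  case (Suc k)
  then show ?case
    by (metis C_k.simps(2))
qed

lemma C_k_continuous: "C_k k f \<Longrightarrow> continuous_on UNIV f"
  by (induction k) (use C_k_SucD in auto)

lemma C_k_const: "C_k k (\<lambda>x. c)"
proof (induction k arbitrary: c)
  case (Suc k)
  show ?case by (rule C_k_SucI[where f'="\<lambda>x v. 0"]) (auto intro: Suc)
qed simp

lemma C_k_bounded_linear: "bounded_linear f \<Longrightarrow> C_k k f"
  by (induction k)
    (auto simp: bounded_linear_imp_has_derivative linear_continuous_on C_k_const
      simp del: C_k.simps(2) intro!: C_k_SucI[where f'="\<lambda>x. f"])

lemma C_k_add: "C_k k f \<Longrightarrow> C_k k g \<Longrightarrow> C_k k (\<lambda>x. f x + g x)"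
proof (induction k arbitrary: f g)
  case 0
  then show ?case by (auto intro: continuous_intros)
next
  case (Suc k)
  show ?case
    by (rule C_k_SucI[OF has_derivative_add[OF Suc.prems[THEN C_k_Suc_has_derivative]]])
      (intro Suc.IH Suc.prems[THEN C_k_Suc_deriv])
qed

lemma C_k_mult:
  fixes f g :: "'a::real_normed_vector \<Rightarrow> real"
  shows "C_k k f \<Longrightarrow> C_k k g \<Longrightarrow> C_k k (\<lambda>x. f x * g x)"
proof (induction k arbitrary: f g)
  case 0
  then show ?case by (auto intro: continuous_intros)
next
  case (Suc k)
  note D = Suc.prems[THEN C_k_Suc_has_derivative] and C = Suc.prems[THEN C_k_SucD] Suc.prems[THEN C_k_Suc_deriv]
  show ?case
    by (rule C_k_SucI[OF has_derivative_mult[OF D]]) (intro C_k_add Suc.IH C)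
qed

lemma C_k_uminus:
  fixes f :: "'a::real_normed_vector \<Rightarrow> real"
  shows "C_k k f \<Longrightarrow> C_k k (\<lambda>x. - f x)"
  using C_k_mult[OF C_k_const[of k "-1"], of f] by simp

lemma C_k_diff:
  fixes f g :: "'a::real_normed_vector \<Rightarrow> real"
  shows "C_k k f \<Longrightarrow> C_k k g \<Longrightarrow> C_k k (\<lambda>x. f x - g x)"
  using C_k_add[OF _ C_k_uminus, of k f g] by simp

lemma C_k_inverse:
  fixes f :: "'a::real_normed_vector \<Rightarrow> real"
  assumes "C_k k f" "\<And>x. f x \<noteq> 0"
  shows "C_k k (\<lambda>x. inverse (f x))"
  using assms(1)
proof (induction k)
  case 0
  then show ?case using assms(2) by (auto intro!: continuous_intros)
next
  case (Suc k)
  note C = Suc.IH[OF C_k_SucD[OF Suc.prems]] C_k_Suc_deriv[OF Suc.prems]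
  show ?case
    by (rule C_k_SucI[OF Deriv.has_derivative_inverse[OF assms(2) C_k_Suc_has_derivative[OF Suc.prems]]])
      (intro C_k_uminus C_k_mult C)
qed

lemma C_k_divide:
  fixes f g :: "'a::real_normed_vector \<Rightarrow> real"
  assumes "C_k k f" "C_k k g" "\<And>x. g x \<noteq> 0"
  shows "C_k k (\<lambda>x. f x / g x)"
  using C_k_mult[OF assms(1) C_k_inverse[OF assms(2,3)]] by (simp add: divide_inverse)

lemma C_k_inner_self:
  shows "C_k k (\<lambda>x::'b::real_inner. x \<bullet> x)"
proof (cases k)
  case (Suc j)
  show ?thesis
    unfolding Suc
    by (rule C_k_SucI[where f'="\<lambda>x v. x \<bullet> v + v \<bullet> x"])
      (auto intro!: derivative_eq_intros C_k_bounded_linear bounded_linear_add bounded_linear_inner_left bounded_linear_inner_right)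
qed (auto intro!: continuous_intros)

text \<open>The family is closed under differentiation, which gives smoothness of all its members at once.\<close>

definition flat_exp :: "nat \<Rightarrow> real \<Rightarrow> real" where
  "flat_exp n s = (if s \<le> 0 then 0 else exp (- 1 / s) / s ^ n)"

lemma flat_exp_has_derivative:
  "(flat_exp n has_real_derivative flat_exp (n + 2) s - n * flat_exp (n + 1) s) (at s)"
proof -
  consider "s < 0" | "s = 0" | "s > 0" by linarith
  then show ?thesis
  proof cases
    case 1
    have "((\<lambda>_. 0) has_real_derivative 0) (at s)" by simp
    then have "(flat_exp n has_real_derivative 0) (at s)"
      by (rule has_field_derivative_transform_within_open[where S="{..<0}"]) (use 1 in \<open>auto simp: flat_exp_def\<close>)
    then show ?thesis using 1 by (simp add: flat_exp_def)
  next
    case 2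
    have "((\<lambda>x. flat_exp n x / x) \<longlongrightarrow> 0) (at_right 0)"
    proof (rule Lim_transform_eventually)
      \<comment> \<open>In the variable 1 / x the quotient is a power over an exponential; 0 is the
        only point where the two branches of \<open>flat_exp\<close> meet.\<close>
      show "((\<lambda>x::real. inverse x ^ Suc n / exp (inverse x)) \<longlongrightarrow> 0) (at_right 0)"
        by (rule filterlim_compose[OF tendsto_power_div_exp_0 filterlim_inverse_at_top_right])
      show "\<forall>\<^sub>F x::real in at_right 0. inverse x ^ Suc n / exp (inverse x) = flat_exp n x / x"
        by (auto simp: flat_exp_def eventually_at_filter exp_minus divide_simps power_divide)
    qed
    moreover have "((\<lambda>x. flat_exp n x / x) \<longlongrightarrow> 0) (at_left 0)"
      by (rule tendsto_eventually) (auto simp: flat_exp_def eventually_at_filter)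
    ultimately have "((\<lambda>x. flat_exp n x / x) \<longlongrightarrow> 0) (at 0)"
      by (simp add: filterlim_at_split)
    then show ?thesis
      using 2 by (simp add: has_field_derivative_iff flat_exp_def)
  next
    case 3
    have "((\<lambda>s. exp (- 1 / s) / s ^ n) has_real_derivative flat_exp (n + 2) s - n * flat_exp (n + 1) s) (at s)"
    proof -
      have "((\<lambda>s. exp (- 1 / s) / s ^ n) has_real_derivative
          (exp (- 1 / s) * (1 / s\<^sup>2) * s ^ n - exp (- 1 / s) * (n * s ^ (n - 1))) / (s ^ n * s ^ n)) (at s)"
        using 3 by (auto intro!: derivative_eq_intros simp: power2_eq_square)
      moreover have "(exp (- 1 / s) * (1 / s\<^sup>2) * s ^ n - exp (- 1 / s) * (n * s ^ (n - 1))) / (s ^ n * s ^ n)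
          = flat_exp (n + 2) s - n * flat_exp (n + 1) s"
      proof (cases n)
        case (Suc m)
        define p where "p = s ^ m"
        have "p > 0" using 3 by (simp add: p_def)
        then show ?thesis
          using 3 by (simp add: Suc flat_exp_def flip: p_def) (simp add: field_simps power2_eq_square)
      qed (use 3 in \<open>simp add: flat_exp_def power2_eq_square\<close>)
      ultimately show ?thesis by simp
    qed
    then show ?thesis
      by (rule has_field_derivative_transform_within_open[where S="{0<..}"]) (use 3 in \<open>auto simp: flat_exp_def\<close>)
  qed
qed

lemma C_k_flat_exp:
  fixes g :: "'a::real_normed_vector \<Rightarrow> real"
  shows "C_k k g \<Longrightarrow> C_k k (\<lambda>x. flat_exp n (g x))"
proof (induction k arbitrary: n)
  case 0
  have "continuous_on UNIV (flat_exp n)"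
    using DERIV_isCont[OF flat_exp_has_derivative] by (simp add: continuous_at_imp_continuous_on)
  then show ?case
    using 0 continuous_on_compose2[of UNIV "flat_exp n" UNIV g] by simp
next
  case (Suc k)
  show ?case
  proof (rule C_k_SucI)
    fix x
    show "((\<lambda>x. flat_exp n (g x)) has_derivative
        (\<lambda>v. (flat_exp (n + 2) (g x) - n * flat_exp (n + 1) (g x)) * frechet_derivative g (at x) v)) (at x)"
      using has_derivative_compose[OF C_k_Suc_has_derivative[OF Suc.prems]
          flat_exp_has_derivative[unfolded has_field_derivative_def]] by simp
  next
    fix v
    show "C_k k (\<lambda>x. (flat_exp (n + 2) (g x) - n * flat_exp (n + 1) (g x)) * frechet_derivative g (at x) v)"
      by (intro C_k_mult C_k_diff C_k_const Suc.IH C_k_Suc_deriv[OF Suc.prems] C_k_SucD[OF Suc.prems])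
  qed
qed

section \<open>Test functions and their gradients\<close>

lemma test_functionI:
  assumes "\<And>k. C_k k \<phi>" "bounded {x. \<phi> x \<noteq> 0}"
  shows "test_function \<phi>"
  using assms by (auto simp: test_function_def)

lemma test_function_C_k: "test_function \<phi> \<Longrightarrow> C_k k \<phi>"
  by (simp add: test_function_def)

lemma test_function_bounded_support: "test_function \<phi> \<Longrightarrow> bounded {x. \<phi> x \<noteq> 0}"
  by (metis test_function_def bounded_subset closure_subset compact_imp_bounded)

lemma test_function_has_derivative:
  "test_function \<phi> \<Longrightarrow> (\<phi> has_derivative (\<lambda>v. grad \<phi> x \<bullet> v)) (at x)"
proof -
  assume "test_function \<phi>"
  then have *: "(\<phi> has_derivative frechet_derivative \<phi> (at x)) (at x)"
    using C_k_Suc_has_derivative test_function_C_k by blast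
  then have l: "linear (frechet_derivative \<phi> (at x))"
    using has_derivative_linear by blast
  have "frechet_derivative \<phi> (at x) v = grad \<phi> x \<bullet> v" for v
  proof -
    have "v = v$1 *\<^sub>R axis 1 1 + v$2 *\<^sub>R axis 2 1"
      by (auto simp: vec_eq_iff forall_2 axis_def)
    then have "frechet_derivative \<phi> (at x) v = frechet_derivative \<phi> (at x) (v$1 *\<^sub>R axis 1 1 + v$2 *\<^sub>R axis 2 1)"
      by (rule arg_cong)
    then have "frechet_derivative \<phi> (at x) v = v$1 * frechet_derivative \<phi> (at x) (axis 1 1)
      + v$2 * frechet_derivative \<phi> (at x) (axis 2 1)"
      by (simp only: linear_add[OF l] linear_cmul[OF l] real_scaleR_def)
    then show ?thesis
      by (simp add: grad_def inner_vec_def sum_2 mult.commute)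
  qed
  then have "frechet_derivative \<phi> (at x) = (\<lambda>v. grad \<phi> x \<bullet> v)" by (rule ext)
  with * show ?thesis by (rule subst[rotated])
qed

lemma grad_eqI:
  assumes "(\<phi> has_derivative (\<lambda>v. w \<bullet> v)) (at x)"
  shows "grad \<phi> x = w"
proof -
  have "frechet_derivative \<phi> (at x) = (\<lambda>v. w \<bullet> v)"
    using frechet_derivative_at[OF assms] by simp
  then show ?thesis
    by (simp add: grad_def vec_eq_iff inner_axis)
qed

lemma test_function_continuous: "test_function \<phi> \<Longrightarrow> continuous_on UNIV \<phi>"
  using C_k_continuous test_function_C_k by blast

lemma test_function_grad:
  assumes "test_function \<phi>"
  shows "test_function (\<lambda>x. grad \<phi> x $ i)"
proof (rule test_functionI)
  show "C_k k (\<lambda>x. grad \<phi> x $ i)" for k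
    using C_k_Suc_deriv[OF test_function_C_k[OF assms]] by (simp add: grad_def)
  \<comment> \<open>Off the closed support \<phi> vanishes on a whole neighbourhood; at a mere zero
    of \<phi> the gradient need not vanish.\<close>
  have "grad \<phi> x $ i = 0" if "x \<notin> closure {x. \<phi> x \<noteq> 0}" for x
  proof -
    have "(\<phi> has_derivative (\<lambda>v. 0)) (at x)"
    proof (rule has_derivative_transform_within_open)
      show "((\<lambda>x. 0) has_derivative (\<lambda>v. 0)) (at x)" by simp
      show "x \<in> - closure {x. \<phi> x \<noteq> 0}" using that by simp
      show "0 = \<phi> y" if "y \<in> - closure {x. \<phi> x \<noteq> 0}" for y
        using that closure_subset[of "{x. \<phi> x \<noteq> 0}"] by auto
    qed (simp add: open_Compl)
    then show ?thesis using grad_eqI[of \<phi> 0 x] by simp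
  qed
  then have "{x. grad \<phi> x $ i \<noteq> 0} \<subseteq> closure {x. \<phi> x \<noteq> 0}" by auto
  with assms show "bounded {x. grad \<phi> x $ i \<noteq> 0}"
    using test_function_bounded_support by (meson bounded_closure bounded_subset)
qed

lemma grad_continuous: "test_function \<phi> \<Longrightarrow> continuous_on UNIV (grad \<phi>)"
  using continuous_on_vec_lambda[of UNIV "\<lambda>i x. grad \<phi> x $ i"] test_function_continuous[OF test_function_grad] by simp

lemma test_function_add:
  assumes "test_function \<phi>" "test_function \<psi>"
  shows "test_function (\<lambda>x. \<phi> x + \<psi> x)"
proof (rule test_functionI)
  show "bounded {x. \<phi> x + \<psi> x \<noteq> 0}"
    using assms[THEN test_function_bounded_support]
    by (rule bounded_subset[OF bounded_Un[THEN iffD2, OF conjI]]) auto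
qed (rule C_k_add[OF assms[THEN test_function_C_k]])

lemma test_function_mult:
  assumes "test_function \<phi>" "\<And>k. C_k k \<psi>"
  shows "test_function (\<lambda>x. \<phi> x * \<psi> x)"
proof (rule test_functionI)
  show "bounded {x. \<phi> x * \<psi> x \<noteq> 0}"
    by (rule bounded_subset[OF test_function_bounded_support[OF assms(1)]]) auto
qed (rule C_k_mult[OF test_function_C_k[OF assms(1)] assms(2)])

lemma test_function_cmult: "test_function \<phi> \<Longrightarrow> test_function (\<lambda>x. c * \<phi> x)"
  by (subst mult.commute) (rule test_function_mult[OF _ C_k_const])

lemma grad_add:
  assumes "test_function \<phi>" "test_function \<psi>"
  shows "grad (\<lambda>x. \<phi> x + \<psi> x) x = grad \<phi> x + grad \<psi> x"
  by (rule grad_eqI) (simp add: inner_add_left has_derivative_add assms test_function_has_derivative)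

lemma grad_cmult:
  assumes "test_function \<phi>"
  shows "grad (\<lambda>x. c * \<phi> x) x = c *\<^sub>R grad \<phi> x"
  by (rule grad_eqI) (simp add: has_derivative_mult_right assms test_function_has_derivative)

text \<open>The quotient u / (u + w) of two one-sided flat functions of |x|^2. The gap a < b keeps
  the denominator positive, and |x|^2 in place of |x| keeps everything smooth at 0.\<close>

lemma ex_cutoff:
  assumes "0 < a" "a < b"
  obtains \<zeta> where "test_function \<zeta>" "\<And>x. norm x \<le> a \<Longrightarrow> \<zeta> x = 1" "\<And>x. norm x \<ge> b \<Longrightarrow> \<zeta> x = 0"
proof -
  let ?u = "\<lambda>x::real^2. flat_exp 0 (b\<^sup>2 - x \<bullet> x)" and ?w = "\<lambda>x::real^2. flat_exp 0 (x \<bullet> x - a\<^sup>2)"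
  let ?\<zeta> = "\<lambda>x. ?u x / (?u x + ?w x)"
  have ab: "a\<^sup>2 < b\<^sup>2" using assms by (simp add: power_strict_mono)
  have ne: "?u x + ?w x \<noteq> 0" for x
  proof -
    have "?u x \<ge> 0" "?w x \<ge> 0" "?u x > 0 \<or> ?w x > 0"
      using ab by (auto simp: flat_exp_def)
    then show ?thesis by linarith
  qed
  have one: "?\<zeta> x = 1" if "norm x \<le> a" for x
  proof -
    have "?w x = 0" using that assms by (simp add: flat_exp_def norm_le_square)
    then show ?thesis using ne[of x] by simp
  qed
  have zero: "?\<zeta> x = 0" if "norm x \<ge> b" for x
  proof -
    have "?u x = 0" using that assms by (simp add: flat_exp_def norm_ge_square)
    then show ?thesis by simp
  qed
  have "test_function ?\<zeta>"
  proof (rule test_functionI)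
    show "C_k k ?\<zeta>" for k
      by (intro C_k_divide C_k_add C_k_flat_exp C_k_diff C_k_const C_k_inner_self ne)
    show "bounded {x. ?\<zeta> x \<noteq> 0}"
    proof (rule boundedI)
      fix x assume "x \<in> {x. ?\<zeta> x \<noteq> 0}"
      then show "norm x \<le> b" using zero[of x] by (cases "norm x \<ge> b") auto
    qed
  qed
  then show ?thesis using one zero that[of ?\<zeta>] by blast
qed

section \<open>Projection in spaces of square-integrable functions\<close>

text \<open>For c > 0 the vertex t = b / c gives the bound; c < 0 is impossible and c = 0 forces b =
  0.\<close>

lemma quadratic_nonneg_imp:
  fixes a b c :: real
  assumes "\<And>t. 0 \<le> a - 2 * t * b + t\<^sup>2 * c"
  shows "b\<^sup>2 \<le> a * c"
proof -
  have a: "0 \<le> a" using assms[of 0] by simp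
  consider "c > 0" | "c < 0" | "c = 0" by linarith
  then show ?thesis
  proof cases
    case 1
    have "0 \<le> a - b\<^sup>2 / c"
      using assms[of "b / c"] 1 by (simp add: power2_eq_square field_simps)
    then show ?thesis using 1 by (simp add: field_simps)
  next
    case 2
    \<comment> \<open>Chosen so that t^2 c = -(a + 1); adding the hypotheses at t and -t removes the
      linear term and leaves 0 <= -2.\<close>
    define t where "t = sqrt ((a + 1) / - c)"
    have "t\<^sup>2 = (a + 1) / - c"
      unfolding t_def using a 2 by (intro real_sqrt_pow2) (simp add: field_simps)
    then have "t\<^sup>2 * c = - (a + 1)" using 2 by simp
    then show ?thesis using assms[of t] assms[of "-t"] by simp
  next
    case 3
    have "b = 0"
    proof (rule ccontr)
      assume "b \<noteq> 0"
      then show False using assms[of "(a + 1) / (2 * b)"] 3 by (simp add: field_simps)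
    qed
    then show ?thesis by (simp add: 3)
  qed
qed

abbreviation nsq :: "'a measure \<Rightarrow> ('a \<Rightarrow> 'b::real_normed_vector) \<Rightarrow> real" where
  "nsq M f \<equiv> (LINT x|M. (norm (f x))\<^sup>2)"

lemma L2_measurable: "f \<in> L2 M \<Longrightarrow> f \<in> borel_measurable M"
  and L2_integrable_norm: "f \<in> L2 M \<Longrightarrow> integrable M (\<lambda>x. (norm (f x))\<^sup>2)"
  by (auto simp: L2_def)

lemma L2_bound:
  assumes "f \<in> borel_measurable M" "integrable M h" "AE x in M. (norm (f x))\<^sup>2 \<le> h x"
  shows "f \<in> L2 M"
  unfolding L2_def using assms
  by (auto intro!: Bochner_Integration.integrable_bound[OF assms(2)] elim: AE_mp)

lemma norm_add_sq_le: "(norm (x + y))\<^sup>2 \<le> 2 * (norm x)\<^sup>2 + 2 * (norm y)\<^sup>2" for x y :: "'a::real_normed_vector"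
proof -
  have "(norm (x + y))\<^sup>2 \<le> (norm x + norm y)\<^sup>2" by (intro power_mono norm_triangle_ineq) simp
  also have "\<dots> \<le> 2 * (norm x)\<^sup>2 + 2 * (norm y)\<^sup>2"
    using sum_squares_bound[of "norm x" "norm y"] by (simp add: power2_sum)
  finally show ?thesis .
qed

lemma L2_add:
  assumes "f \<in> L2 M" "g \<in> L2 M" shows "(\<lambda>x. f x + g x) \<in> L2 M"
  by (rule L2_bound[where h="\<lambda>x. 2 * (norm (f x))\<^sup>2 + 2 * (norm (g x))\<^sup>2"])
    (use assms in \<open>auto simp: L2_def norm_add_sq_le\<close>)

lemma nsq_add_le:
  assumes "f \<in> L2 M" "g \<in> L2 M"
  shows "nsq M (\<lambda>x. f x + g x) \<le> 2 * nsq M f + 2 * nsq M g"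
proof -
  have "nsq M (\<lambda>x. f x + g x) \<le> (LINT x|M. 2 * (norm (f x))\<^sup>2 + 2 * (norm (g x))\<^sup>2)"
    using assms L2_add[OF assms] by (intro integral_mono) (auto simp: L2_def norm_add_sq_le)
  also have "\<dots> = 2 * nsq M f + 2 * nsq M g"
    using assms by (simp add: L2_def)
  finally show ?thesis .
qed

lemma L2_scaleR:
  assumes "f \<in> L2 M" shows "(\<lambda>x. c *\<^sub>R f x) \<in> L2 M"
  using assms by (auto simp: L2_def power_mult_distrib)

lemma L2_uminus: "f \<in> L2 M \<Longrightarrow> (\<lambda>x. - f x) \<in> L2 M"
  using L2_scaleR[of f M "-1"] by simp

lemma L2_diff:
  assumes "f \<in> L2 M" "g \<in> L2 M" shows "(\<lambda>x. f x - g x) \<in> L2 M"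
  using L2_add[OF assms(1) L2_uminus[OF assms(2)]] by simp

lemma L2_inner_integrable:
  fixes f g :: "'a \<Rightarrow> 'b::euclidean_space"
  assumes "f \<in> L2 M" "g \<in> L2 M"
  shows "integrable M (\<lambda>x. f x \<bullet> g x)"
proof (rule Bochner_Integration.integrable_bound)
  show "integrable M (\<lambda>x. (norm (f x))\<^sup>2 + (norm (g x))\<^sup>2)"
    using assms by (simp add: L2_def)
  show "(\<lambda>x. f x \<bullet> g x) \<in> borel_measurable M"
    using assms by (auto simp: L2_def)
  have "norm (u \<bullet> v) \<le> norm ((norm u)\<^sup>2 + (norm v)\<^sup>2)" for u v :: 'b
    using Cauchy_Schwarz_ineq2[of u v] sum_squares_bound[of "norm u" "norm v"]
      zero_le_power2[of "norm u"] zero_le_power2[of "norm v"] mult_nonneg_nonneg[of "norm u" "norm v"]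
    by (simp add: mult.assoc)
  then show "AE x in M. norm (f x \<bullet> g x) \<le> norm ((norm (f x))\<^sup>2 + (norm (g x))\<^sup>2)" by simp
qed

lemma L2_bounded_mult:
  fixes Y :: "'a \<Rightarrow> 'b::euclidean_space"
  assumes A: "A \<in> borel_measurable M" "\<And>x. \<bar>A x\<bar> \<le> 1" and Y: "Y \<in> L2 M"
  shows "(\<lambda>x. A x *\<^sub>R Y x) \<in> L2 M"
proof (rule L2_bound[OF _ L2_integrable_norm[OF Y]])
  have "\<bar>A x\<bar> * norm (Y x) \<le> 1 * norm (Y x)" for x using A(2) by (intro mult_right_mono) auto
  then have "(\<bar>A x\<bar> * norm (Y x))\<^sup>2 \<le> (norm (Y x))\<^sup>2" for x by (intro power_mono) auto
  then show "AE x in M. (norm (A x *\<^sub>R Y x))\<^sup>2 \<le> (norm (Y x))\<^sup>2" by simp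
qed (intro borel_measurable_scaleR A L2_measurable Y)

lemma nsq_diff_scaleR:
  fixes f g :: "'a \<Rightarrow> 'b::euclidean_space"
  assumes "f \<in> L2 M" "g \<in> L2 M"
  shows "nsq M (\<lambda>x. f x - t *\<^sub>R g x) = nsq M f - 2 * t * (LINT x|M. f x \<bullet> g x) + t\<^sup>2 * nsq M g"
proof -
  have "(norm (f x - t *\<^sub>R g x))\<^sup>2 = (norm (f x))\<^sup>2 - 2 * t * (f x \<bullet> g x) + t\<^sup>2 * (norm (g x))\<^sup>2" for x
    unfolding power2_norm_eq_inner
    by (simp add: inner_diff inner_commute algebra_simps power2_eq_square)
  then show ?thesis
    using assms L2_inner_integrable[OF assms] by (simp add: L2_def)
qed

lemma L2_Cauchy_Schwarz:
  fixes f g :: "'a \<Rightarrow> 'b::euclidean_space"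
  assumes "f \<in> L2 M" "g \<in> L2 M"
  shows "(LINT x|M. f x \<bullet> g x)\<^sup>2 \<le> nsq M f * nsq M g"
proof (rule quadratic_nonneg_imp)
  show "0 \<le> nsq M f - 2 * t * (LINT x|M. f x \<bullet> g x) + t\<^sup>2 * nsq M g" for t
    by (subst nsq_diff_scaleR[OF assms, symmetric]) simp
qed

lemma L2_inner_tendsto:
  fixes f W :: "'a \<Rightarrow> 'b::euclidean_space"
  assumes "f \<in> L2 M" "W \<in> L2 M" "\<And>n. X n \<in> L2 M" "(\<lambda>n. nsq M (\<lambda>x. X n x - f x)) \<longlonglongrightarrow> 0"
  shows "(\<lambda>n. LINT x|M. W x \<bullet> X n x) \<longlonglongrightarrow> (LINT x|M. W x \<bullet> f x)"
proof -
  have "(\<lambda>n. (LINT x|M. W x \<bullet> (X n x - f x))\<^sup>2) \<longlonglongrightarrow> 0"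
  proof (rule tendsto_sandwich[of "\<lambda>_. 0"])
    show "\<forall>\<^sub>F n in sequentially. (LINT x|M. W x \<bullet> (X n x - f x))\<^sup>2 \<le> nsq M W * nsq M (\<lambda>x. X n x - f x)"
      by (intro always_eventually allI L2_Cauchy_Schwarz L2_diff assms)
    show "(\<lambda>n. nsq M W * nsq M (\<lambda>x. X n x - f x)) \<longlonglongrightarrow> 0"
      using tendsto_mult_right_zero[OF assms(4)] by simp
  qed auto
  then have "(\<lambda>n. LINT x|M. W x \<bullet> (X n x - f x)) \<longlonglongrightarrow> 0"
    using tendsto_real_sqrt[of "\<lambda>n. (LINT x|M. W x \<bullet> (X n x - f x))\<^sup>2" 0] by (simp add: tendsto_rabs_zero_iff)
  moreover have "(LINT x|M. W x \<bullet> (X n x - f x)) = (LINT x|M. W x \<bullet> X n x) - (LINT x|M. W x \<bullet> f x)" for n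
    using assms by (simp add: inner_diff_right L2_inner_integrable)
  ultimately show ?thesis by (simp add: LIM_zero_iff)
qed

lemma geometric_increments:
  fixes X :: "nat \<Rightarrow> 'b::real_normed_vector"
  assumes "\<And>n. norm (X (Suc n) - X n) \<le> s * (1/2) ^ n" "0 \<le> s"
  shows "norm (X (n + k) - X n) \<le> 2 * s * (1/2) ^ n"
proof -
  \<comment> \<open>The factor 1 - (1/2)^k makes the induction close and is dropped
    afterwards.\<close>
  have "norm (X (n + k) - X n) \<le> 2 * s * (1/2) ^ n * (1 - (1/2) ^ k)"
  proof (induction k)
    case (Suc k)
    have "norm (X (n + Suc k) - X n) \<le> norm (X (Suc (n + k)) - X (n + k)) + norm (X (n + k) - X n)"
      using norm_triangle_ineq[of "X (Suc (n + k)) - X (n + k)" "X (n + k) - X n"] by simp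
    also have "\<dots> \<le> s * (1/2) ^ (n + k) + 2 * s * (1/2) ^ n * (1 - (1/2) ^ k)"
      using assms(1)[of "n + k"] Suc by simp
    also have "\<dots> = 2 * s * (1/2) ^ n * (1 - (1/2) ^ Suc k)"
      by (simp add: power_add algebra_simps)
    finally show ?case .
  qed simp
  also have "\<dots> \<le> 2 * s * (1/2) ^ n * 1"
    using assms(2) by (intro mult_left_mono) auto
  finally show ?thesis by simp
qed

text \<open>Riesz-Fischer for fast increments. Even with weight 4^n the squared increments have
  summable integrals, and their sum S bounds the n-th increment pointwise by sqrt S / 2^n; this
  gives convergence almost everywhere and a rate in L2 at once.\<close>

lemma L2_complete:
  fixes X :: "nat \<Rightarrow> 'a \<Rightarrow> 'b::euclidean_space"
  assumes X: "\<And>n. X n \<in> L2 M" and inc: "\<And>n. nsq M (\<lambda>x. X (Suc n) x - X n x) \<le> (1/16) ^ n"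
  obtains P where "P \<in> L2 M" "(\<lambda>n. nsq M (\<lambda>x. X n x - P x)) \<longlonglongrightarrow> 0"
proof -
  define d where "d n x = 4 ^ n * (norm (X (Suc n) x - X n x))\<^sup>2" for n x
  define S where "S x = (\<Sum>n. d n x)" for x
  \<comment> \<open>Where the sequence diverges \<open>lim\<close> is some arbitrary value, but that
    happens on a null set only, and the total definition is measurable.\<close>
  define P where "P x = lim (\<lambda>n. X n x)" for x
  have [measurable]: "X n \<in> borel_measurable M" for n using X by (rule L2_measurable)
  have half_sq: "((1/2) ^ n)\<^sup>2 = (1/4 :: real) ^ n" for n
    by (simp add: power2_eq_square flip: power_mult_distrib)
  have d_nonneg: "0 \<le> d n x" for n x by (simp add: d_def)
  have d_int: "integrable M (d n)" for n
    unfolding d_def using L2_diff[OF X X] by (auto simp: L2_def)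
  have d_le: "(LINT x|M. d n x) \<le> (1/4) ^ n" for n
  proof -
    have "(LINT x|M. d n x) = 4 ^ n * nsq M (\<lambda>x. X (Suc n) x - X n x)" by (simp add: d_def)
    also have "\<dots> \<le> 4 ^ n * (1/16) ^ n" using inc by (intro mult_left_mono) auto
    also have "\<dots> = (1/4) ^ n" by (simp flip: power_mult_distrib)
    finally show ?thesis .
  qed
  have "(\<integral>\<^sup>+x. (\<Sum>n. ennreal (d n x)) \<partial>M) = (\<Sum>n. \<integral>\<^sup>+x. ennreal (d n x) \<partial>M)"
    using d_int by (intro nn_integral_suminf) auto
  also have "\<dots> = (\<Sum>n. ennreal (LINT x|M. d n x))"
    using d_int d_nonneg by (simp add: nn_integral_eq_integral)
  also have "\<dots> \<le> (\<Sum>n. ennreal ((1/4) ^ n))"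
    using d_le by (intro suminf_le) (auto simp: ennreal_leI)
  also have "\<dots> = ennreal (\<Sum>n. (1/4) ^ n)"
    by (rule suminf_ennreal2) (auto intro: summable_geometric)
  also have "\<dots> < \<infinity>" by simp
  finally have "AE x in M. (\<Sum>n. ennreal (d n x)) \<noteq> \<infinity>"
    using d_int by (intro nn_integral_noteq_infinite) auto
  then have summ: "AE x in M. summable (\<lambda>n. d n x)"
    by (rule eventually_mono) (rule summable_suminf_not_top[OF d_nonneg], simp)
  have S_int: "integrable M S"
    unfolding S_def
  proof (rule integrable_suminf)
    show "AE x in M. summable (\<lambda>n. norm (d n x))"
      using summ by (rule eventually_mono) (simp add: d_nonneg)
    show "summable (\<lambda>n. LINT x|M. norm (d n x))"
    proof (rule summable_comparison_test'[where N=0])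
      show "summable (\<lambda>n. (1/4::real) ^ n)" by (rule summable_geometric) simp
      show "norm (LINT x|M. norm (d n x)) \<le> (1/4) ^ n" for n
        using d_le[of n] d_nonneg by (simp add: integral_nonneg)
    qed
  qed (rule d_int)
  have PX: "(norm (X n x - P x))\<^sup>2 \<le> 4 * (1/4) ^ n * S x" if s: "summable (\<lambda>n. d n x)" for n x
  proof -
    have S0: "0 \<le> S x" unfolding S_def using s d_nonneg by (intro suminf_nonneg)
    have "norm (X (Suc n) x - X n x) \<le> sqrt (S x) * (1/2) ^ n" for n
    proof (rule power2_le_imp_le)
      have four_pow: "(2 ^ n)\<^sup>2 = (4 :: real) ^ n"
        by (simp add: power2_eq_square flip: power_mult_distrib)
      have "d n x \<le> S x"
        unfolding S_def using sum_le_suminf[OF s, of "{n}"] d_nonneg by simp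
      then show "(norm (X (Suc n) x - X n x))\<^sup>2 \<le> (sqrt (S x) * (1/2) ^ n)\<^sup>2"
        using S0 four_pow by (simp add: d_def power_mult_distrib half_sq power_one_over field_simps)
    qed (use S0 in simp)
    then have bd: "norm (X (n + k) x - X n x) \<le> 2 * sqrt (S x) * (1/2) ^ n" for n k
      by (rule geometric_increments[where X="\<lambda>n. X n x"]) (use S0 in simp)
    have "Cauchy (\<lambda>n. X n x)"
    proof (rule CauchyI')
      fix e :: real assume "0 < e"
      have "(\<lambda>n. 2 * sqrt (S x) * (1/2) ^ n) \<longlonglongrightarrow> 0"
        by (intro tendsto_mult_right_zero LIMSEQ_realpow_zero) auto
      from order_tendstoD(2)[OF this \<open>0 < e\<close>]
      obtain N where N: "2 * sqrt (S x) * (1/2) ^ n < e" if "n \<ge> N" for n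
        unfolding eventually_sequentially by blast
      have "dist (X m x) (X n x) < e" if "m \<ge> N" "n > m" for m n
        using bd[of m "n - m"] N[of m] that by (simp add: dist_norm norm_minus_commute)
      then show "\<exists>M. \<forall>m\<ge>M. \<forall>n>m. dist (X m x) (X n x) < e" by blast
    qed
    then have lim: "(\<lambda>n. X n x) \<longlonglongrightarrow> P x"
      unfolding P_def by (rule convergent_LIMSEQ_iff[THEN iffD1, OF Cauchy_convergent])
    have "(\<lambda>k. norm (X (n + k) x - X n x)) \<longlonglongrightarrow> norm (P x - X n x)"
      using LIMSEQ_ignore_initial_segment[OF lim, of n] by (intro tendsto_intros) (simp add: add.commute)
    then have "norm (P x - X n x) \<le> 2 * sqrt (S x) * (1/2) ^ n"
      by (rule LIMSEQ_le_const2) (use bd in auto)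
    then have "(norm (X n x - P x))\<^sup>2 \<le> (2 * sqrt (S x) * (1/2) ^ n)\<^sup>2"
      by (intro power_mono) (auto simp: norm_minus_commute)
    also have "\<dots> = 4 * (1/4) ^ n * S x"
      using S0 by (simp add: power_mult_distrib half_sq)
    finally show ?thesis .
  qed
  have [measurable]: "P \<in> borel_measurable M" unfolding P_def by measurable
  have PX': "AE x in M. (norm (X n x - P x))\<^sup>2 \<le> 4 * (1/4) ^ n * S x" for n
    using summ by (rule eventually_mono) (rule PX)
  have L: "(\<lambda>x. X n x - P x) \<in> L2 M" for n
    using S_int by (intro L2_bound[OF _ _ PX']) auto
  show ?thesis
  proof (rule that)
    show "P \<in> L2 M" using L2_diff[OF X L, of 0 0] by simp
    show "(\<lambda>n. nsq M (\<lambda>x. X n x - P x)) \<longlonglongrightarrow> 0"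
    proof (rule tendsto_sandwich[of "\<lambda>_. 0"])
      show "\<forall>\<^sub>F n in sequentially. nsq M (\<lambda>x. X n x - P x) \<le> 4 * (1/4) ^ n * (LINT x|M. S x)"
      proof (intro always_eventually allI)
        fix n
        have "nsq M (\<lambda>x. X n x - P x) \<le> (LINT x|M. 4 * (1/4) ^ n * S x)"
          using L[of n] S_int by (intro integral_mono_AE PX') (auto simp: L2_def)
        then show "nsq M (\<lambda>x. X n x - P x) \<le> 4 * (1/4) ^ n * (LINT x|M. S x)" by simp
      qed
      show "(\<lambda>n. 4 * (1/4) ^ n * (LINT x|M. S x)) \<longlonglongrightarrow> 0"
        by (intro tendsto_mult_left_zero tendsto_mult_right_zero LIMSEQ_realpow_zero) auto
    qed auto
  qed
qed

text \<open>A sequence minimizing the distance from X to V is Cauchy by the parallelogram identity.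
  V need not be closed, so P may lie outside it, and the approximating sequence is returned as the
  link between the two.\<close>

lemma L2_projection:
  fixes X :: "'a \<Rightarrow> 'b::euclidean_space"
  assumes X: "X \<in> L2 M" and V: "V \<subseteq> L2 M" "V \<noteq> {}"
    and add: "\<And>f g. f \<in> V \<Longrightarrow> g \<in> V \<Longrightarrow> (\<lambda>x. f x + g x) \<in> V"
    and scale: "\<And>c f. f \<in> V \<Longrightarrow> (\<lambda>x. c *\<^sub>R f x) \<in> V"
  shows "\<exists>P v. P \<in> L2 M \<and> (\<forall>n. v n \<in> V) \<and> (\<lambda>n. nsq M (\<lambda>x. v n x - P x)) \<longlonglongrightarrow> 0 \<and>
    (\<forall>w\<in>V. (LINT x|M. (X x - P x) \<bullet> w x) = 0)"
proof -
  define D where "D v = nsq M (\<lambda>x. X x - v x)" for v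
  define m where "m = (INF v\<in>V. D v)"
  \<comment> \<open>With this accuracy the parallelogram identity bounds the squared increments by 2
    \<epsilon> (Suc n) + 2 \<epsilon> n, which is below the rate (1/16)^n that
    \<open>L2_complete\<close> asks for.\<close>
  define \<epsilon> where "\<epsilon> n = (1/4) * (1/16 :: real) ^ n" for n
  have bdd: "bdd_below (D ` V)" by (rule bdd_belowI[of _ 0]) (auto simp: D_def)
  have lower: "m \<le> D v" if "v \<in> V" for v
    unfolding m_def using bdd that by (rule cINF_lower)
  have "\<exists>v\<in>V. D v < m + \<epsilon> n" for n
    using cINF_less_iff[OF V(2) bdd, of "m + \<epsilon> n"] by (simp add: m_def \<epsilon>_def)
  then obtain v where v: "\<And>n. v n \<in> V" and vD: "\<And>n. D (v n) < m + \<epsilon> n" by metis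
  have vL: "v n \<in> L2 M" for n using v V by auto
  have "nsq M (\<lambda>x. v (Suc n) x - v n x) \<le> (1/16) ^ n" for n
  proof -
    let ?a = "\<lambda>x. X x - v (Suc n) x" and ?b = "\<lambda>x. X x - v n x"
    let ?w = "\<lambda>x. (1/2) *\<^sub>R (v (Suc n) x + v n x)"
    have "nsq M (\<lambda>x. v (Suc n) x - v n x) = (LINT x|M. 2 * (norm (?a x))\<^sup>2 + 2 * (norm (?b x))\<^sup>2 - 4 * (norm (X x - ?w x))\<^sup>2)"
    proof (rule Bochner_Integration.integral_cong[OF refl])
      fix x
      show "(norm (v (Suc n) x - v n x))\<^sup>2 = 2 * (norm (?a x))\<^sup>2 + 2 * (norm (?b x))\<^sup>2 - 4 * (norm (X x - ?w x))\<^sup>2"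
        unfolding power2_norm_eq_inner
        by (simp add: inner_diff inner_add inner_commute algebra_simps)
    qed
    also have "\<dots> = 2 * D (v (Suc n)) + 2 * D (v n) - 4 * D ?w"
      unfolding D_def using L2_integrable_norm[OF L2_diff[OF X vL]]
        L2_integrable_norm[OF L2_diff[OF X L2_scaleR[OF L2_add[OF vL vL]]]] by simp
    also have "\<dots> \<le> 2 * \<epsilon> (Suc n) + 2 * \<epsilon> n"
      using vD[of n] vD[of "Suc n"] lower[OF scale[OF add[OF v v]], of "1/2" "Suc n" n] by linarith
    also have "\<dots> \<le> (1/16) ^ n" by (simp add: \<epsilon>_def)
    finally show ?thesis .
  qed
  then obtain P where P: "P \<in> L2 M" "(\<lambda>n. nsq M (\<lambda>x. v n x - P x)) \<longlonglongrightarrow> 0"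
    by (rule L2_complete[OF vL])
  have "(LINT x|M. (X x - P x) \<bullet> w x) = 0" if w: "w \<in> V" for w
  proof -
    have wL: "w \<in> L2 M" using w V by auto
    define I where "I n = (LINT x|M. (X x - v n x) \<bullet> w x)" for n
    \<comment> \<open>Moving from \<open>v n\<close> along w cannot lower the squared distance by
      more than \<epsilon> n, so the quadratic in t is nonnegative and its discriminant bounds the
      inner product.\<close>
    have le: "(I n)\<^sup>2 \<le> \<epsilon> n * nsq M w" for n
    proof (rule quadratic_nonneg_imp)
      fix t
      have "m \<le> D (\<lambda>x. v n x + t *\<^sub>R w x)" by (intro lower add v scale w)
      also have "\<dots> = nsq M (\<lambda>x. (X x - v n x) - t *\<^sub>R w x)" by (simp add: D_def algebra_simps)
      also have "\<dots> = D (v n) - 2 * t * I n + t\<^sup>2 * nsq M w"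
        unfolding D_def I_def by (rule nsq_diff_scaleR[OF L2_diff[OF X vL] wL])
      finally show "0 \<le> \<epsilon> n - 2 * t * I n + t\<^sup>2 * nsq M w" using vD[of n] by linarith
    qed
    have "I n = (LINT x|M. w x \<bullet> (X x - v n x))" for n
      by (simp only: I_def inner_commute)
    then have I_eq: "I n = (LINT x|M. w x \<bullet> X x) - (LINT x|M. w x \<bullet> v n x)" for n
      using X vL wL by (simp add: inner_diff_right L2_inner_integrable)
    have "I \<longlonglongrightarrow> (LINT x|M. w x \<bullet> X x) - (LINT x|M. w x \<bullet> P x)"
      unfolding I_eq by (intro tendsto_intros L2_inner_tendsto P wL vL)
    moreover have "(LINT x|M. w x \<bullet> X x) - (LINT x|M. w x \<bullet> P x) = (LINT x|M. (X x - P x) \<bullet> w x)"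
      using X P wL by (subst inner_commute) (simp add: inner_diff_right L2_inner_integrable)
    ultimately have "(\<lambda>n. (I n)\<^sup>2) \<longlonglongrightarrow> (LINT x|M. (X x - P x) \<bullet> w x)\<^sup>2"
      by (intro tendsto_intros) simp
    moreover have "(\<lambda>n. \<epsilon> n * nsq M w) \<longlonglongrightarrow> 0"
      unfolding \<epsilon>_def by (intro tendsto_mult_left_zero tendsto_mult_right_zero LIMSEQ_realpow_zero) auto
    ultimately have "(LINT x|M. (X x - P x) \<bullet> w x)\<^sup>2 \<le> 0"
      by (rule LIMSEQ_le) (use le in blast)
    then show ?thesis by simp
  qed
  then show ?thesis using P v by blast
qed

section \<open>Integration by parts and curl-free fields\<close>

text \<open>Boxes are an intersection-stable generator of the Borel sets, and the whole space is an
  increasing union of them; the vanishing therefore spreads to all Borel sets by a Dynkin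
  argument.\<close>

lemma AE_zero_if_box_integrals_zero:
  fixes E :: "'a::euclidean_space \<Rightarrow> 'b::{banach, second_countable_topology}"
  assumes E: "integrable lborel E" and box: "\<And>a b. (LINT x:box a b|lborel. E x) = 0"
  shows "AE x in lborel. E x = 0"
proof (rule sigma_finite_measure.density_zero[OF sigma_finite_lborel E])
  fix A :: "'a set" assume "A \<in> sets lborel"
  then have A: "A \<in> sigma_sets UNIV (range (\<lambda>(a, b). box a b))"
    by (simp add: borel_eq_box)
  have sets: "sigma_sets UNIV (range (\<lambda>(a, b). box a b)) = sets (borel :: 'a measure)"
    by (simp add: borel_eq_box)
  have SI: "set_integrable lborel B E" if "B \<in> sets borel" for B
    unfolding set_integrable_def using that E by (intro integrable_mult_indicator) auto
  have UNIV0: "(LINT x:UNIV|lborel. E x) = 0"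
  proof -
    let ?B = "\<lambda>n::nat. box (- (real n *\<^sub>R One)) (real n *\<^sub>R One) :: 'a set"
    have "incseq ?B"
      by (auto simp: incseq_def mem_box; force)
    then have "(\<lambda>n. LINT x:?B n|lborel. E x) \<longlonglongrightarrow> (LINT x:(\<Union>n. ?B n)|lborel. E x)"
      by (intro set_integral_cont_up) (auto simp: UN_box_eq_UNIV intro: SI)
    then show ?thesis
      unfolding box UN_box_eq_UNIV by (simp add: LIMSEQ_const_iff)
  qed
  have IS: "Int_stable (range (\<lambda>(a, b). box a b :: 'a set))"
  proof (rule Int_stableI_image)
    fix i j :: "'a \<times> 'a"
    show "\<exists>k\<in>UNIV. (case i of (a, b) \<Rightarrow> box a b) \<inter> (case j of (a, b) \<Rightarrow> box a b) = (case k of (a, b) \<Rightarrow> box a b)"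
      by (cases i; cases j; simp only: prod.case box_Int_box) (metis (no_types, lifting) UNIV_I case_prod_conv)
  qed
  have "range (\<lambda>(a, b). box a b) \<subseteq> Pow (UNIV :: 'a set)" by simp
  from IS this A show "(LINT x:A|lborel. E x) = 0"
  proof (induction rule: sigma_sets_induct_disjoint)
    case (basic A)
    then show ?case using box by auto
  next
    case empty
    then show ?case by (simp add: set_lebesgue_integral_def)
  next
    case (compl A)
    then have A: "A \<in> sets borel" by (simp add: sets)
    have "(LINT x:A \<union> - A|lborel. E x) = (LINT x:A|lborel. E x) + (LINT x:- A|lborel. E x)"
      using A by (intro set_integral_Un SI) auto
    then show ?case using UNIV0 compl by (simp add: Compl_eq_Diff_UNIV)
  next
    case (union A)
    then have A: "A i \<in> sets borel" for i by (auto simp: sets)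
    have "(LINT x:(\<Union>i. A i)|lborel. E x) = (\<Sum>i. (LINT x:(A i)|lborel. E x))"
      using A union by (intro lebesgue_integral_countable_add SI) (auto simp: disjoint_family_on_def)
    then show ?case using union by simp
  qed
qed

section \<open>Integration by parts for locally Lipschitz functions\<close>

text \<open>The constant may depend on the ball, which is what polynomial primitives provide; a test
  function of bounded support only sees one ball.\<close>

definition lipschitz_on_balls :: "(real^2 \<Rightarrow> real) \<Rightarrow> bool" where
  "lipschitz_on_balls s \<longleftrightarrow> (\<forall>r. \<exists>L. L-lipschitz_on (cball 0 r) s)"

lemma lipschitz_on_balls_continuous: "lipschitz_on_balls s \<Longrightarrow> continuous_on UNIV s"
proof (rule continuous_at_imp_continuous_on, safe)
  fix x :: "real^2" assume "lipschitz_on_balls s"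
  then obtain L where "L-lipschitz_on (cball 0 (norm x + 1)) s" by (auto simp: lipschitz_on_balls_def)
  then have "continuous_on (cball 0 (norm x + 1)) s" by (rule lipschitz_on_continuous_on)
  then show "isCont s x" by (rule continuous_on_interior) simp
qed

lemma test_function_support:
  assumes "test_function \<phi>"
  obtains r where "0 < r" "\<And>x. norm x > r \<Longrightarrow> \<phi> x = 0" "\<And>x. norm x > r \<Longrightarrow> grad \<phi> x = 0"
proof -
  have "bounded ({x. \<phi> x \<noteq> 0} \<union> {x. grad \<phi> x $ 1 \<noteq> 0} \<union> {x. grad \<phi> x $ 2 \<noteq> 0})"
    using assms test_function_bounded_support test_function_grad by auto
  then obtain r where r: "0 < r" "\<forall>x\<in>{x. \<phi> x \<noteq> 0} \<union> {x. grad \<phi> x $ 1 \<noteq> 0} \<union> {x. grad \<phi> x $ 2 \<noteq> 0}. norm x \<le> r"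
    unfolding bounded_pos by blast
  show ?thesis
    by (rule that[OF r(1)]) (use r(2) in \<open>auto simp: vec_eq_iff forall_2 not_le[symmetric]\<close>)
qed

lemma test_function_lipschitz:
  assumes "test_function \<phi>"
  obtains L where "L-lipschitz_on UNIV \<phi>"
proof -
  obtain r where r: "0 < r" "\<And>x. norm x > r \<Longrightarrow> grad \<phi> x = 0"
    using test_function_support[OF assms] by metis
  have "bounded (grad \<phi> ` cball 0 r)"
    using grad_continuous[OF assms] continuous_on_subset
    by (intro compact_imp_bounded compact_continuous_image) auto
  then obtain B where B: "0 < B" "\<And>x. norm x \<le> r \<Longrightarrow> norm (grad \<phi> x) \<le> B"
    unfolding bounded_pos by auto
  have B': "norm (grad \<phi> x) \<le> B" for x
    using B r(2)[of x] by (cases "norm x \<le> r") auto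
  have "B-lipschitz_on UNIV \<phi>"
  proof (rule lipschitz_onI)
    fix x y
    have "norm (\<phi> x - \<phi> y) \<le> B * norm (x - y)"
    proof (rule differentiable_bound[where S=UNIV and f'="\<lambda>x v. grad \<phi> x \<bullet> v"])
      show "onorm (\<lambda>v. grad \<phi> x \<bullet> v) \<le> B" for x
        by (rule order_trans[OF onorm_le[where b="norm (grad \<phi> x)"] B']) (simp add: Cauchy_Schwarz_ineq2)
    qed (auto intro: test_function_has_derivative assms)
    then show "dist (\<phi> x) (\<phi> y) \<le> B * dist x y" by (simp add: dist_norm)
  qed (use B in auto)
  then show ?thesis by (rule that)
qed

lemma test_function_lipschitz_on_balls: "test_function \<phi> \<Longrightarrow> lipschitz_on_balls \<phi>"
  by (meson lipschitz_on_balls_def lipschitz_on_subset subset_UNIV test_function_lipschitz)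

lemma test_function_borel: "test_function \<phi> \<Longrightarrow> \<phi> \<in> borel_measurable borel"
  and grad_borel: "test_function \<phi> \<Longrightarrow> grad \<phi> \<in> borel_measurable borel"
  by (simp_all add: test_function_continuous grad_continuous borel_measurable_continuous_onI)

lemma integrable_continuous_bounded_support:
  fixes f :: "'a::euclidean_space \<Rightarrow> 'b::{banach, second_countable_topology}"
  assumes "continuous_on UNIV f" "\<And>x. norm x > r \<Longrightarrow> f x = 0"
  shows "integrable lborel f"
proof -
  have "integrable lborel (\<lambda>x. indicator (cball 0 r) x *\<^sub>R f x)"
    using assms(1) continuous_on_subset by (intro borel_integrable_compact) auto
  also have "(\<lambda>x. indicator (cball 0 r) x *\<^sub>R f x) = f"
    using assms(2) by (auto simp: indicator_def fun_eq_iff not_le)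
  finally show ?thesis .
qed

lemma lborel_integral_shift:
  fixes f :: "'a::euclidean_space \<Rightarrow> real"
  assumes "f \<in> borel_measurable borel"
  shows "(LINT x|lborel. f (x + c)) = (LINT x|lborel. f x)"
proof -
  have "(LINT x|lborel. f x) = (LINT x|distr lborel borel ((+) c). f x)"
    by (simp add: lborel_distr_plus)
  also have "\<dots> = (LINT x|lborel. f (c + x))"
    using assms by (intro integral_distr) auto
  finally show ?thesis by (simp add: add.commute)
qed

lemma difference_quotient_tendsto:
  fixes s :: "'a::real_normed_vector \<Rightarrow> real"
  assumes "(s has_derivative D) (at x)" "t \<longlonglongrightarrow> 0" "\<And>n. t n \<noteq> 0"
  shows "(\<lambda>n. (s (x + t n *\<^sub>R v) - s x) / t n) \<longlonglongrightarrow> D v"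
proof -
  have "((\<lambda>h. s (x + h *\<^sub>R v)) has_derivative (\<lambda>h. D (h *\<^sub>R v))) (at 0)"
    by (rule has_derivative_compose[where f="\<lambda>h. x + h *\<^sub>R v"]) (use assms(1) in \<open>auto intro!: derivative_eq_intros\<close>)
  then have "((\<lambda>h. s (x + h *\<^sub>R v)) has_real_derivative D v) (at 0)"
    using linear_cmul[OF has_derivative_linear[OF assms(1)]]
    by (simp add: has_field_derivative_def mult_commute_abs)
  then have "((\<lambda>h. (s (x + h *\<^sub>R v) - s x) / h) \<longlongrightarrow> D v) (at 0)"
    by (simp add: DERIV_def)
  moreover have "filterlim t (at 0) sequentially"
    using assms by (simp add: filterlim_at)
  ultimately show ?thesis by (rule filterlim_compose)
qed

text \<open>
  Integration by parts by translation invariance of Lebesgue measure: difference quotients move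
  from one factor to the other, and the Lipschitz bound allows passing to the limit.
\<close>

lemma integral_by_parts_lipschitz:
  assumes lip: "lipschitz_on_balls s"
    and deriv: "AE x in lebesgue. (s has_derivative (\<lambda>w. g x \<bullet> w)) (at x)"
    and g: "g \<in> borel_measurable lebesgue"
    and \<psi>: "test_function \<psi>"
  shows "integrable lebesgue (\<lambda>x. \<psi> x * (g x \<bullet> v))"
    and "(LINT x|lebesgue. \<psi> x * (g x \<bullet> v)) = - (LINT x|lebesgue. s x * (grad \<psi> x \<bullet> v))"
proof -
  define t where "t n = inverse (real (Suc n))" for n
  have t0: "t \<longlonglongrightarrow> 0"
    unfolding t_def by (rule LIMSEQ_inverse_real_of_nat)
  have t: "t n \<noteq> 0" "0 < t n" "t n \<le> 1" for n
    by (auto simp: t_def divide_simps)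
  obtain r where r: "0 < r" "\<And>x. norm x > r \<Longrightarrow> \<psi> x = 0" "\<And>x. norm x > r \<Longrightarrow> grad \<psi> x = 0"
    using test_function_support[OF \<psi>] by metis
  \<comment> \<open>As \<open>t n\<close> is at most 1, translations move points by at most
    \<open>norm v\<close>, so this ball contains all shifted supports.\<close>
  define r' where "r' = r + norm v"
  obtain L where L: "L-lipschitz_on (cball 0 r') s" using lip by (auto simp: lipschitz_on_balls_def)
  obtain L' where L': "L'-lipschitz_on UNIV \<psi>" using test_function_lipschitz[OF \<psi>] .
  note sc = lipschitz_on_balls_continuous[OF lip] and \<psi>c = test_function_continuous[OF \<psi>]
  note gc = grad_continuous[OF \<psi>]
  have [measurable]: "s \<in> borel_measurable borel" "\<psi> \<in> borel_measurable borel"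
    using sc \<psi>c by (auto intro: borel_measurable_continuous_onI)
  have bor: "f \<in> borel_measurable lebesgue" if "f \<in> borel_measurable borel" for f :: "real^2 \<Rightarrow> real"
    using that by (intro measurable_completion) simp
  define a where "a n x = (s (x + t n *\<^sub>R v) - s x) / t n * \<psi> x" for n x
  define b where "b n x = s x * ((\<psi> (x + (- t n) *\<^sub>R v) - \<psi> x) / - t n)" for n x
  have [measurable]: "a n \<in> borel_measurable borel" "b n \<in> borel_measurable borel" for n
    unfolding a_def b_def by measurable
  have ab: "(LINT x|lborel. a n x) = - (LINT x|lborel. b n x)" for n
  proof -
    have i1: "integrable lborel (\<lambda>x. s (x + t n *\<^sub>R v) * \<psi> x)"
      by (rule integrable_continuous_bounded_support[of _ r])
        (use r in \<open>auto intro!: continuous_intros continuous_on_compose2[OF sc] \<psi>c\<close>)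
    have i2: "integrable lborel (\<lambda>x. s x * \<psi> x)"
      by (rule integrable_continuous_bounded_support[of _ r])
        (use r in \<open>auto intro!: continuous_intros sc \<psi>c\<close>)
    have i3: "integrable lborel (\<lambda>x. s x * \<psi> (x - t n *\<^sub>R v))"
    proof (rule integrable_continuous_bounded_support[of _ "r'"])
      fix x :: "real^2" assume "norm x > r'"
      moreover have "norm (t n *\<^sub>R v) \<le> norm v"
        using t[of n] by (simp add: mult_left_le_one_le)
      ultimately have "norm (x - t n *\<^sub>R v) > r"
        using norm_triangle_ineq2[of x "t n *\<^sub>R v"] by (simp add: r'_def)
      then show "s x * \<psi> (x - t n *\<^sub>R v) = 0" using r by simp
    qed (auto intro!: continuous_intros sc continuous_on_compose2[OF \<psi>c])
    have sh: "(LINT x|lborel. s (x + t n *\<^sub>R v) * \<psi> x) = (LINT x|lborel. s x * \<psi> (x - t n *\<^sub>R v))"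
      using lborel_integral_shift[of "\<lambda>x. s x * \<psi> (x - t n *\<^sub>R v)" "t n *\<^sub>R v"] by simp
    have "(LINT x|lborel. a n x) = (LINT x|lborel. (s (x + t n *\<^sub>R v) * \<psi> x - s x * \<psi> x) / t n)"
      by (simp add: a_def algebra_simps)
    also have "\<dots> = ((LINT x|lborel. s x * \<psi> (x - t n *\<^sub>R v)) - (LINT x|lborel. s x * \<psi> x)) / t n"
      using i1 i2 sh by simp
    also have "\<dots> = (LINT x|lborel. (s x * \<psi> (x - t n *\<^sub>R v) - s x * \<psi> x) / t n)"
      using i2 i3 by simp
    also have "\<dots> = - (LINT x|lborel. b n x)"
      unfolding b_def by (simp add: algebra_simps flip: integral_minus)
    finally show ?thesis .
  qed
  have lim_a: "AE x in lebesgue. (\<lambda>n. a n x) \<longlonglongrightarrow> \<psi> x * (g x \<bullet> v)"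
    using deriv
  proof (rule eventually_mono)
    fix x assume "(s has_derivative (\<lambda>w. g x \<bullet> w)) (at x)"
    from difference_quotient_tendsto[where v=v, OF this t0 t(1)]
    show "(\<lambda>n. a n x) \<longlonglongrightarrow> \<psi> x * (g x \<bullet> v)"
      unfolding a_def by (subst mult.commute) (intro tendsto_intros)
  qed
  have bd_a: "norm (a n x) \<le> L * norm v * norm (\<psi> x)" for n x
  proof (cases "norm x \<le> r")
    case True
    have "norm (x + t n *\<^sub>R v) \<le> r'"
      using norm_triangle_ineq[of x "t n *\<^sub>R v"] True t[of n] mult_left_le_one_le[of "norm v" "t n"] by (simp add: r'_def)
    then have "dist (s (x + t n *\<^sub>R v)) (s x) \<le> L * dist (x + t n *\<^sub>R v) x"
      using True by (intro lipschitz_onD[OF L]) (auto simp: r'_def add_increasing2)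
    then have "\<bar>(s (x + t n *\<^sub>R v) - s x) / t n\<bar> \<le> L * norm v"
      using t[of n] by (simp add: dist_norm divide_simps mult.commute mult.left_commute)
    then show ?thesis unfolding a_def norm_mult by (intro mult_right_mono) auto
  next
    case False
    then show ?thesis using r by (simp add: a_def)
  qed
  have bd_int: "integrable lborel (\<lambda>x. L * norm v * norm (\<psi> x))"
    by (rule integrable_continuous_bounded_support[of _ r]) (use r in \<open>auto intro!: continuous_intros \<psi>c\<close>)
  have bd_int': "integrable lebesgue (\<lambda>x. L * norm v * norm (\<psi> x))"
    using bd_int by (simp add: integrable_completion)
  have meas: "(\<lambda>x. \<psi> x * (g x \<bullet> v)) \<in> borel_measurable lebesgue"
    using g bor[of \<psi>] by (intro borel_measurable_times borel_measurable_inner) auto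
  show "integrable lebesgue (\<lambda>x. \<psi> x * (g x \<bullet> v))"
    by (rule integrable_dominated_convergence[OF meas bor bd_int' lim_a]) (use bd_a in simp_all)
  have "(\<lambda>n. LINT x|lebesgue. a n x) \<longlonglongrightarrow> (LINT x|lebesgue. \<psi> x * (g x \<bullet> v))"
    by (rule integral_dominated_convergence[OF meas bor bd_int' lim_a]) (use bd_a in simp_all)
  then have A: "(\<lambda>n. LINT x|lborel. a n x) \<longlonglongrightarrow> (LINT x|lebesgue. \<psi> x * (g x \<bullet> v))"
    by (simp add: integral_completion)
  have "(\<lambda>n. LINT x|lborel. b n x) \<longlonglongrightarrow> (LINT x|lborel. s x * (grad \<psi> x \<bullet> v))"
  proof (rule integral_dominated_convergence)
    let ?w = "\<lambda>x. indicator (cball 0 r') x *\<^sub>R (\<bar>s x\<bar> * (L' * norm v))"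
    show "integrable lborel ?w"
      by (intro borel_integrable_compact continuous_intros continuous_on_subset[OF sc]) auto
    show "AE x in lborel. (\<lambda>n. b n x) \<longlonglongrightarrow> s x * (grad \<psi> x \<bullet> v)"
      unfolding b_def
      by (intro AE_I2 tendsto_intros difference_quotient_tendsto[OF test_function_has_derivative[OF \<psi>]])
        (use t tendsto_minus[OF t0] in auto)
    show "AE x in lborel. norm (b n x) \<le> ?w x" for n
    proof (rule AE_I2)
      fix x
      have le: "\<bar>(\<psi> (x + (- t n) *\<^sub>R v) - \<psi> x) / - t n\<bar> \<le> L' * norm v"
        using lipschitz_onD[OF L', of "x + (- t n) *\<^sub>R v" x] t[of n]
        by (simp add: dist_norm divide_simps mult.commute mult.left_commute)
      show "norm (b n x) \<le> ?w x"
      proof (cases "norm x \<le> r'")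
        case True
        then show ?thesis using mult_left_mono[OF le, of "\<bar>s x\<bar>"] by (simp add: b_def abs_mult)
      next
        case False
        have "norm (t n *\<^sub>R v) \<le> norm v"
          using t[of n] by (simp add: mult_left_le_one_le)
        with False have "norm (x - t n *\<^sub>R v) > r"
          using norm_triangle_ineq2[of x "t n *\<^sub>R v"] by (simp add: r'_def)
        moreover have "norm x > r" using False by (simp add: r'_def) (smt (verit) norm_ge_zero)
        ultimately show ?thesis using r False by (simp add: b_def)
      qed
    qed
    show "(\<lambda>x. s x * (grad \<psi> x \<bullet> v)) \<in> borel_measurable lborel"
      using grad_borel[OF \<psi>] by simp
  qed simp
  then have "(\<lambda>n. - (LINT x|lborel. b n x)) \<longlonglongrightarrow> - (LINT x|lborel. s x * (grad \<psi> x \<bullet> v))"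
    by (rule tendsto_minus)
  with A have "(LINT x|lebesgue. \<psi> x * (g x \<bullet> v)) = - (LINT x|lborel. s x * (grad \<psi> x \<bullet> v))"
    unfolding ab by (rule LIMSEQ_unique)
  then show "(LINT x|lebesgue. \<psi> x * (g x \<bullet> v)) = - (LINT x|lebesgue. s x * (grad \<psi> x \<bullet> v))"
    using grad_borel[OF \<psi>] by (simp add: integral_completion)
qed

section \<open>Symmetry of second derivatives and weakly curl-free fields\<close>

text \<open>The mean value theorem twice, first along axis i and then along axis j. The left side is
  symmetric in i and j and the right side is not, so letting h tend to 0 yields the equality of
  mixed partials.\<close>

lemma second_difference:
  assumes \<phi>: "test_function \<phi>" and h: "0 < h"
  obtains p where "norm (p - x) \<le> 2 * h"
    "\<phi> (x + h *\<^sub>R axis i 1 + h *\<^sub>R axis j 1) - \<phi> (x + h *\<^sub>R axis i 1) - \<phi> (x + h *\<^sub>R axis j 1) + \<phi> x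
      = h\<^sup>2 * (grad (\<lambda>y. grad \<phi> y $ i) p $ j)"
proof -
  let ?a = "axis i 1 :: real^2" and ?b = "axis j 1 :: real^2"
  have line: "((\<lambda>t. f (y + t *\<^sub>R axis k 1)) has_real_derivative grad f (y + t *\<^sub>R axis k 1) $ k) (at t)"
    if "test_function f" for f y t and k :: 2
  proof -
    have "((\<lambda>t. f (y + t *\<^sub>R axis k 1)) has_derivative (\<lambda>u. grad f (y + t *\<^sub>R axis k 1) \<bullet> (u *\<^sub>R axis k 1))) (at t)"
      by (rule has_derivative_compose[where f="\<lambda>t. y + t *\<^sub>R axis k 1", OF _ test_function_has_derivative[OF that]])
        (auto intro!: derivative_eq_intros)
    then show ?thesis by (simp add: has_field_derivative_def inner_axis mult_commute_abs)
  qed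
  define F where "F t = \<phi> ((x + h *\<^sub>R ?b) + t *\<^sub>R ?a) - \<phi> (x + t *\<^sub>R ?a)" for t
  have "\<exists>z>0. z < h \<and> F h - F 0 = (h - 0) * (grad \<phi> ((x + h *\<^sub>R ?b) + z *\<^sub>R ?a) $ i - grad \<phi> (x + z *\<^sub>R ?a) $ i)"
    unfolding F_def by (intro MVT2 h DERIV_diff line \<phi>)
  then obtain z where z: "0 < z" "z < h"
    "F h - F 0 = h * (grad \<phi> ((x + h *\<^sub>R ?b) + z *\<^sub>R ?a) $ i - grad \<phi> (x + z *\<^sub>R ?a) $ i)" by auto
  let ?G = "\<lambda>u. grad \<phi> ((x + z *\<^sub>R ?a) + u *\<^sub>R ?b) $ i"
  have "\<exists>w>0. w < h \<and> ?G h - ?G 0 = (h - 0) * (grad (\<lambda>y. grad \<phi> y $ i) ((x + z *\<^sub>R ?a) + w *\<^sub>R ?b) $ j)"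
    by (intro MVT2 h line test_function_grad \<phi>)
  then obtain w where w: "0 < w" "w < h"
    "?G h - ?G 0 = h * (grad (\<lambda>y. grad \<phi> y $ i) ((x + z *\<^sub>R ?a) + w *\<^sub>R ?b) $ j)" by auto
  show ?thesis
  proof (rule that)
    have "norm ((x + z *\<^sub>R ?a) + w *\<^sub>R ?b - x) \<le> norm (z *\<^sub>R ?a) + norm (w *\<^sub>R ?b)"
      using norm_triangle_ineq[of "z *\<^sub>R ?a" "w *\<^sub>R ?b"] by simp
    also have "\<dots> \<le> 2 * h" using z w by (simp add: norm_axis_1)
    finally show "norm ((x + z *\<^sub>R ?a) + w *\<^sub>R ?b - x) \<le> 2 * h" .
    show "\<phi> (x + h *\<^sub>R ?a + h *\<^sub>R ?b) - \<phi> (x + h *\<^sub>R ?a) - \<phi> (x + h *\<^sub>R ?b) + \<phi> x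
      = h\<^sup>2 * (grad (\<lambda>y. grad \<phi> y $ i) ((x + z *\<^sub>R ?a) + w *\<^sub>R ?b) $ j)"
      using z(3) w(3) by (simp add: F_def power2_eq_square algebra_simps)
  qed
qed

lemma mixed_partials_commute:
  assumes \<phi>: "test_function \<phi>"
  shows "grad (\<lambda>y. grad \<phi> y $ i) x $ j = grad (\<lambda>y. grad \<phi> y $ j) x $ i"
proof -
  define t where "t n = inverse (real (Suc n))" for n
  have t: "t \<longlonglongrightarrow> 0" "0 < t n" for n
    unfolding t_def using LIMSEQ_inverse_real_of_nat by auto
  define \<Delta> where "\<Delta> i j n = \<phi> (x + t n *\<^sub>R axis i 1 + t n *\<^sub>R axis j 1)
    - \<phi> (x + t n *\<^sub>R axis i 1) - \<phi> (x + t n *\<^sub>R axis j 1) + \<phi> x" for i j n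
  have \<Delta>_commute: "\<Delta> i j n = \<Delta> j i n" for i j n
  proof -
    have "x + t n *\<^sub>R axis i 1 + t n *\<^sub>R axis j 1 = x + t n *\<^sub>R axis j 1 + t n *\<^sub>R axis i 1" by simp
    then have "\<phi> (x + t n *\<^sub>R axis i 1 + t n *\<^sub>R axis j 1) = \<phi> (x + t n *\<^sub>R axis j 1 + t n *\<^sub>R axis i 1)"
      by (rule arg_cong)
    then show ?thesis unfolding \<Delta>_def by linarith
  qed
  define Q where "Q i j n p \<longleftrightarrow> norm (p - x) \<le> 2 * t n \<and> \<Delta> i j n = (t n)\<^sup>2 * (grad (\<lambda>y. grad \<phi> y $ i) p $ j)" for i j n p
  have "\<exists>p. Q i j n p" for i j n
    unfolding Q_def \<Delta>_def by (rule second_difference[OF \<phi> t(2)[of n], of x i j]) (rule exI, rule conjI)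
  then obtain p where Q: "\<And>i j n. Q i j n (p i j n)" by metis
  have p: "norm (p i j n - x) \<le> 2 * t n"
    and eq: "\<Delta> i j n = (t n)\<^sup>2 * (grad (\<lambda>y. grad \<phi> y $ i) (p i j n) $ j)" for i j n
    using Q[of i j n] by (simp_all only: Q_def)
  have lim: "(\<lambda>n. grad (\<lambda>y. grad \<phi> y $ i) (p i j n) $ j) \<longlonglongrightarrow> grad (\<lambda>y. grad \<phi> y $ i) x $ j" for i j
  proof -
    have "(\<lambda>n. 2 * t n) \<longlonglongrightarrow> 0" using t(1) by (rule tendsto_mult_right_zero)
    then have "(\<lambda>n. p i j n - x) \<longlonglongrightarrow> 0"
      by (rule Lim_null_comparison[rotated]) (rule always_eventually[OF allI[OF p]])
    then have "p i j \<longlonglongrightarrow> x" by (simp add: LIM_zero_iff)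
    moreover have "continuous_on UNIV (\<lambda>y. grad (\<lambda>y. grad \<phi> y $ i) y $ j)"
      by (rule test_function_continuous[OF test_function_grad[OF test_function_grad[OF \<phi>]]])
    ultimately show ?thesis
      by (intro continuous_on_tendsto_compose[where f="\<lambda>y. grad (\<lambda>y. grad \<phi> y $ i) y $ j" and s=UNIV]) auto
  qed
  have "grad (\<lambda>y. grad \<phi> y $ i) (p i j n) $ j = grad (\<lambda>y. grad \<phi> y $ j) (p j i n) $ i" for n
  proof -
    have "(t n)\<^sup>2 * (grad (\<lambda>y. grad \<phi> y $ i) (p i j n) $ j) = (t n)\<^sup>2 * (grad (\<lambda>y. grad \<phi> y $ j) (p j i n) $ i)"
      unfolding eq[symmetric] by (rule \<Delta>_commute)
    then show ?thesis using t(2)[of n] by simp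
  qed
  then have "(\<lambda>n. grad (\<lambda>y. grad \<phi> y $ i) (p i j n) $ j) \<longlonglongrightarrow> grad (\<lambda>y. grad \<phi> y $ j) x $ i"
    using lim[of j i] by simp
  with lim[of i j] show ?thesis by (rule LIMSEQ_unique)
qed

text \<open>The derivatives sit on the test function because the fields are only square-integrable;
  for a smooth field the condition reads d_1 Y_2 = d_2 Y_1.\<close>

definition curl_free :: "(real^2 \<Rightarrow> real^2) \<Rightarrow> bool" where
  "curl_free Y \<longleftrightarrow> (\<forall>\<phi>. test_function \<phi> \<longrightarrow>
    (LINT x|lebesgue. Y x $ 1 * grad \<phi> x $ 2 - Y x $ 2 * grad \<phi> x $ 1) = 0)"

text \<open>Integrating by parts against the two partial derivatives of the test function leaves its
  mixed second derivatives, which cancel. Since s is Lipschitz, g may jump across curves without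
  producing an interface term.\<close>

lemma curl_free_lipschitz:
  assumes "lipschitz_on_balls s" "AE x in lebesgue. (s has_derivative (\<lambda>w. g x \<bullet> w)) (at x)"
    and "g \<in> borel_measurable lebesgue"
  shows "curl_free g"
  unfolding curl_free_def
proof (intro allI impI)
  fix \<phi> assume \<phi>: "test_function \<phi>"
  note I = integral_by_parts_lipschitz[OF assms test_function_grad[OF \<phi>]]
  have 1: "integrable lebesgue (\<lambda>x. g x $ 1 * grad \<phi> x $ 2)" "integrable lebesgue (\<lambda>x. g x $ 2 * grad \<phi> x $ 1)"
    using I(1)[of 2 "axis 1 1"] I(1)[of 1 "axis 2 1"] by (simp_all add: inner_axis mult.commute)
  then have "(LINT x|lebesgue. g x $ 1 * grad \<phi> x $ 2 - g x $ 2 * grad \<phi> x $ 1)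
    = (LINT x|lebesgue. grad \<phi> x $ 2 * (g x \<bullet> axis 1 1)) - (LINT x|lebesgue. grad \<phi> x $ 1 * (g x \<bullet> axis 2 1))"
    by (simp add: inner_axis mult.commute)
  also have "\<dots> = 0"
    unfolding I(2) by (simp add: inner_axis mixed_partials_commute[OF \<phi>, of 2 _ 1])
  finally show "(LINT x|lebesgue. g x $ 1 * grad \<phi> x $ 2 - g x $ 2 * grad \<phi> x $ 1) = 0" .
qed

lemma grad_lebesgue_measurable: "test_function \<phi> \<Longrightarrow> grad \<phi> \<in> borel_measurable lebesgue"
  by (intro measurable_completion) (simp add: grad_borel)

lemma curl_free_grad: "test_function \<phi> \<Longrightarrow> curl_free (grad \<phi>)"
  by (rule curl_free_lipschitz[of \<phi>])
    (auto intro: test_function_lipschitz_on_balls test_function_has_derivative grad_lebesgue_measurable)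

section \<open>The Cauchy representation of weakly holomorphic fields\<close>

definition cplx :: "real^2 \<Rightarrow> complex" where
  "cplx x = Complex (x $ 1) (x $ 2)"

lemma cplx_sel [simp]: "Re (cplx x) = x $ 1" "Im (cplx x) = x $ 2"
  by (simp_all add: cplx_def)

lemma cplx_add: "cplx (x + y) = cplx x + cplx y"
  and cplx_diff: "cplx (x - y) = cplx x - cplx y"
  and cplx_scaleR: "cplx (c *\<^sub>R x) = c *\<^sub>R cplx x"
  and cplx_zero [simp]: "cplx 0 = 0"
  by (simp_all add: complex_eq_iff)

lemma cmod_cplx [simp]: "cmod (cplx x) = norm x"
  by (simp add: cmod_def norm_vec_def L2_set_def sum_2)

lemma bounded_linear_cplx: "bounded_linear cplx"
  by (rule bounded_linear_intro[of _ 1]) (simp_all add: cplx_add cplx_scaleR)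

lemma continuous_on_cplx [continuous_intros]: "continuous_on S f \<Longrightarrow> continuous_on S (\<lambda>x. cplx (f x))"
  using bounded_linear.continuous_on[OF bounded_linear_cplx] .

lemma borel_measurable_cplx [measurable]: "cplx \<in> borel_measurable borel"
  by (intro borel_measurable_continuous_onI continuous_intros)

lemma cplx_inner_self: "cnj (cplx x) * cplx x = of_real (x \<bullet> x)"
  by (simp add: complex_eq_iff inner_vec_def sum_2 power2_eq_square)

section \<open>The smoothed Cauchy kernel and its d-bar derivative\<close>

text \<open>The d-bar derivative of \<open>cauchy_kernel t\<close>. For t > 0 it is the dilation by
  t of one integrable profile with mass pi, hence up to that constant an approximate identity as t
  tends to 0.\<close>

definition poisson :: "real \<Rightarrow> real^2 \<Rightarrow> real" where
  "poisson t y = t\<^sup>2 / (y \<bullet> y + t\<^sup>2)\<^sup>2"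

text \<open>A smooth version of 1 / z = cnj z / |z|^2, so that a cutoff times its components is an
  admissible test function; its modulus never exceeds that of 1 / z.\<close>

definition cauchy_kernel :: "real \<Rightarrow> real^2 \<Rightarrow> complex" where
  "cauchy_kernel t y = cnj (cplx y) / of_real (y \<bullet> y + t\<^sup>2)"

definition poisson_mass :: real where
  "poisson_mass = (LINT y|lborel. poisson 1 y)"

lemma poisson_nonneg: "0 \<le> poisson t y"
  by (simp add: poisson_def)

lemma continuous_on_poisson: "t \<noteq> 0 \<Longrightarrow> continuous_on S (poisson t)"
  unfolding poisson_def
  by (intro continuous_intros) (auto simp: add_nonneg_eq_0_iff)

lemma continuous_on_cauchy_kernel: "t \<noteq> 0 \<Longrightarrow> continuous_on S (cauchy_kernel t)"
  unfolding cauchy_kernel_def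
  by (intro continuous_intros) (auto simp: add_nonneg_eq_0_iff simp flip: of_real_add of_real_power)

lemma borel_poisson [measurable]: "poisson t \<in> borel_measurable borel"
  unfolding poisson_def by measurable

lemma borel_cauchy_kernel [measurable]: "cauchy_kernel t \<in> borel_measurable borel"
proof -
  have [measurable]: "(\<lambda>x. cnj (cplx x)) \<in> borel_measurable borel"
    "(\<lambda>x::real^2. complex_of_real (x \<bullet> x + t\<^sup>2)) \<in> borel_measurable borel"
    by (intro borel_measurable_continuous_onI continuous_intros)+
  show ?thesis unfolding cauchy_kernel_def by measurable
qed

text \<open>Dominated by a product of two one-dimensional functions 1 / (1 + s^2), whose integral
  factorizes.\<close>

lemma integrable_poisson: "integrable lborel (poisson 1)"
proof (rule integrableI_bounded)
  let ?f = "\<lambda>x::real. 1 / (1 + x\<^sup>2)"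
  have pos: "0 < 1 + x\<^sup>2" for x :: real by (simp add: add_pos_nonneg)
  have f: "integrable lborel ?f"
    using integrable_inverse_1_plus_square by (simp add: set_integrable_def inverse_eq_divide)
  have le: "poisson 1 y \<le> (\<Prod>b\<in>Basis. ?f (y \<bullet> b))" for y
  proof -
    have B: "(Basis :: (real^2) set) = {axis 1 1, axis 2 1}"
      by (auto simp: Basis_vec_def UNIV_2)
    have "(axis 1 1 :: real^2) \<noteq> axis 2 1" by (simp add: axis_eq_axis)
    then have eq: "(\<Prod>b\<in>Basis. ?f (y \<bullet> b)) = 1 / ((1 + (y$1)\<^sup>2) * (1 + (y$2)\<^sup>2))"
      by (simp add: B inner_axis)
    have "(1 + (y$1)\<^sup>2) * (1 + (y$2)\<^sup>2) \<le> (y \<bullet> y + 1)\<^sup>2"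
    proof -
      have "(y \<bullet> y + 1)\<^sup>2 = (1 + (y$1)\<^sup>2) * (1 + (y$2)\<^sup>2) + ((y$1)\<^sup>2 + (y$2)\<^sup>2 + (y$1)^4 + (y$2)^4 + (y$1)\<^sup>2 * (y$2)\<^sup>2)"
        by (simp add: inner_vec_def sum_2 power2_eq_square power4_eq_xxxx algebra_simps)
      then show ?thesis by simp
    qed
    then show ?thesis
      unfolding eq poisson_def using pos by (intro frac_le) auto
  qed
  have "(\<integral>\<^sup>+y. ennreal (norm (poisson 1 y)) \<partial>lborel) \<le> (\<integral>\<^sup>+y. (\<Prod>b\<in>Basis. ennreal (?f ((y::real^2) \<bullet> b))) \<partial>lborel)"
    using le by (intro nn_integral_mono) (auto simp: poisson_nonneg prod_ennreal less_imp_le[OF pos] intro!: ennreal_leI)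
  also have "\<dots> = (\<Prod>b\<in>(Basis :: (real^2) set). (\<integral>\<^sup>+x. ennreal (?f x) \<partial>lborel))"
    by (rule nn_integral_lborel_prod) auto
  also have "\<dots> < \<infinity>"
    using f by (simp add: nn_integral_eq_integral less_imp_le[OF pos] prod_ennreal ennreal_power)
  finally show "(\<integral>\<^sup>+y. ennreal (norm (poisson 1 y)) \<partial>lborel) < \<infinity>" .
qed simp

lemma poisson_mass_pos: "0 < poisson_mass"
proof -
  have pos: "0 < poisson 1 y" for y
    unfolding poisson_def using add_nonneg_pos[of "y \<bullet> y" "1::real"] by simp
  have "poisson_mass \<noteq> 0"
  proof
    assume "poisson_mass = 0"
    then have "AE y in (lborel :: (real^2) measure). poisson 1 y = 0"
      unfolding poisson_mass_def using integrable_poisson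
      by (subst (asm) integral_nonneg_eq_0_iff_AE) (auto simp: poisson_nonneg)
    moreover have "poisson 1 y \<noteq> 0" for y using pos[of y] by simp
    ultimately have "AE y in (lborel :: (real^2) measure). False" by simp
    then show False by (simp add: AE_iff_null null_sets_def)
  qed
  moreover have "0 \<le> poisson_mass"
    unfolding poisson_mass_def by (intro Bochner_Integration.integral_nonneg) (simp add: poisson_nonneg)
  ultimately show ?thesis by simp
qed

text \<open>Substituting x - t y for y moves the parameter from the kernel into \<theta>, where the
  limit of small t is a matter of continuity.\<close>

lemma integral_poisson_scale:
  fixes \<theta> :: "real^2 \<Rightarrow> real"
  assumes [measurable]: "\<theta> \<in> borel_measurable borel" and t: "0 < t"
  shows "(LINT y|lborel. \<theta> y * poisson t (x - y)) = (LINT y|lborel. \<theta> (x - t *\<^sub>R y) * poisson 1 y)"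
proof -
  have "(LINT y|lborel. \<theta> y * poisson t (x - y))
    = (LINT y|density (distr lborel borel (\<lambda>y. x + (- t) *\<^sub>R y)) (\<lambda>_. \<bar>- t\<bar> ^ DIM(real^2)). \<theta> y * poisson t (x - y))"
    using t by (subst lborel_affine[of "- t" x]) auto
  also have "\<dots> = (LINT y|distr lborel borel (\<lambda>y. x + (- t) *\<^sub>R y). t\<^sup>2 *\<^sub>R (\<theta> y * poisson t (x - y)))"
    using t by (subst integral_density) auto
  also have "\<dots> = (LINT y|lborel. t\<^sup>2 *\<^sub>R (\<theta> (x - t *\<^sub>R y) * poisson t (t *\<^sub>R y)))"
    by (subst integral_distr) auto
  also have "\<dots> = (LINT y|lborel. \<theta> (x - t *\<^sub>R y) * poisson 1 y)"
  proof (rule Bochner_Integration.integral_cong[OF refl])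
    fix y :: "real^2"
    have "(t *\<^sub>R y) \<bullet> (t *\<^sub>R y) + t\<^sup>2 = t\<^sup>2 * (y \<bullet> y + 1)"
      by (simp add: power2_eq_square algebra_simps)
    then have "t\<^sup>2 * poisson t (t *\<^sub>R y) = poisson 1 y"
      using t by (simp add: poisson_def power_mult_distrib)
    then show "t\<^sup>2 *\<^sub>R (\<theta> (x - t *\<^sub>R y) * poisson t (t *\<^sub>R y)) = \<theta> (x - t *\<^sub>R y) * poisson 1 y"
      by (metis mult.left_commute real_scaleR_def)
  qed
  finally show ?thesis .
qed

lemma indicator_tendsto:
  fixes x :: "'a::metric_space"
  assumes "f \<longlonglongrightarrow> x" "x \<notin> frontier Q"
  shows "(\<lambda>n. indicator Q (f n) :: real) \<longlonglongrightarrow> indicator Q x"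
proof -
  have "isCont (indicator Q :: _ \<Rightarrow> real) x"
    using assms(2) by (simp add: isCont_indicator)
  then show ?thesis using assms(1) by (rule isCont_tendsto_compose)
qed

lemma poisson_smoothing_tendsto:
  assumes Q: "Q \<in> sets borel" and x: "x \<notin> frontier Q" and t: "t \<longlonglongrightarrow> 0" "\<And>n. 0 < t n"
  shows "(\<lambda>n. LINT y|lborel. indicator Q y * poisson (t n) (x - y)) \<longlonglongrightarrow> poisson_mass * indicator Q x"
proof -
  have [measurable]: "Q \<in> sets borel" by fact
  have "(\<lambda>n. LINT y|lborel. indicator Q (x - t n *\<^sub>R y) * poisson 1 y) \<longlonglongrightarrow> (LINT y|lborel. indicator Q x * poisson 1 y)"
  proof (rule integral_dominated_convergence[where w="poisson 1"])
    show "AE y in lborel. (\<lambda>n. indicator Q (x - t n *\<^sub>R y) * poisson 1 y) \<longlonglongrightarrow> indicator Q x * poisson 1 y"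
    proof (rule AE_I2)
      fix y :: "real^2"
      have "(\<lambda>n. x - t n *\<^sub>R y) \<longlonglongrightarrow> x - 0 *\<^sub>R y" by (intro tendsto_intros t)
      then show "(\<lambda>n. indicator Q (x - t n *\<^sub>R y) * poisson 1 y) \<longlonglongrightarrow> indicator Q x * poisson 1 y"
        using x by (intro tendsto_mult tendsto_const indicator_tendsto) auto
    qed
    show "AE y in lborel. norm (indicator Q (x - t n *\<^sub>R y) * poisson 1 y) \<le> poisson 1 y" for n
      by (auto simp: indicator_def poisson_nonneg)
  qed (auto simp: integrable_poisson)
  then show ?thesis
    using t by (subst integral_poisson_scale) (auto simp: poisson_mass_def mult.commute)
qed

lemma poisson_smoothing_bound:
  assumes Q: "Q \<in> sets borel" and t: "0 < t"
  shows "\<bar>LINT y|lborel. indicator Q y * poisson t (x - y)\<bar> \<le> poisson_mass"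
proof -
  have [measurable]: "Q \<in> sets borel" by fact
  have "integrable lborel (\<lambda>y. indicator Q (x - t *\<^sub>R y) * poisson 1 y)"
    by (rule Bochner_Integration.integrable_bound[OF integrable_poisson]) (auto simp: indicator_def)
  then have "(LINT y|lborel. indicator Q (x - t *\<^sub>R y) * poisson 1 y) \<le> poisson_mass"
    unfolding poisson_mass_def
    by (intro integral_mono integrable_poisson) (auto simp: indicator_def poisson_nonneg)
  moreover have "0 \<le> (LINT y|lborel. indicator Q (x - t *\<^sub>R y) * poisson 1 y)"
    by (intro Bochner_Integration.integral_nonneg) (simp add: poisson_nonneg)
  ultimately show ?thesis
    using t by (subst integral_poisson_scale) auto
qed

lemma cauchy_kernel_tendsto:
  assumes "t \<longlonglongrightarrow> 0" "y \<noteq> 0"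
  shows "(\<lambda>n. cauchy_kernel (t n) y) \<longlonglongrightarrow> 1 / cplx y"
proof -
  have ne: "cplx y \<noteq> 0" using assms(2) by (metis cmod_cplx norm_eq_zero)
  have "(\<lambda>n. cauchy_kernel (t n) y) \<longlonglongrightarrow> cnj (cplx y) / of_real (y \<bullet> y + 0\<^sup>2)"
    unfolding cauchy_kernel_def using assms by (intro tendsto_intros) auto
  also have "cnj (cplx y) / of_real (y \<bullet> y + 0\<^sup>2) = 1 / cplx y"
    using ne assms(2) cplx_inner_self[of y] by (simp add: divide_simps del: of_real_add)
  finally show ?thesis .
qed

lemma cauchy_kernel_bound: "cmod (cauchy_kernel t y) \<le> 1 / norm y"
proof (cases "y = 0")
  case False
  have "norm y / (y \<bullet> y + t\<^sup>2) \<le> norm y / (y \<bullet> y)"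
    using False by (intro divide_left_mono mult_pos_pos add_pos_nonneg) auto
  also have "\<dots> = 1 / norm y"
    using False by (simp add: dot_square_norm power2_eq_square)
  finally show ?thesis
    by (simp add: cauchy_kernel_def norm_divide del: of_real_add of_real_power)
qed (simp add: cauchy_kernel_def)


text \<open>Test functions are real, so the real and imaginary parts of the smoothed kernel are
  handled one at a time, through the choices of a along the two axes.\<close>

lemma grad_mult_kernel:
  fixes x0 :: "real^2" and t :: real
  defines "D \<equiv> \<lambda>x. (x - x0) \<bullet> (x - x0) + t\<^sup>2"
  assumes \<zeta>: "test_function \<zeta>" and t: "0 < t"
  shows "test_function (\<lambda>x. \<zeta> x * (((x - x0) \<bullet> a) / D x))"
    and "grad (\<lambda>x. \<zeta> x * (((x - x0) \<bullet> a) / D x)) x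
      = (((x - x0) \<bullet> a) / D x) *\<^sub>R grad \<zeta> x + (\<zeta> x / D x) *\<^sub>R a - (2 * \<zeta> x * ((x - x0) \<bullet> a) / (D x)\<^sup>2) *\<^sub>R (x - x0)"
proof -
  have D: "0 < D x" for x using t by (simp add: D_def add_nonneg_pos)
  have D_eq: "D x = x \<bullet> x - x \<bullet> (2 *\<^sub>R x0) + (x0 \<bullet> x0 + t\<^sup>2)" for x
    by (simp add: D_def inner_diff inner_commute algebra_simps)
  show "test_function (\<lambda>x. \<zeta> x * (((x - x0) \<bullet> a) / D x))"
  proof (rule test_function_mult[OF \<zeta>])
    fix k
    have "C_k k D"
      unfolding D_eq[abs_def]
      by (intro C_k_add C_k_diff C_k_const C_k_inner_self C_k_bounded_linear bounded_linear_inner_left)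
    moreover have "C_k k (\<lambda>x. (x - x0) \<bullet> a)"
      unfolding inner_diff_left by (intro C_k_diff C_k_const C_k_bounded_linear bounded_linear_inner_left)
    ultimately show "C_k k (\<lambda>x. ((x - x0) \<bullet> a) / D x)"
      using D by (intro C_k_divide) (auto simp: less_imp_neq[symmetric])
  qed
  have "((\<lambda>x. \<zeta> x * (((x - x0) \<bullet> a) / D x)) has_derivative
    (\<lambda>v. \<zeta> x * (((v \<bullet> a) * D x - ((x - x0) \<bullet> a) * (2 * ((x - x0) \<bullet> v))) / (D x * D x)) + (grad \<zeta> x \<bullet> v) * (((x - x0) \<bullet> a) / D x))) (at x)"
  proof (intro has_derivative_mult has_derivative_divide' test_function_has_derivative \<zeta>)
    show "((\<lambda>x. (x - x0) \<bullet> a) has_derivative (\<lambda>v. v \<bullet> a)) (at x)"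
      by (auto intro!: derivative_eq_intros)
    show "(D has_derivative (\<lambda>v. 2 * ((x - x0) \<bullet> v))) (at x)"
      unfolding D_def by (auto intro!: derivative_eq_intros simp: inner_commute)
    show "D x \<noteq> 0" using D[of x] by simp
  qed
  also have "(\<lambda>v. \<zeta> x * (((v \<bullet> a) * D x - ((x - x0) \<bullet> a) * (2 * ((x - x0) \<bullet> v))) / (D x * D x)) + (grad \<zeta> x \<bullet> v) * (((x - x0) \<bullet> a) / D x))
    = (\<lambda>v. ((((x - x0) \<bullet> a) / D x) *\<^sub>R grad \<zeta> x + (\<zeta> x / D x) *\<^sub>R a - (2 * \<zeta> x * ((x - x0) \<bullet> a) / (D x)\<^sup>2) *\<^sub>R (x - x0)) \<bullet> v)"
  proof
    fix v
    define p q where "p = (x - x0) \<bullet> a" and "q = (x - x0) \<bullet> v"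
    show "\<zeta> x * (((v \<bullet> a) * D x - ((x - x0) \<bullet> a) * (2 * ((x - x0) \<bullet> v))) / (D x * D x)) + (grad \<zeta> x \<bullet> v) * (((x - x0) \<bullet> a) / D x)
     = ((((x - x0) \<bullet> a) / D x) *\<^sub>R grad \<zeta> x + (\<zeta> x / D x) *\<^sub>R a - (2 * \<zeta> x * ((x - x0) \<bullet> a) / (D x)\<^sup>2) *\<^sub>R (x - x0)) \<bullet> v"
      unfolding inner_diff_left[of _ _ v] inner_add_left inner_scaleR_left p_def[symmetric]
      unfolding q_def[symmetric] inner_diff_left[of x x0 v, symmetric]
      using D[of x] by (simp add: inner_commute[of v a] field_simps power2_eq_square)
  qed
  finally show "grad (\<lambda>x. \<zeta> x * (((x - x0) \<bullet> a) / D x)) x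
      = (((x - x0) \<bullet> a) / D x) *\<^sub>R grad \<zeta> x + (\<zeta> x / D x) *\<^sub>R a - (2 * \<zeta> x * ((x - x0) \<bullet> a) / (D x)\<^sup>2) *\<^sub>R (x - x0)"
    by (rule grad_eqI)
qed

text \<open>The map \<open>cplx (grad _)\<close> is twice the d-bar derivative, and k 1 - i k 2 is
  the smoothed Cauchy kernel. The product rule then gives one term from the cutoff and twice the
  Poisson kernel.\<close>

lemma grad_mult_cauchy_kernel:
  fixes x0 :: "real^2" and t :: real
  defines "k \<equiv> \<lambda>i x. ((x - x0) \<bullet> axis i 1) / ((x - x0) \<bullet> (x - x0) + t\<^sup>2)"
  assumes \<zeta>: "test_function \<zeta>" and t: "0 < t"
  shows "cplx (grad (\<lambda>x. \<zeta> x * k 1 x) x) - \<i> * cplx (grad (\<lambda>x. \<zeta> x * k 2 x) x)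
    = cplx (grad \<zeta> x) * cauchy_kernel t (x - x0) + of_real (2 * \<zeta> x * poisson t (x - x0))"
proof -
  define y where "y = x - x0"
  define D where "D = y \<bullet> y + t\<^sup>2"
  have D: "0 < D" using t by (simp add: D_def add_nonneg_pos)
  have Dy: "D - (y$1)\<^sup>2 - (y$2)\<^sup>2 = t\<^sup>2" by (simp add: D_def inner_vec_def sum_2 power2_eq_square)
  have ck: "cauchy_kernel t y = Complex (y$1 / D) (- (y$2) / D)"
    by (simp add: cauchy_kernel_def D_def[symmetric] complex_eq_iff del: of_real_add)
  have po: "2 * \<zeta> x * poisson t y = 2 * \<zeta> x / D - 2 * \<zeta> x * ((y$1)\<^sup>2 + (y$2)\<^sup>2) / D\<^sup>2"
  proof -
    have eq: "(y$1)\<^sup>2 + (y$2)\<^sup>2 = D - t\<^sup>2" using Dy by simp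
    show ?thesis
      unfolding poisson_def D_def[symmetric] eq using D by (simp add: field_simps power2_eq_square)
  qed
  show ?thesis
    unfolding k_def grad_mult_kernel(2)[OF \<zeta> t] y_def[symmetric] D_def[symmetric] ck po
    by (simp only: inner_axis inner_real_def mult_1_right)
      (simp add: complex_eq_iff axis_def algebra_simps power2_eq_square add_divide_distrib)
qed

section \<open>The Cauchy representation\<close>

locale weakly_holomorphic =
  fixes H :: "real^2 \<Rightarrow> complex" and \<zeta> :: "real^2 \<Rightarrow> real" and r :: real
  assumes H_borel [measurable]: "H \<in> borel_measurable borel"
    and H_loc: "\<And>\<rho>. integrable lborel (\<lambda>x. indicator (cball 0 \<rho>) x *\<^sub>R H x)"
    and \<zeta>: "test_function \<zeta>"
    and \<zeta>_1: "\<And>x. norm x \<le> r \<Longrightarrow> \<zeta> x = 1"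
    and weak: "\<And>\<phi>. test_function \<phi> \<Longrightarrow> (\<And>x. \<zeta> x = 0 \<Longrightarrow> \<phi> x = 0) \<Longrightarrow>
      (LINT x|lborel. H x * cplx (grad \<phi> x)) = 0"
begin

lemma mult_integrable:
  assumes f: "continuous_on UNIV f" and supp: "\<And>x. norm x > \<rho> \<Longrightarrow> f x = 0"
  shows "integrable lborel (\<lambda>x. H x * f x)"
proof -
  have "bounded (f ` cball 0 \<rho>)"
    using f continuous_on_subset by (intro compact_imp_bounded compact_continuous_image) auto
  then obtain B where B: "0 < B" "\<And>x. norm x \<le> \<rho> \<Longrightarrow> norm (f x) \<le> B"
    unfolding bounded_pos by auto
  show ?thesis
  proof (rule Bochner_Integration.integrable_bound)
    show "integrable lborel (\<lambda>x. B * norm (indicator (cball 0 \<rho>) x *\<^sub>R H x))"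
      using H_loc[of \<rho>] by (intro integrable_mult_right integrable_norm)
    show "(\<lambda>x. H x * f x) \<in> borel_measurable lborel"
      using borel_measurable_continuous_onI[OF f] by simp
    show "AE x in lborel. norm (H x * f x) \<le> norm (B * norm (indicator (cball 0 \<rho>) x *\<^sub>R H x))"
    proof (rule AE_I2)
      fix x
      show "norm (H x * f x) \<le> norm (B * norm (indicator (cball 0 \<rho>) x *\<^sub>R H x))"
      proof (cases "norm x \<le> \<rho>")
        case True
        then show ?thesis
          using mult_left_mono[OF B(2)[OF True], of "norm (H x)"] B(1) by (simp add: norm_mult mult.commute)
      next
        case False
        then show ?thesis using supp[of x] B(1) by simp
      qed
    qed
  qed
qed

lemma test_mult_integrable:
  assumes "test_function \<phi>" "continuous_on UNIV f"
  shows "integrable lborel (\<lambda>x. H x * (of_real (\<phi> x) * f x))" "integrable lborel (\<lambda>x. H x * (cplx (grad \<phi> x) * f x))"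
proof -
  obtain \<rho> where \<rho>: "\<And>x. norm x > \<rho> \<Longrightarrow> \<phi> x = 0" "\<And>x. norm x > \<rho> \<Longrightarrow> grad \<phi> x = 0"
    using test_function_support[OF assms(1)] by metis
  show "integrable lborel (\<lambda>x. H x * (of_real (\<phi> x) * f x))" "integrable lborel (\<lambda>x. H x * (cplx (grad \<phi> x) * f x))"
    by (rule mult_integrable[of _ \<rho>],
        use \<rho> assms in \<open>auto intro!: continuous_intros test_function_continuous grad_continuous\<close>)+
qed

text \<open>The equation is tested with \<zeta> times the kernel. Where \<zeta> = 1 the left side
  averages H near x, while the right side only sees the region where the cutoff varies.\<close>

lemma kernel_identity:
  assumes t: "0 < t"
  shows "2 * (LINT y|lborel. H y * of_real (\<zeta> y) * of_real (poisson t (y - x)))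
    = - (LINT y|lborel. H y * cplx (grad \<zeta> y) * cauchy_kernel t (y - x))"
proof -
  define k where "k i y = ((y - x) \<bullet> axis i 1) / ((y - x) \<bullet> (y - x) + t\<^sup>2)" for i y
  define \<phi> where "\<phi> i y = \<zeta> y * k i y" for i y
  have \<phi>: "test_function (\<phi> i)" for i
    unfolding \<phi>_def k_def by (rule grad_mult_kernel[OF \<zeta> t])
  have zero: "(LINT y|lborel. H y * cplx (grad (\<phi> i) y)) = 0" for i
    by (rule weak[OF \<phi>]) (simp add: \<phi>_def)
  have int: "integrable lborel (\<lambda>y. H y * cplx (grad (\<phi> i) y))" for i
    using test_mult_integrable(2)[OF \<phi>, of "\<lambda>_. 1"] by simp
  have t0: "t \<noteq> 0" using t by simp
  have cont: "continuous_on UNIV (\<lambda>y. cauchy_kernel t (y - x))" "continuous_on UNIV (\<lambda>y. complex_of_real (poisson t (y - x)))"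
    by (intro continuous_intros continuous_on_compose2[OF continuous_on_cauchy_kernel[OF t0, of UNIV]]
       continuous_on_compose2[OF continuous_on_poisson[OF t0, of UNIV]] subset_UNIV)+
  have "(LINT y|lborel. H y * (cplx (grad \<zeta> y) * cauchy_kernel t (y - x)) + 2 * (H y * (of_real (\<zeta> y) * of_real (poisson t (y - x)))))
    = (LINT y|lborel. H y * cplx (grad (\<phi> 1) y) - \<i> * (H y * cplx (grad (\<phi> 2) y)))"
  proof (rule Bochner_Integration.integral_cong[OF refl])
    fix y
    have "cplx (grad (\<phi> 1) y) - \<i> * cplx (grad (\<phi> 2) y)
      = cplx (grad \<zeta> y) * cauchy_kernel t (y - x) + of_real (2 * \<zeta> y * poisson t (y - x))"
      unfolding \<phi>_def k_def by (rule grad_mult_cauchy_kernel[OF \<zeta> t])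
    then have "H y * (cplx (grad (\<phi> 1) y) - \<i> * cplx (grad (\<phi> 2) y))
      = H y * (cplx (grad \<zeta> y) * cauchy_kernel t (y - x) + of_real (2 * \<zeta> y * poisson t (y - x)))" by simp
    then show "H y * (cplx (grad \<zeta> y) * cauchy_kernel t (y - x)) + 2 * (H y * (of_real (\<zeta> y) * of_real (poisson t (y - x))))
      = H y * cplx (grad (\<phi> 1) y) - \<i> * (H y * cplx (grad (\<phi> 2) y))"
      by (simp add: algebra_simps)
  qed
  also have "\<dots> = 0" using int zero by simp
  finally show ?thesis
    using test_mult_integrable(1)[OF \<zeta> cont(2)] test_mult_integrable(2)[OF \<zeta> cont(1)]
    by (simp add: mult.assoc eq_neg_iff_add_eq_0 add.commute)
qed


definition source :: "real^2 \<Rightarrow> complex" where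
  "source y = H y * cplx (grad \<zeta> y)"

lemma source_borel [measurable]: "source \<in> borel_measurable borel"
  unfolding source_def using grad_borel[OF \<zeta>] by measurable

lemma source_integrable: "integrable lborel source"
  unfolding source_def using test_mult_integrable(2)[OF \<zeta>, of "\<lambda>_. 1"] by simp

lemma source_zero: "norm y < r \<Longrightarrow> source y = 0"
proof -
  assume y: "norm y < r"
  have "(\<zeta> has_derivative (\<lambda>v. 0 \<bullet> v)) (at y)"
  proof (rule has_derivative_transform_within_open)
    show "((\<lambda>x. 1) has_derivative (\<lambda>v. 0 \<bullet> v)) (at y)" by simp
    show "y \<in> ball 0 r" using y by simp
    show "1 = \<zeta> x" if "x \<in> ball 0 r" for x using that \<zeta>_1[of x] by simp
  qed simp
  then have "grad \<zeta> y = 0" by (rule grad_eqI)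
  then show ?thesis by (simp add: source_def)
qed

text \<open>The Cauchy transform of \<open>source\<close>, up to a constant; as the source vanishes
  for norm y < r, it is holomorphic in that ball.\<close>

definition potential :: "real^2 \<Rightarrow> complex" where
  "potential x = (LINT y|lborel. source y / cplx (y - x))"

lemma potential_borel [measurable]: "potential \<in> borel_measurable borel"
  unfolding potential_def by measurable

text \<open>The source keeps distance r - r' from x. The factor w stands for any kernel dominated by
  the Cauchy kernel, which makes the bound uniform in the smoothing parameter.\<close>

lemma source_quotient_bound:
  assumes "norm x < r'" "r' < r" "norm w \<le> 1 / norm (y - x)"
  shows "norm (source y * w) \<le> norm (source y) / (r - r')"
proof (cases "norm y < r")
  case False
  then have "r - r' \<le> norm (y - x)" using assms norm_triangle_ineq2[of y x] by simp
  then have "1 / norm (y - x) \<le> 1 / (r - r')" using assms by (intro frac_le) auto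
  with assms(3) have "norm w \<le> 1 / (r - r')" by linarith
  then show ?thesis
    using mult_left_mono[of "norm w" "1 / (r - r')" "norm (source y)"] by (simp add: norm_mult)
qed (simp add: source_zero)

lemma potential_tendsto:
  assumes x: "norm x < r'" "r' < r" and t: "t \<longlonglongrightarrow> 0"
  shows "(\<lambda>n. LINT y|lborel. source y * cauchy_kernel (t n) (y - x)) \<longlonglongrightarrow> potential x"
  unfolding potential_def
proof (rule integral_dominated_convergence)
  show "integrable lborel (\<lambda>y. norm (source y) / (r - r'))"
    using source_integrable by simp
  show "AE y in lborel. (\<lambda>n. source y * cauchy_kernel (t n) (y - x)) \<longlonglongrightarrow> source y / cplx (y - x)"
  proof (rule AE_I2)
    fix y
    show "(\<lambda>n. source y * cauchy_kernel (t n) (y - x)) \<longlonglongrightarrow> source y / cplx (y - x)"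
    proof (cases "norm y < r")
      case False
      then have "y - x \<noteq> 0" using x by auto
      from tendsto_mult_left[OF cauchy_kernel_tendsto[OF t this], of "source y"]
      show ?thesis by simp
    qed (simp add: source_zero)
  qed
  show "AE y in lborel. norm (source y * cauchy_kernel (t n) (y - x)) \<le> norm (source y) / (r - r')" for n
    by (intro AE_I2 source_quotient_bound[OF x cauchy_kernel_bound])
qed measurable

lemma smoothed_bound:
  assumes x: "norm x < r'" "r' < r"
  shows "norm (LINT y|lborel. source y * cauchy_kernel t (y - x)) \<le> (LINT y|lborel. norm (source y)) / (r - r')"
proof -
  have "integrable lborel (\<lambda>y. source y * cauchy_kernel t (y - x))"
    by (rule Bochner_Integration.integrable_bound[where f="\<lambda>y. norm (source y) / (r - r')"])
      (use source_integrable source_quotient_bound[OF x cauchy_kernel_bound] x in auto)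
  then have "norm (LINT y|lborel. source y * cauchy_kernel t (y - x)) \<le> (LINT y|lborel. norm (source y) / (r - r'))"
    using source_integrable source_quotient_bound[OF x cauchy_kernel_bound]
    by (intro order_trans[OF integral_norm_bound] integral_mono integrable_norm) auto
  then show ?thesis by simp
qed

lemma potential_bound:
  assumes x: "norm x < r'" "r' < r"
  shows "norm (potential x) \<le> (LINT y|lborel. norm (source y)) / (r - r')"
proof -
  have "(\<lambda>n. inverse (real (Suc n))) \<longlonglongrightarrow> 0" by (rule LIMSEQ_inverse_real_of_nat)
  from tendsto_norm[OF potential_tendsto[OF x this]]
  show ?thesis by (rule LIMSEQ_le_const2) (use smoothed_bound[OF x] in auto)
qed

text \<open>Fubini, legitimate because Q is bounded and the kernel is at most 1 / t^2; it shifts the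
  average over Q from the field to the kernel.\<close>

lemma smoothed_integral:
  fixes Q :: "(real^2) set"
  assumes Q: "Q \<in> sets borel" "bounded Q" and t: "0 < t"
  shows "(LINT x|lborel. indicator Q x *\<^sub>R (LINT y|lborel. H y * of_real (\<zeta> y) * of_real (poisson t (y - x))))
    = (LINT y|lborel. H y * of_real (\<zeta> y) * of_real (LINT x|lborel. indicator Q x * poisson t (y - x)))"
proof -
  have [measurable]: "Q \<in> sets borel" by fact
  have [measurable]: "\<zeta> \<in> borel_measurable borel" by (rule test_function_borel[OF \<zeta>])
  define N where "N y = H y * of_real (\<zeta> y)" for y
  have [measurable]: "N \<in> borel_measurable borel" unfolding N_def by measurable
  have N: "integrable lborel N"
    unfolding N_def using test_mult_integrable(1)[OF \<zeta>, of "\<lambda>_. 1"] by simp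
  have iQ: "integrable lborel (indicator Q :: _ \<Rightarrow> real)"
    using emeasure_bounded_finite[OF Q(2)] by (intro integrable_real_indicator) auto
  let ?f = "\<lambda>x y. indicator Q x *\<^sub>R (N y * of_real (poisson t (y - x)))"
  have pb: "poisson t y \<le> 1 / t\<^sup>2" for y
  proof -
    have "(t\<^sup>2)\<^sup>2 \<le> (y \<bullet> y + t\<^sup>2)\<^sup>2" by (intro power_mono) auto
    then have "t\<^sup>2 / (y \<bullet> y + t\<^sup>2)\<^sup>2 \<le> t\<^sup>2 / (t\<^sup>2)\<^sup>2"
      using t by (intro divide_left_mono mult_pos_pos) (auto simp: add_nonneg_pos)
    then show ?thesis using t by (simp add: poisson_def power2_eq_square)
  qed
  have prod: "integrable (lborel \<Otimes>\<^sub>M lborel) (\<lambda>(x, y). indicator Q x *\<^sub>R (norm (N y) / t\<^sup>2))"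
  proof (rule lborel_pair.Fubini_integrable)
    show "integrable lborel (\<lambda>x. LINT y|lborel. norm (case (x, y) of (x, y) \<Rightarrow> indicator Q x *\<^sub>R (norm (N y) / t\<^sup>2)))"
      using iQ by (simp add: abs_mult)
    show "AE x in lborel. integrable lborel (\<lambda>y. case (x, y) of (x, y) \<Rightarrow> indicator Q x *\<^sub>R (norm (N y) / t\<^sup>2))"
      using N by simp
  qed measurable
  have "integrable (lborel \<Otimes>\<^sub>M lborel) (\<lambda>(x, y). ?f x y)"
  proof (rule Bochner_Integration.integrable_bound[OF prod])
    show "(\<lambda>(x, y). ?f x y) \<in> borel_measurable (lborel \<Otimes>\<^sub>M lborel)" by measurable
    have "norm (?f x y) \<le> norm (indicator Q x *\<^sub>R (norm (N y) / t\<^sup>2))" for x y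
      using mult_left_mono[OF pb[of "y - x"], of "norm (N y)"]
      by (auto simp: indicator_def norm_mult poisson_nonneg)
    then show "AE p in lborel \<Otimes>\<^sub>M lborel. norm (case p of (x, y) \<Rightarrow> ?f x y)
        \<le> norm (case p of (x, y) \<Rightarrow> indicator Q x *\<^sub>R (norm (N y) / t\<^sup>2))"
      by (intro AE_I2) auto
  qed
  from lborel_pair.Fubini_integral[OF this]
  have "(LINT x|lborel. LINT y|lborel. ?f x y) = (LINT y|lborel. LINT x|lborel. ?f x y)" by simp
  also have "\<dots> = (LINT y|lborel. N y * of_real (LINT x|lborel. indicator Q x * poisson t (y - x)))"
  proof (rule Bochner_Integration.integral_cong[OF refl])
    fix y
    have "?f x y = N y * of_real (indicator Q x * poisson t (y - x))" for x
      by (simp add: scaleR_conv_of_real)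
    then have "(LINT x|lborel. ?f x y) = (LINT x|lborel. N y * of_real (indicator Q x * poisson t (y - x)))" by simp
    also have "\<dots> = N y * of_real (LINT x|lborel. indicator Q x * poisson t (y - x))"
      by (simp only: integral_mult_right_zero integral_complex_of_real)
    finally show "(LINT x|lborel. ?f x y) = N y * of_real (LINT x|lborel. indicator Q x * poisson t (y - x))" .
  qed
  finally show ?thesis by (simp add: N_def)
qed

text \<open>
  The smoothed Cauchy kernel turns the weak equation into an identity between a Poisson average of
  the field and a potential of a source located outside the ball; averaging over boxes before
  letting the smoothing parameter vanish avoids Lebesgue points.
\<close>

lemma box_average:
  fixes Q :: "(real^2) set"
  assumes Q: "Q \<in> sets borel" "convex Q" "Q \<subseteq> ball 0 r'" and r': "r' < r"
  shows "2 * of_real poisson_mass * (LINT x|lborel. indicator Q x *\<^sub>R H x) = - (LINT x|lborel. indicator Q x *\<^sub>R potential x)"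
proof -
  have [measurable]: "Q \<in> sets borel" by fact
  have [measurable]: "\<zeta> \<in> borel_measurable borel" by (rule test_function_borel[OF \<zeta>])
  have bQ: "bounded Q" using Q(3) bounded_ball bounded_subset by blast
  have iQ: "integrable lborel (\<lambda>x. indicator Q x * c :: real)" for c
    using emeasure_bounded_finite[OF bQ] by (intro integrable_mult_left integrable_real_indicator) auto
  define t where "t n = inverse (real (Suc n))" for n
  have t0: "t \<longlonglongrightarrow> 0" unfolding t_def by (rule LIMSEQ_inverse_real_of_nat)
  have t: "0 < t n" for n by (simp add: t_def)
  define T where "T n x = (LINT y|lborel. source y * cauchy_kernel (t n) (y - x))" for n x
  have [measurable]: "T n \<in> borel_measurable borel" for n unfolding T_def by measurable
  let ?C = "(LINT y|lborel. norm (source y)) / (r - r')"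
  have 1: "(\<lambda>n. LINT x|lborel. indicator Q x *\<^sub>R T n x) \<longlonglongrightarrow> (LINT x|lborel. indicator Q x *\<^sub>R potential x)"
  proof (rule integral_dominated_convergence[where w="\<lambda>x. indicator Q x * ?C"])
    show "AE x in lborel. (\<lambda>n. indicator Q x *\<^sub>R T n x) \<longlonglongrightarrow> indicator Q x *\<^sub>R potential x"
      using Q(3) potential_tendsto[OF _ r' t0] by (intro AE_I2) (auto simp: T_def indicator_def)
    show "AE x in lborel. norm (indicator Q x *\<^sub>R T n x) \<le> indicator Q x * ?C" for n
      using Q(3) smoothed_bound[OF _ r'] by (intro AE_I2) (auto simp: T_def indicator_def)
  qed (use iQ in auto)
  define N where "N y = H y * of_real (\<zeta> y)" for y
  have [measurable]: "N \<in> borel_measurable borel" unfolding N_def by measurable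
  have N: "integrable lborel N"
    unfolding N_def using test_mult_integrable(1)[OF \<zeta>, of "\<lambda>_. 1"] by simp
  define K where "K n y = (LINT x|lborel. indicator Q x * poisson (t n) (y - x))" for n y
  have [measurable]: "K n \<in> borel_measurable borel" for n unfolding K_def by measurable
  have 2: "(\<lambda>n. LINT y|lborel. N y * of_real (K n y)) \<longlonglongrightarrow> (LINT y|lborel. N y * of_real (poisson_mass * indicator Q y))"
  proof (rule integral_dominated_convergence[where w="\<lambda>y. norm (N y) * poisson_mass"])
    \<comment> \<open>Poisson averages of an indicator converge to it only off the frontier;
      convexity of Q makes the frontier a null set.\<close>
    have "AE y in lebesgue. y \<notin> frontier Q"
      using negligible_convex_frontier[OF Q(2)] by (intro AE_not_in) (simp add: negligible_iff_null_sets)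
    then have "AE y in lborel. y \<notin> frontier Q" by (simp add: AE_completion_iff)
    then show "AE y in lborel. (\<lambda>n. N y * of_real (K n y)) \<longlonglongrightarrow> N y * of_real (poisson_mass * indicator Q y)"
      by (rule eventually_mono) (intro tendsto_intros, unfold K_def, rule poisson_smoothing_tendsto[OF Q(1) _ t0 t])
    show "AE y in lborel. norm (N y * of_real (K n y)) \<le> norm (N y) * poisson_mass" for n
      unfolding norm_mult norm_of_real K_def
      by (intro AE_I2 mult_left_mono poisson_smoothing_bound[OF Q(1) t]) auto
  qed (use N in auto)
  have 3: "2 * (LINT y|lborel. N y * of_real (K n y)) = - (LINT x|lborel. indicator Q x *\<^sub>R T n x)" for n
  proof -
    have "2 * (LINT y|lborel. N y * of_real (K n y))
      = 2 * (LINT x|lborel. indicator Q x *\<^sub>R (LINT y|lborel. H y * of_real (\<zeta> y) * of_real (poisson (t n) (y - x))))"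
      using smoothed_integral[OF Q(1) bQ t, of n] by (simp add: N_def K_def)
    also have "\<dots> = (LINT x|lborel. indicator Q x *\<^sub>R (2 * (LINT y|lborel. H y * of_real (\<zeta> y) * of_real (poisson (t n) (y - x)))))"
      by (simp flip: integral_mult_right_zero)
    also have "\<dots> = (LINT x|lborel. - (indicator Q x *\<^sub>R T n x))"
      unfolding kernel_identity[OF t] by (simp add: T_def source_def)
    finally show ?thesis by simp
  qed
  have "2 * (LINT y|lborel. N y * of_real (poisson_mass * indicator Q y)) = - (LINT x|lborel. indicator Q x *\<^sub>R potential x)"
    using tendsto_mult_left[OF 2, of 2] tendsto_minus[OF 1] unfolding 3 by (rule LIMSEQ_unique)
  moreover have "(LINT y|lborel. N y * of_real (poisson_mass * indicator Q y))
    = (LINT y|lborel. of_real poisson_mass * (indicator Q y *\<^sub>R H y))"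
    using Q(3) r' \<zeta>_1 by (intro Bochner_Integration.integral_cong refl) (force simp: N_def indicator_def)
  ultimately show ?thesis by (simp only: mult.assoc integral_mult_right_zero)
qed

theorem cauchy_representation:
  assumes r': "r' < r"
  shows "AE x in lborel. norm x < r' \<longrightarrow> 2 * of_real poisson_mass * H x = - potential x"
proof -
  define E where "E x = indicator (ball 0 r') x *\<^sub>R (2 * of_real poisson_mass * H x + potential x)" for x
  let ?C = "(LINT y|lborel. norm (source y)) / (r - r')"
  have iH: "integrable lborel (\<lambda>x. indicator S x *\<^sub>R H x)" if [measurable]: "S \<in> sets borel" and "S \<subseteq> ball 0 r'" for S
  proof (rule Bochner_Integration.integrable_bound[OF H_loc[of r']])
    have "norm (indicator S x *\<^sub>R H x) \<le> norm (indicator (cball 0 r') x *\<^sub>R H x)" for x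
      using that(2) by (auto simp: indicator_def)
    then show "AE x in lborel. norm (indicator S x *\<^sub>R H x) \<le> norm (indicator (cball 0 r') x *\<^sub>R H x)"
      by (intro AE_I2)
  qed simp
  have iP: "integrable lborel (\<lambda>x. indicator S x *\<^sub>R potential x)" if [measurable]: "S \<in> sets borel" and S: "S \<subseteq> ball 0 r'" for S
  proof (rule Bochner_Integration.integrable_bound)
    show "integrable lborel (\<lambda>x::real^2. indicator (ball 0 r') x * ?C)"
      by (intro integrable_mult_left integrable_real_indicator) (use emeasure_bounded_finite[OF bounded_ball, of 0 r'] in auto)
    show "AE x in lborel. norm (indicator S x *\<^sub>R potential x) \<le> norm (indicator (ball 0 r') x * ?C)"
      using S r' potential_bound[OF _ r'] by (intro AE_I2) (auto simp: indicator_def)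
  qed simp
  have "integrable lborel (\<lambda>x. 2 * of_real poisson_mass * (indicator (ball 0 r') x *\<^sub>R H x) + indicator (ball 0 r') x *\<^sub>R potential x)"
    by (intro Bochner_Integration.integrable_add integrable_mult_right iH iP) auto
  then have iE: "integrable lborel E"
    by (rule back_subst[of "integrable lborel"]) (simp add: E_def fun_eq_iff scaleR_add_right)
  have "AE x in lborel. E x = 0"
  proof (rule AE_zero_if_box_integrals_zero[OF iE])
    fix a b :: "real^2"
    \<comment> \<open>E is cut off outside the ball, so its integral over the box is one over this
      convex set, to which \<open>box_average\<close> applies.\<close>
    let ?Q = "box a b \<inter> ball 0 r'"
    have Q: "?Q \<in> sets borel" "convex ?Q" "?Q \<subseteq> ball 0 r'" by (auto intro: convex_Int)
    have "(LINT x:box a b|lborel. E x) = (LINT x|lborel. 2 * of_real poisson_mass * (indicator ?Q x *\<^sub>R H x) + indicator ?Q x *\<^sub>R potential x)"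
      unfolding set_lebesgue_integral_def
      by (intro Bochner_Integration.integral_cong refl) (auto simp: E_def indicator_def)
    also have "\<dots> = 2 * of_real poisson_mass * (LINT x|lborel. indicator ?Q x *\<^sub>R H x) + (LINT x|lborel. indicator ?Q x *\<^sub>R potential x)"
      by (simp only: Bochner_Integration.integral_add[OF integrable_mult_right[OF iH[OF Q(1,3)]] iP[OF Q(1,3)]]
          integral_mult_right_zero)
    also have "\<dots> = 0" using box_average[OF Q r'] by simp
    finally show "(LINT x:box a b|lborel. E x) = 0" .
  qed
  then show ?thesis
    by (rule eventually_mono) (auto simp: E_def eq_neg_iff_add_eq_0)
qed

end

section \<open>Limits of gradients\<close>

lemma C_k_compose_linear:
  assumes "bounded_linear l" shows "C_k k f \<Longrightarrow> C_k k (\<lambda>x. f (l x))"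
proof (induction k arbitrary: f)
  case 0
  then show ?case
    using assms continuous_on_compose2[of UNIV f UNIV l] by (simp add: linear_continuous_on)
next
  case (Suc k)
  have "((\<lambda>x. f (l x)) has_derivative (\<lambda>v. frechet_derivative f (at (l x)) (l v))) (at x)" for x
    by (rule has_derivative_compose[OF bounded_linear_imp_has_derivative[OF assms] C_k_Suc_has_derivative[OF Suc.prems]])
  then show ?case
    by (rule C_k_SucI) (rule Suc.IH[OF C_k_Suc_deriv[OF Suc.prems]])
qed

lemma borel_measurable_cnj [measurable]: "cnj \<in> borel_measurable borel"
  by (intro borel_measurable_continuous_onI continuous_intros)

text \<open>The gradient of Re h at a point where h' = d, by the Cauchy-Riemann equations.\<close>

definition gvec :: "complex \<Rightarrow> real^2" where
  "gvec d = (\<chi> i. if i = 1 then Re d else - Im d)"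

lemma gvec_nth [simp]: "gvec d $ 1 = Re d" "gvec d $ 2 = - Im d"
  by (simp_all add: gvec_def)

lemma gvec_add: "gvec (c + d) = gvec c + gvec d"
  and gvec_diff: "gvec (c - d) = gvec c - gvec d"
  and gvec_scaleR: "gvec (a *\<^sub>R d) = a *\<^sub>R gvec d"
  by (simp_all add: vec_eq_iff forall_2)

lemma norm_gvec [simp]: "norm (gvec d) = cmod d"
  by (simp add: cmod_def norm_vec_def L2_set_def sum_2)

lemma gvec_cnj_cplx [simp]: "gvec (cnj (cplx y)) = y"
  by (simp add: vec_eq_iff forall_2)

lemma inner_gvec: "gvec d \<bullet> v = Re (d * cplx v)"
  by (simp add: inner_vec_def sum_2)

lemma borel_measurable_gvec [measurable]: "gvec \<in> borel_measurable borel"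
proof -
  have "bounded_linear gvec"
    by (rule bounded_linear_intro[of _ 1]) (simp_all add: gvec_add gvec_scaleR)
  then show ?thesis
    by (intro borel_measurable_continuous_onI linear_continuous_on)
qed

lemma measurable_lebesgueI: "f \<in> borel_measurable borel \<Longrightarrow> f \<in> borel_measurable lebesgue"
  by (intro measurable_completion) simp

definition perp :: "real^2 \<Rightarrow> real^2" where
  "perp y = (\<chi> i. if i = 1 then - y $ 2 else y $ 1)"

lemma perp_nth [simp]: "perp y $ 1 = - y $ 2" "perp y $ 2 = y $ 1"
  by (simp_all add: perp_def)

lemma norm_perp [simp]: "norm (perp y) = norm y"
  by (simp add: norm_vec_def L2_set_def sum_2 add.commute)

lemma perp_measurable: "Y \<in> borel_measurable M \<Longrightarrow> (\<lambda>x. perp (Y x)) \<in> borel_measurable M"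
proof -
  have "bounded_linear perp"
    by (rule bounded_linear_intro[of _ 1]) (simp_all add: vec_eq_iff forall_2)
  then have "perp \<in> borel_measurable borel"
    by (intro borel_measurable_continuous_onI linear_continuous_on)
  then show "Y \<in> borel_measurable M \<Longrightarrow> (\<lambda>x. perp (Y x)) \<in> borel_measurable M"
    by (rule measurable_compose[rotated])
qed

lemma L2_perp: "Y \<in> L2 M \<Longrightarrow> (\<lambda>x. perp (Y x)) \<in> L2 M"
  by (auto simp: L2_def perp_measurable)

text \<open>A quarter turn converts curl into divergence, which makes the condition a pairing with
  gradients that passes to L2 limits.\<close>

lemma curl_free_perp: "curl_free Y \<longleftrightarrow> (\<forall>\<phi>. test_function \<phi> \<longrightarrow> (LINT x|lebesgue. perp (Y x) \<bullet> grad \<phi> x) = 0)"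
  by (simp add: curl_free_def inner_vec_def sum_2)

lemma L2_grad: "test_function \<phi> \<Longrightarrow> grad \<phi> \<in> L2 lebesgue"
proof -
  assume \<phi>: "test_function \<phi>"
  obtain \<rho> where \<rho>: "\<And>x. norm x > \<rho> \<Longrightarrow> grad \<phi> x = 0"
    using test_function_support[OF \<phi>] by metis
  have "integrable lborel (\<lambda>x. (norm (grad \<phi> x))\<^sup>2)"
    by (rule integrable_continuous_bounded_support[of _ \<rho>])
      (use \<rho> grad_continuous[OF \<phi>] in \<open>auto intro!: continuous_intros\<close>)
  then show "grad \<phi> \<in> L2 lebesgue"
    using grad_borel[OF \<phi>] by (simp add: L2_def integrable_completion measurable_lebesgueI)
qed

lemma curl_free_add_scaleR:
  assumes "Y \<in> L2 lebesgue" "Y' \<in> L2 lebesgue" "curl_free Y" "curl_free Y'"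
  shows "curl_free (\<lambda>x. Y x + c *\<^sub>R Y' x)"
  unfolding curl_free_perp
proof (intro allI impI)
  fix \<phi> assume \<phi>: "test_function \<phi>"
  have "perp (a + c *\<^sub>R b) \<bullet> w = perp a \<bullet> w + c * (perp b \<bullet> w)" for a b w :: "real^2"
    by (simp add: inner_vec_def sum_2 algebra_simps)
  then show "(LINT x|lebesgue. perp (Y x + c *\<^sub>R Y' x) \<bullet> grad \<phi> x) = 0"
    using assms \<phi> by (simp add: L2_inner_integrable L2_perp L2_grad curl_free_perp)
qed

text \<open>The Cauchy representation uses product measurability and Fubini for
  \<open>lborel\<close>, so a Lebesgue measurable field is first changed on a null set.\<close>

lemma ex_borel_representative:
  fixes Y :: "real^2 \<Rightarrow> real^2"
  assumes "Y \<in> borel_measurable lebesgue"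
  obtains H where "H \<in> borel_measurable borel" "AE x in lebesgue. H x = cnj (cplx (Y x))"
proof -
  have "(\<lambda>x. Y x $ i) \<in> borel_measurable lebesgue" for i
    by (intro measurable_compose[OF assms]) (simp add: borel_measurable_continuous_onI continuous_intros)
  from completion_ex_borel_measurable_real[OF this]
  have "\<exists>g. g \<in> borel_measurable lborel \<and> (AE x in lborel. Y x $ i = g x)" for i by blast
  then obtain g where g: "\<And>i. g i \<in> borel_measurable lborel" "\<And>i. AE x in lborel. Y x $ i = g i x"
    by metis
  show ?thesis
  proof (rule that)
    have [measurable]: "g i \<in> borel_measurable borel" for i using g(1)[of i] by simp
    show "(\<lambda>x. of_real (g 1 x) - \<i> * of_real (g 2 x)) \<in> borel_measurable borel" by measurable
    have "AE x in lborel. of_real (g 1 x) - \<i> * of_real (g 2 x) = cnj (cplx (Y x))"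
      using g(2)[of 1] g(2)[of 2] by eventually_elim (simp add: complex_eq_iff)
    then show "AE x in lebesgue. of_real (g 1 x) - \<i> * of_real (g 2 x) = cnj (cplx (Y x))"
      by (rule AE_completion)
  qed
qed

lemma representative_square_integrable:
  fixes Y :: "real^2 \<Rightarrow> real^2"
  assumes Y: "Y \<in> L2 lebesgue" and H: "H \<in> borel_measurable borel" "AE x in lebesgue. H x = cnj (cplx (Y x))"
  shows "integrable lborel (\<lambda>x. (norm (H x))\<^sup>2)"
proof -
  have [measurable]: "H \<in> borel_measurable borel" by fact
  have "integrable lebesgue (\<lambda>x. (norm (H x))\<^sup>2)"
  proof (rule integrable_cong_AE_imp)
    show "integrable lebesgue (\<lambda>x. (norm (Y x))\<^sup>2)" using Y by (simp add: L2_def)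
    show "(\<lambda>x. (norm (H x))\<^sup>2) \<in> borel_measurable lebesgue" by (intro measurable_lebesgueI) simp
    show "AE x in lebesgue. (norm (Y x))\<^sup>2 = (norm (H x))\<^sup>2"
      using H(2) by eventually_elim simp
  qed
  then show ?thesis by (simp add: integrable_completion)
qed

text \<open>For H = Y_1 - i Y_2 the real part of the tested equation is the divergence condition and
  the imaginary part is the curl condition.\<close>

lemma weakly_holomorphicI:
  fixes Y :: "real^2 \<Rightarrow> real^2"
  assumes Y: "Y \<in> L2 lebesgue" "curl_free Y"
    and H: "H \<in> borel_measurable borel" "AE x in lebesgue. H x = cnj (cplx (Y x))"
    and \<zeta>: "test_function \<zeta>" "\<And>x. norm x \<le> r \<Longrightarrow> \<zeta> x = 1"
    and div: "\<And>\<phi>. test_function \<phi> \<Longrightarrow> (\<And>x. \<zeta> x = 0 \<Longrightarrow> \<phi> x = 0) \<Longrightarrow> (LINT x|lebesgue. Y x \<bullet> grad \<phi> x) = 0"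
  shows "weakly_holomorphic H \<zeta> r"
proof
  have [measurable]: "H \<in> borel_measurable borel" by fact
  have H2: "integrable lborel (\<lambda>x. (norm (H x))\<^sup>2)"
    by (rule representative_square_integrable[OF Y(1) H])
  show "integrable lborel (\<lambda>x. indicator (cball 0 \<rho>) x *\<^sub>R H x)" for \<rho>
  proof (rule Bochner_Integration.integrable_bound)
    show "integrable lborel (\<lambda>x. indicator (cball 0 \<rho>) x + (norm (H x))\<^sup>2)"
      using emeasure_bounded_finite[OF bounded_cball, of 0 \<rho>]
      by (intro Bochner_Integration.integrable_add H2 integrable_real_indicator) auto
    have "t \<le> 1 + t\<^sup>2" for t :: real
      using zero_le_power2[of "t - 1/2"] by (simp add: power2_eq_square algebra_simps)
    then have "norm (indicator (cball 0 \<rho>) x *\<^sub>R H x) \<le> norm (indicator (cball 0 \<rho>) x + (norm (H x))\<^sup>2)" for x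
      by (auto simp: indicator_def)
    then show "AE x in lborel. norm (indicator (cball 0 \<rho>) x *\<^sub>R H x) \<le> norm (indicator (cball 0 \<rho>) x + (norm (H x))\<^sup>2)"
      by (intro AE_I2)
    show "(\<lambda>x. indicator (cball 0 \<rho>) x *\<^sub>R H x) \<in> borel_measurable lborel"
      using H(1) by (intro borel_measurable_scaleR borel_measurable_indicator) auto
  qed
  fix \<phi> assume \<phi>: "test_function \<phi>" "\<And>x. \<zeta> x = 0 \<Longrightarrow> \<phi> x = 0"
  have [measurable]: "grad \<phi> \<in> borel_measurable borel" by (rule grad_borel[OF \<phi>(1)])
  have i: "integrable lebesgue (\<lambda>x. Y x \<bullet> grad \<phi> x)" "integrable lebesgue (\<lambda>x. perp (Y x) \<bullet> grad \<phi> x)"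
    by (intro L2_inner_integrable L2_perp Y L2_grad \<phi>)+
  have "(LINT x|lborel. H x * cplx (grad \<phi> x)) = (LINT x|lebesgue. H x * cplx (grad \<phi> x))"
    by (rule integral_completion[symmetric]) simp
  also have "\<dots> = (LINT x|lebesgue. of_real (Y x \<bullet> grad \<phi> x) + \<i> * of_real (perp (Y x) \<bullet> grad \<phi> x))"
  proof (rule integral_cong_AE)
    show "(\<lambda>x. H x * cplx (grad \<phi> x)) \<in> borel_measurable lebesgue" by (intro measurable_lebesgueI) simp
    show "(\<lambda>x. of_real (Y x \<bullet> grad \<phi> x) + \<i> * of_real (perp (Y x) \<bullet> grad \<phi> x)) \<in> borel_measurable lebesgue"
      using i by (intro borel_measurable_integrable) simp
    show "AE x in lebesgue. H x * cplx (grad \<phi> x) = of_real (Y x \<bullet> grad \<phi> x) + \<i> * of_real (perp (Y x) \<bullet> grad \<phi> x)"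
      using H(2) by eventually_elim (simp add: complex_eq_iff inner_vec_def sum_2)
  qed
  also have "\<dots> = of_real (LINT x|lebesgue. Y x \<bullet> grad \<phi> x) + \<i> * of_real (LINT x|lebesgue. perp (Y x) \<bullet> grad \<phi> x)"
    using i by simp
  also have "\<dots> = 0"
    using div[OF \<phi>] Y(2) \<phi>(1) by (simp add: curl_free_perp)
  finally show "(LINT x|lborel. H x * cplx (grad \<phi> x)) = 0" .
qed (use H \<zeta> in auto)

text \<open>Cauchy-Schwarz: the area of the disk is proportional to n^2, hence the linear factor
  n.\<close>

lemma integral_ball_le:
  assumes H: "H \<in> borel_measurable borel" "integrable lborel (\<lambda>x. (norm (H x :: complex))\<^sup>2)" and n: "0 \<le> n"
  shows "(LINT x|lborel. indicator (cball (0::real^2) n) x * norm (H x)) \<le> n * sqrt (measure lborel (cball (0::real^2) 1) * nsq lborel H)"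
proof -
  have fin: "emeasure lborel (cball (0::real^2) n) < \<infinity>"
    using emeasure_bounded_finite[OF bounded_cball] by simp
  have sq: "(indicator (cball 0 n) x :: real)\<^sup>2 = indicator (cball 0 n) x" for x :: "real^2"
    by (simp add: indicator_def)
  have "(indicator (cball (0::real^2) n) :: _ \<Rightarrow> real) \<in> L2 lborel"
    using fin by (simp add: L2_def sq borel_measurable_indicator)
  moreover have "(\<lambda>x. norm (H x)) \<in> L2 lborel"
    using H by (simp add: L2_def)
  ultimately have "(LINT x|lborel. indicator (cball (0::real^2) n) x \<bullet> norm (H x))\<^sup>2
    \<le> nsq lborel (indicator (cball (0::real^2) n) :: _ \<Rightarrow> real) * nsq lborel (\<lambda>x. norm (H x))"
    by (rule L2_Cauchy_Schwarz)
  also have "nsq lborel (indicator (cball (0::real^2) n) :: _ \<Rightarrow> real) = measure lborel (cball (0::real^2) n)"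
    by (simp add: sq)
  also have "\<dots> = n\<^sup>2 * measure lborel (cball (0::real^2) 1)"
    using n by (simp add: content_cball)
  finally have "(LINT x|lborel. indicator (cball (0::real^2) n) x * norm (H x))\<^sup>2
    \<le> (n * sqrt (measure lborel (cball (0::real^2) 1) * nsq lborel H))\<^sup>2"
    by (simp add: power_mult_distrib mult.assoc)
  then show ?thesis
    by (rule power2_le_imp_le) (use n in simp)
qed

text \<open>
  Liouville: on the ball of radius \<open>n\<close>, the Cauchy representation with a cutoff at scale \<open>n\<close>
  bounds an \<open>L2\<close> field by a multiple of \<open>1 / n\<close>.
\<close>

lemma div_curl_free_zero:
  fixes Y :: "real^2 \<Rightarrow> real^2"
  assumes Y: "Y \<in> L2 lebesgue" "curl_free Y"
    and div: "\<And>\<phi>. test_function \<phi> \<Longrightarrow> (LINT x|lebesgue. Y x \<bullet> grad \<phi> x) = 0"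
  shows "AE x in lebesgue. Y x = 0"
proof -
  obtain H where H: "H \<in> borel_measurable borel" "AE x in lebesgue. H x = cnj (cplx (Y x))"
    by (rule ex_borel_representative[OF L2_measurable[OF Y(1)]])
  have [measurable]: "H \<in> borel_measurable borel" by fact
  have H2: "integrable lborel (\<lambda>x. (norm (H x))\<^sup>2)"
    by (rule representative_square_integrable[OF Y(1) H])
  obtain \<zeta> :: "real^2 \<Rightarrow> real" where \<zeta>: "test_function \<zeta>" "\<And>x. norm x \<le> 2 \<Longrightarrow> \<zeta> x = 1" "\<And>x. norm x \<ge> 3 \<Longrightarrow> \<zeta> x = 0"
    using ex_cutoff[of 2 3] by auto
  obtain \<rho>0 where \<rho>0: "0 < \<rho>0" "\<And>x. norm x > \<rho>0 \<Longrightarrow> grad \<zeta> x = 0"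
    using test_function_support[OF \<zeta>(1)] by metis
  have "bounded (grad \<zeta> ` cball 0 \<rho>0)"
    using grad_continuous[OF \<zeta>(1)] continuous_on_subset
    by (intro compact_imp_bounded compact_continuous_image) auto
  then obtain B where B: "0 < B" "\<And>x. norm x \<le> \<rho>0 \<Longrightarrow> norm (grad \<zeta> x) \<le> B"
    unfolding bounded_pos by auto
  \<comment> \<open>Independent of the scale n: the gradient of the rescaled cutoff contributes 1 /
    n, and the L1 norm of H on the ball of radius \<rho>0 n contributes n. The decay is left to the
    distance 2 n - n between point and source.\<close>
  define C where "C = B * \<rho>0 * sqrt (measure lborel (cball (0::real^2) 1) * nsq lborel H)"
  have main: "AE x in lborel. norm x < n \<longrightarrow> 2 * poisson_mass * norm (H x) \<le> C / n" if n: "0 < n" for n :: real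
  proof -
    define \<zeta>n where "\<zeta>n x = \<zeta> (inverse n *\<^sub>R x)" for x
    have \<zeta>n: "test_function \<zeta>n"
    proof (rule test_functionI)
      show "C_k k \<zeta>n" for k
        unfolding \<zeta>n_def by (rule C_k_compose_linear[OF bounded_linear_scaleR_right test_function_C_k[OF \<zeta>(1)]])
      show "bounded {x. \<zeta>n x \<noteq> 0}"
      proof (rule boundedI)
        fix x assume "x \<in> {x. \<zeta>n x \<noteq> 0}"
        then have "\<not> 3 \<le> norm (inverse n *\<^sub>R x)" using \<zeta>(3) by (auto simp: \<zeta>n_def)
        then show "norm x \<le> 3 * n" using n by (simp add: field_simps)
      qed
    qed
    have grad: "grad \<zeta>n x = inverse n *\<^sub>R grad \<zeta> (inverse n *\<^sub>R x)" for x
    proof (rule grad_eqI)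
      have "(\<zeta>n has_derivative (\<lambda>v. grad \<zeta> (inverse n *\<^sub>R x) \<bullet> (inverse n *\<^sub>R v))) (at x)"
        unfolding \<zeta>n_def
        by (rule has_derivative_compose[OF bounded_linear_imp_has_derivative[OF bounded_linear_scaleR_right] test_function_has_derivative[OF \<zeta>(1)]])
      then show "(\<zeta>n has_derivative (\<lambda>v. (inverse n *\<^sub>R grad \<zeta> (inverse n *\<^sub>R x)) \<bullet> v)) (at x)" by simp
    qed
    have WH: "weakly_holomorphic H \<zeta>n (2 * n)"
      by (rule weakly_holomorphicI[OF Y H \<zeta>n _ div])
        (use \<zeta>(2) n in \<open>auto simp: \<zeta>n_def field_simps\<close>)
    interpret W: weakly_holomorphic H \<zeta>n "2 * n" by (rule WH)
    have le: "norm (W.source x) \<le> B / n * (indicator (cball 0 (\<rho>0 * n)) x * norm (H x))" for x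
    proof (cases "norm x \<le> \<rho>0 * n")
      case True
      then have "norm (inverse n *\<^sub>R x) \<le> \<rho>0" using n by (simp add: field_simps)
      from mult_left_mono[OF B(2)[OF this], of "norm (H x) / n"] show ?thesis
        using True n by (simp add: W.source_def norm_mult grad field_simps)
    next
      case False
      then have "norm (inverse n *\<^sub>R x) > \<rho>0" using n by (simp add: field_simps)
      then show ?thesis using False \<rho>0 by (simp add: W.source_def grad)
    qed
    have iH: "integrable lborel (\<lambda>x. indicator (cball 0 (\<rho>0 * n)) x * norm (H x))"
      using integrable_norm[OF W.H_loc[of "\<rho>0 * n"]] by simp
    have "(LINT y|lborel. norm (W.source y)) \<le> (LINT x|lborel. B / n * (indicator (cball 0 (\<rho>0 * n)) x * norm (H x)))"
      by (intro integral_mono integrable_norm W.source_integrable integrable_mult_right iH le)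
    also have "\<dots> = B / n * (LINT x|lborel. indicator (cball 0 (\<rho>0 * n)) x * norm (H x))" by simp
    also have "\<dots> \<le> B / n * ((\<rho>0 * n) * sqrt (measure lborel (cball (0::real^2) 1) * nsq lborel H))"
      using B n \<rho>0 by (intro mult_left_mono integral_ball_le H H2) auto
    also have "\<dots> = C" using n by (simp add: C_def)
    finally have S: "(LINT y|lborel. norm (W.source y)) \<le> C" .
    have "AE x in lborel. norm x < n \<longrightarrow> 2 * of_real poisson_mass * H x = - W.potential x"
      using n by (intro W.cauchy_representation) simp
    then show ?thesis
    proof (rule eventually_mono, intro impI)
      fix x assume eq: "norm x < n \<longrightarrow> 2 * of_real poisson_mass * H x = - W.potential x" and x: "norm x < n"
      have "2 * poisson_mass * norm (H x) = norm (2 * of_real poisson_mass * H x)"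
        using poisson_mass_pos by (simp add: norm_mult)
      also have "\<dots> = norm (W.potential x)" using eq x by simp
      also have "\<dots> \<le> (LINT y|lborel. norm (W.source y)) / (2 * n - n)"
        using n by (intro W.potential_bound x) simp
      also have "\<dots> \<le> C / n" using S n by (simp add: divide_right_mono)
      finally show "2 * poisson_mass * norm (H x) \<le> C / n" .
    qed
  qed
  have "AE x in lborel. \<forall>n. norm x < real (Suc n) \<longrightarrow> 2 * poisson_mass * norm (H x) \<le> C / real (Suc n)"
    using main by (simp add: AE_all_countable)
  then have "AE x in lborel. H x = 0"
  proof (rule eventually_mono)
    fix x assume *: "\<forall>n. norm x < real (Suc n) \<longrightarrow> 2 * poisson_mass * norm (H x) \<le> C / real (Suc n)"
    have "(\<lambda>n. C * inverse (real (Suc n))) \<longlonglongrightarrow> 0"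
      by (intro tendsto_mult_right_zero LIMSEQ_inverse_real_of_nat)
    moreover obtain N where N: "norm x < real N" using reals_Archimedean2 by blast
    have "\<exists>N. \<forall>n\<ge>N. 2 * poisson_mass * norm (H x) \<le> C * inverse (real (Suc n))"
      using * N by (intro exI[of _ N]) (auto simp: divide_inverse)
    ultimately have "2 * poisson_mass * norm (H x) \<le> 0"
      by (rule LIMSEQ_le_const)
    then show "H x = 0" using poisson_mass_pos by (simp add: mult_le_0_iff)
  qed
  then have "AE x in lebesgue. H x = 0" by (rule AE_completion)
  with H(2) show ?thesis
  proof eventually_elim
    fix x assume "H x = cnj (cplx (Y x))" "H x = 0"
    then have "cmod (cplx (Y x)) = 0" by simp
    then show "Y x = 0" by simp
  qed
qed

section \<open>The L2 closure of gradients\<close>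

text \<open>The closure is formed for gradients alone: members of \<open>Hdot1\<close> need not be
  square-integrable themselves, and no convergence of the \<open>\<phi> n\<close> is asked
  for.\<close>

definition gradient_limit :: "(real^2 \<Rightarrow> real^2) \<Rightarrow> bool" where
  "gradient_limit Y \<longleftrightarrow> Y \<in> L2 lebesgue \<and>
    (\<exists>\<phi>. (\<forall>n. test_function (\<phi> n)) \<and> (\<lambda>n. nsq lebesgue (\<lambda>x. grad (\<phi> n) x - Y x)) \<longlonglongrightarrow> 0)"

text \<open>Makes a limit of gradients an admissible test field, the substitute for testing an
  equation with its own solution.\<close>

lemma gradient_limit_extend:
  assumes E: "gradient_limit E" and W: "W \<in> L2 lebesgue"
    and eq: "\<And>\<phi>. test_function \<phi> \<Longrightarrow> (LINT x|lebesgue. W x \<bullet> grad \<phi> x) = 0"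
  shows "(LINT x|lebesgue. W x \<bullet> E x) = 0"
proof -
  obtain \<phi> where \<phi>: "\<And>n. test_function (\<phi> n)" "(\<lambda>n. nsq lebesgue (\<lambda>x. grad (\<phi> n) x - E x)) \<longlonglongrightarrow> 0"
    using E by (auto simp: gradient_limit_def)
  have "(\<lambda>n. LINT x|lebesgue. W x \<bullet> grad (\<phi> n) x) \<longlonglongrightarrow> (LINT x|lebesgue. W x \<bullet> E x)"
    using E by (intro L2_inner_tendsto W L2_grad \<phi>) (simp add: gradient_limit_def)
  then show ?thesis using eq[OF \<phi>(1)] by (simp add: LIMSEQ_const_iff)
qed

lemma gradient_limit_curl_free:
  assumes E: "gradient_limit E" shows "curl_free E"
  unfolding curl_free_perp
proof (intro allI impI)
  fix \<psi> assume \<psi>: "test_function \<psi>"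
  have adj: "perp y \<bullet> z = - (perp z \<bullet> y)" for y z :: "real^2"
    by (simp add: inner_vec_def sum_2)
  have "(LINT x|lebesgue. perp (grad \<psi> x) \<bullet> E x) = 0"
  proof (rule gradient_limit_extend[OF E L2_perp[OF L2_grad[OF \<psi>]]])
    show "(LINT x|lebesgue. perp (grad \<psi> x) \<bullet> grad \<phi> x) = 0" if "test_function \<phi>" for \<phi>
      using curl_free_grad[OF \<psi>] that by (simp add: curl_free_perp)
  qed
  then show "(LINT x|lebesgue. perp (E x) \<bullet> grad \<psi> x) = 0"
    by (subst adj) simp
qed

lemma gradient_limit_projection:
  assumes X: "X \<in> L2 lebesgue"
  obtains P where "gradient_limit P" "\<And>\<phi>. test_function \<phi> \<Longrightarrow> (LINT x|lebesgue. (X x - P x) \<bullet> grad \<phi> x) = 0"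
proof -
  let ?V = "grad ` {\<phi>. test_function \<phi>}"
  have zero: "test_function (\<lambda>x. 0)" by (rule test_functionI) (auto intro: C_k_const)
  have add: "(\<lambda>x. f x + g x) \<in> ?V" if fg: "f \<in> ?V" "g \<in> ?V" for f g
  proof -
    obtain \<phi> \<psi> where "test_function \<phi>" "f = grad \<phi>" "test_function \<psi>" "g = grad \<psi>" using fg by blast
    then show ?thesis
      by (intro image_eqI[of _ _ "\<lambda>x. \<phi> x + \<psi> x"]) (auto simp: grad_add test_function_add)
  qed
  have scale: "(\<lambda>x. c *\<^sub>R f x) \<in> ?V" if f: "f \<in> ?V" for c f
  proof -
    obtain \<phi> where "test_function \<phi>" "f = grad \<phi>" using f by blast
    then show ?thesis
      by (intro image_eqI[of _ _ "\<lambda>x. c * \<phi> x"]) (auto simp: grad_cmult test_function_cmult)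
  qed
  have V: "?V \<subseteq> L2 lebesgue" "?V \<noteq> {}" using L2_grad zero by auto
  obtain P v where P: "P \<in> L2 lebesgue" and v: "\<And>n. v n \<in> ?V"
    and lim: "(\<lambda>n. nsq lebesgue (\<lambda>x. v n x - P x)) \<longlonglongrightarrow> 0"
    and orth: "\<And>w. w \<in> ?V \<Longrightarrow> (LINT x|lebesgue. (X x - P x) \<bullet> w x) = 0"
    using L2_projection[OF X V add scale] by blast
  have "\<forall>n. \<exists>\<phi>. test_function \<phi> \<and> v n = grad \<phi>" using v by auto
  then obtain \<phi> where \<phi>: "\<And>n. test_function (\<phi> n)" "\<And>n. v n = grad (\<phi> n)" by metis
  show ?thesis
  proof (rule that)
    show "gradient_limit P"
      unfolding gradient_limit_def using P lim \<phi> by auto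
  qed (use orth in auto)
qed

text \<open>Y minus its projection is curl-free, and being orthogonal to all gradients it is
  divergence-free as well; \<open>div_curl_free_zero\<close> then identifies Y with its
  projection.\<close>

lemma curl_free_gradient_limit:
  assumes Y: "Y \<in> L2 lebesgue" "curl_free Y"
  shows "gradient_limit Y"
proof -
  obtain P where P: "gradient_limit P" and orth: "\<And>\<phi>. test_function \<phi> \<Longrightarrow> (LINT x|lebesgue. (Y x - P x) \<bullet> grad \<phi> x) = 0"
    by (rule gradient_limit_projection[OF Y(1)], rule that)
  have PL: "P \<in> L2 lebesgue" using P by (simp add: gradient_limit_def)
  have "curl_free (\<lambda>x. Y x - P x)"
    using curl_free_add_scaleR[OF Y(1) PL Y(2) gradient_limit_curl_free[OF P], of "-1"] by simp
  then have eq: "AE x in lebesgue. Y x - P x = 0"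
    by (intro div_curl_free_zero L2_diff Y PL orth)
  obtain \<phi> where \<phi>: "\<And>n. test_function (\<phi> n)" "(\<lambda>n. nsq lebesgue (\<lambda>x. grad (\<phi> n) x - P x)) \<longlonglongrightarrow> 0"
    using P by (auto simp: gradient_limit_def)
  have "nsq lebesgue (\<lambda>x. grad (\<phi> n) x - P x) = nsq lebesgue (\<lambda>x. grad (\<phi> n) x - Y x)" for n
  proof (rule integral_cong_AE)
    show "AE x in lebesgue. (norm (grad (\<phi> n) x - P x))\<^sup>2 = (norm (grad (\<phi> n) x - Y x))\<^sup>2"
      using eq by eventually_elim simp
  qed (use L2_integrable_norm[OF L2_diff[OF L2_grad[OF \<phi>(1)] PL]] L2_integrable_norm[OF L2_diff[OF L2_grad[OF \<phi>(1)] Y(1)]] in auto)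
  then show ?thesis
    using \<phi> Y by (auto simp: gradient_limit_def)
qed

section \<open>Local expansion and the energy estimate\<close>

text \<open>The exact remainder keeps everything finite, so integrals are exchanged with finite sums
  only.\<close>

lemma geometric_remainder:
  fixes w z :: complex
  assumes "w \<noteq> 0" "w \<noteq> z"
  shows "1 / (w - z) = (\<Sum>k<K. z ^ k / w ^ Suc k) + z ^ K / (w ^ K * (w - z))"
proof (induction K)
  case (Suc K)
  have "z ^ K / (w ^ K * (w - z)) = z ^ K / w ^ Suc K + z ^ Suc K / (w ^ Suc K * (w - z))"
    using assms by (simp add: field_simps)
  then show ?case unfolding Suc.IH sum.lessThan_Suc by simp
qed simp

context weakly_holomorphic
begin

text \<open>The k-th Taylor coefficient of \<open>potential\<close> at 0, from expanding 1 / (y - x)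
  in powers of x.\<close>

definition coeff_integral :: "nat \<Rightarrow> complex" where
  "coeff_integral k = (LINT y|lborel. source y / cplx y ^ Suc k)"

lemma source_power_bound:
  assumes "0 < r"
  shows "norm (source y / cplx y ^ k) \<le> norm (source y) / r ^ k"
proof (cases "norm y < r")
  case False
  then have "r ^ k \<le> norm y ^ k" using assms by (intro power_mono) auto
  then show ?thesis
    using assms False by (auto simp: norm_divide norm_power intro!: divide_left_mono mult_pos_pos zero_less_power)
qed (simp add: source_zero)

lemma source_power_integrable:
  assumes "0 < r"
  shows "integrable lborel (\<lambda>y. source y / cplx y ^ k)"
proof (rule Bochner_Integration.integrable_bound)
  show "integrable lborel (\<lambda>y. norm (source y) / r ^ k)" using source_integrable by simp
  show "AE y in lborel. norm (source y / cplx y ^ k) \<le> norm (norm (source y) / r ^ k)"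
    using source_power_bound[OF assms] assms by (intro AE_I2) simp
qed measurable

lemma coeff_integral_bound:
  assumes "0 < r"
  shows "norm (coeff_integral k) \<le> (LINT y|lborel. norm (source y)) / r ^ Suc k"
proof -
  have "norm (coeff_integral k) \<le> (LINT y|lborel. norm (source y) / r ^ Suc k)"
    unfolding coeff_integral_def
    by (intro order_trans[OF integral_norm_bound] integral_mono integrable_norm source_power_integrable assms
        source_power_bound) (simp add: source_integrable)
  then show ?thesis by simp
qed

text \<open>The finite geometric identity is integrated against the source, which lives at modulus
  at least r; the remainder carries K powers of x over K powers of y.\<close>

lemma potential_expansion:
  assumes r: "0 < r" and x: "norm x < r'" "r' < r"
  shows "norm (potential x - (\<Sum>k<K. coeff_integral k * cplx x ^ k))
    \<le> (LINT y|lborel. norm (source y)) / (r - r') * (r' / r) ^ K"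
proof -
  have r': "0 < r'" using x by (meson le_less_trans norm_ge_zero)
  have eq: "source y / cplx (y - x) = (\<Sum>k<K. source y / cplx y ^ Suc k * cplx x ^ k)
     + cplx x ^ K * (source y * (1 / (cplx y ^ K * cplx (y - x))))" for y
  proof (cases "norm y < r")
    case False
    then have "cplx y \<noteq> 0" "cplx y \<noteq> cplx x"
      using x r cmod_cplx[of y] cmod_cplx[of x] by (auto simp del: cmod_cplx)
    then have "source y * (1 / (cplx y - cplx x))
      = source y * ((\<Sum>k<K. cplx x ^ k / cplx y ^ Suc k) + cplx x ^ K / (cplx y ^ K * (cplx y - cplx x)))"
      by (intro arg_cong[where f="(*) (source y)"] geometric_remainder)
    then show ?thesis by (simp add: cplx_diff distrib_left sum_distrib_left mult.commute)
  qed (simp add: source_zero)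
  have bd: "norm (source y * (1 / (cplx y ^ K * cplx (y - x)))) \<le> norm (source y) / (r ^ K * (r - r'))" for y
  proof (cases "norm y < r")
    case False
    then have "r - r' \<le> norm (y - x)" using x norm_triangle_ineq2[of y x] by simp
    moreover have "r ^ K \<le> norm y ^ K" using r False by (intro power_mono) auto
    ultimately have "r ^ K * (r - r') \<le> norm y ^ K * norm (y - x)"
      using x by (intro mult_mono) auto
    then have "1 / (norm y ^ K * norm (y - x)) \<le> 1 / (r ^ K * (r - r'))"
      using r x by (intro frac_le) auto
    from mult_left_mono[OF this, of "norm (source y)"]
    show ?thesis by (simp add: norm_mult norm_divide norm_power)
  qed (simp add: source_zero)
  have iR: "integrable lborel (\<lambda>y. source y * (1 / (cplx y ^ K * cplx (y - x))))"
  proof (rule Bochner_Integration.integrable_bound)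
    show "integrable lborel (\<lambda>y. norm (source y) / (r ^ K * (r - r')))" using source_integrable by simp
    show "AE y in lborel. norm (source y * (1 / (cplx y ^ K * cplx (y - x)))) \<le> norm (norm (source y) / (r ^ K * (r - r')))"
      using bd r x by (intro AE_I2) simp
  qed measurable
  define T where "T = (LINT y|lborel. source y * (1 / (cplx y ^ K * cplx (y - x))))"
  have "potential x = (LINT y|lborel. (\<Sum>k<K. source y / cplx y ^ Suc k * cplx x ^ k))
      + (LINT y|lborel. cplx x ^ K * (source y * (1 / (cplx y ^ K * cplx (y - x)))))"
    unfolding potential_def eq
    by (intro Bochner_Integration.integral_add Bochner_Integration.integrable_sum integrable_mult_left integrable_mult_right
        source_power_integrable r iR)
  also have "(LINT y|lborel. (\<Sum>k<K. source y / cplx y ^ Suc k * cplx x ^ k)) = (\<Sum>k<K. coeff_integral k * cplx x ^ k)"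
    unfolding coeff_integral_def
    by (subst Bochner_Integration.integral_sum)
      (intro integrable_mult_left source_power_integrable r, simp only: integral_mult_left_zero)
  also have "(LINT y|lborel. cplx x ^ K * (source y * (1 / (cplx y ^ K * cplx (y - x))))) = cplx x ^ K * T"
    unfolding T_def by (rule integral_mult_right_zero)
  finally have "norm (potential x - (\<Sum>k<K. coeff_integral k * cplx x ^ k)) = norm x ^ K * norm T"
    by (simp add: norm_mult norm_power)
  also have "\<dots> \<le> r' ^ K * ((LINT y|lborel. norm (source y)) / (r ^ K * (r - r')))"
  proof (intro mult_mono power_mono)
    have "norm T \<le> (LINT y|lborel. norm (source y) / (r ^ K * (r - r')))"
      unfolding T_def
      by (intro order_trans[OF integral_norm_bound] integral_mono integrable_norm iR bd) (simp add: source_integrable)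
    then show "norm T \<le> (LINT y|lborel. norm (source y)) / (r ^ K * (r - r'))" by simp
  qed (use x r' in auto)
  also have "\<dots> = (LINT y|lborel. norm (source y)) / (r - r') * (r' / r) ^ K"
    by (simp add: power_divide mult.commute)
  finally show ?thesis .
qed

end

text \<open>The Cauchy representation with a cutoff equal to 1 up to radius r and 0 from q on. C and
  b serve all truncations at once, since K will later depend on eta.\<close>

lemma harmonic_expansion:
  fixes Y :: "real^2 \<Rightarrow> real^2"
  assumes Y: "Y \<in> L2 lebesgue" "curl_free Y"
    and r: "0 < r'" "r' < r" "r < q"
    and div: "\<And>\<phi>. test_function \<phi> \<Longrightarrow> (\<And>x. norm x \<ge> q \<Longrightarrow> \<phi> x = 0) \<Longrightarrow> (LINT x|lebesgue. Y x \<bullet> grad \<phi> x) = 0"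
  obtains C b where "0 \<le> C" "\<And>k. cmod (b k) \<le> C / r ^ k"
    "\<And>K. AE x in lebesgue. norm x < r' \<longrightarrow> norm (Y x - gvec (\<Sum>k<K. b k * cplx x ^ k)) \<le> C * (r' / r) ^ K"
proof -
  obtain H where H: "H \<in> borel_measurable borel" "AE x in lebesgue. H x = cnj (cplx (Y x))"
    by (rule ex_borel_representative[OF L2_measurable[OF Y(1)]])
  obtain \<zeta> :: "real^2 \<Rightarrow> real" where \<zeta>: "test_function \<zeta>" "\<And>x. norm x \<le> r \<Longrightarrow> \<zeta> x = 1" "\<And>x. norm x \<ge> q \<Longrightarrow> \<zeta> x = 0"
    using ex_cutoff[of r q] r by auto
  have "weakly_holomorphic H \<zeta> r"
  proof (rule weakly_holomorphicI[OF Y H \<zeta>(1,2)])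
    show "(LINT x|lebesgue. Y x \<bullet> grad \<phi> x) = 0" if "test_function \<phi>" "\<And>x. \<zeta> x = 0 \<Longrightarrow> \<phi> x = 0" for \<phi>
      using that \<zeta>(3) by (intro div) auto
  qed
  then interpret W: weakly_holomorphic H \<zeta> r .
  define S where "S = (LINT y|lborel. norm (W.source y))"
  define m where "m = 2 * poisson_mass"
  define b where "b k = - W.coeff_integral k / of_real m" for k
  define C where "C = S / (r - r') / m + S / r / m"
  have m: "0 < m" using poisson_mass_pos by (simp add: m_def)
  have S: "0 \<le> S" unfolding S_def by (intro Bochner_Integration.integral_nonneg) simp
  have C: "S / (r - r') / m \<le> C" "S / r / m \<le> C" "0 \<le> C"
    using S m r by (simp_all add: C_def)
  show ?thesis
  proof (rule that[OF C(3)])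
    fix k
    have "cmod (b k) = cmod (W.coeff_integral k) / m" using m by (simp add: b_def norm_divide)
    also have "\<dots> \<le> S / r ^ Suc k / m"
      using W.coeff_integral_bound[of k] r m by (intro divide_right_mono) (auto simp: S_def)
    also have "\<dots> = S / r / m / r ^ k" by simp
    also have "\<dots> \<le> C / r ^ k" using C r by (intro divide_right_mono) auto
    finally show "cmod (b k) \<le> C / r ^ k" .
  next
    fix K
    have "AE x in lborel. norm x < r' \<longrightarrow> 2 * of_real poisson_mass * H x = - W.potential x"
      by (rule W.cauchy_representation[OF r(2)])
    then have "AE x in lebesgue. norm x < r' \<longrightarrow> 2 * of_real poisson_mass * H x = - W.potential x"
      by (rule AE_completion)
    with H(2) show "AE x in lebesgue. norm x < r' \<longrightarrow> norm (Y x - gvec (\<Sum>k<K. b k * cplx x ^ k)) \<le> C * (r' / r) ^ K"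
    proof (eventually_elim, intro impI)
      fix x assume Hx: "H x = cnj (cplx (Y x))" and x: "norm x < r'"
        and "norm x < r' \<longrightarrow> 2 * of_real poisson_mass * H x = - W.potential x"
      then have mH: "of_real m * H x = - W.potential x" by (simp add: m_def)
      have mb: "of_real m * b k = - W.coeff_integral k" for k using m by (simp add: b_def)
      have "of_real m * (\<Sum>k<K. b k * cplx x ^ k) = (\<Sum>k<K. (of_real m * b k) * cplx x ^ k)"
        by (simp add: sum_distrib_left mult.assoc)
      also have "\<dots> = - (\<Sum>k<K. W.coeff_integral k * cplx x ^ k)"
        unfolding mb by (simp add: sum_negf)
      finally have "of_real m * (H x - (\<Sum>k<K. b k * cplx x ^ k)) = - (W.potential x - (\<Sum>k<K. W.coeff_integral k * cplx x ^ k))"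
        by (simp only: right_diff_distrib mH) simp
      then have "norm (of_real m * (H x - (\<Sum>k<K. b k * cplx x ^ k))) = norm (W.potential x - (\<Sum>k<K. W.coeff_integral k * cplx x ^ k))"
        by (simp only: norm_minus_cancel)
      then have "m * norm (H x - (\<Sum>k<K. b k * cplx x ^ k)) = norm (W.potential x - (\<Sum>k<K. W.coeff_integral k * cplx x ^ k))"
        using m by (simp add: norm_mult)
      also have "\<dots> \<le> S / (r - r') * (r' / r) ^ K"
        unfolding S_def using r x by (intro W.potential_expansion) auto
      finally have "norm (H x - (\<Sum>k<K. b k * cplx x ^ k)) \<le> (S / (r - r') * (r' / r) ^ K) / m"
        by (subst pos_le_divide_eq[OF m]) (simp only: mult.commute)
      also have "\<dots> = S / (r - r') / m * (r' / r) ^ K" by simp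
      also have "\<dots> \<le> C * (r' / r) ^ K" using C r by (intro mult_right_mono) auto
      finally have "norm (gvec (H x - (\<Sum>k<K. b k * cplx x ^ k))) \<le> C * (r' / r) ^ K" by simp
      then show "norm (Y x - gvec (\<Sum>k<K. b k * cplx x ^ k)) \<le> C * (r' / r) ^ K"
        by (simp add: Hx gvec_diff)
    qed
  qed
qed

text \<open>
  Equations \<open>re\<close> and \<open>im\<close> are the two parts of the complex equation; the proof is the imaginary part of
  testing it with the conjugate of \<open>G - V + \<i> G'\<close>.
\<close>

lemma energy_estimate:
  fixes A :: "real^2 \<Rightarrow> real"
  assumes G: "gradient_limit G" "gradient_limit G'" and V: "gradient_limit V" and Z: "Z \<in> L2 lebesgue"
    and A: "A \<in> borel_measurable lebesgue" "\<And>x. \<bar>A x\<bar> \<le> 1" and \<eta>: "0 < \<eta>"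
    and re: "\<And>\<phi>. test_function \<phi> \<Longrightarrow>
      (LINT x|lebesgue. (A x *\<^sub>R G x - \<eta> *\<^sub>R G' x) \<bullet> grad \<phi> x) = (LINT x|lebesgue. (A x *\<^sub>R V x - Z x) \<bullet> grad \<phi> x)"
    and im: "\<And>\<phi>. test_function \<phi> \<Longrightarrow>
      (LINT x|lebesgue. (A x *\<^sub>R G' x + \<eta> *\<^sub>R G x) \<bullet> grad \<phi> x) = 0"
  shows "\<eta> * (nsq lebesgue G + nsq lebesgue G') \<le> 4 * \<eta> * nsq lebesgue V + 2 / \<eta> * nsq lebesgue Z"
proof -
  have L: "G \<in> L2 lebesgue" "G' \<in> L2 lebesgue" "V \<in> L2 lebesgue"
    using G V by (auto simp: gradient_limit_def)
  note LA = L2_bounded_mult[OF A]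
  define D where "D x = G x - V x" for x
  have DL: "D \<in> L2 lebesgue" unfolding D_def[abs_def] by (intro L2_diff L)
  have Dg: "gradient_limit D"
  proof (rule curl_free_gradient_limit[OF DL])
    show "curl_free D"
      using curl_free_add_scaleR[OF L(1,3) gradient_limit_curl_free[OF G(1)] gradient_limit_curl_free[OF V], of "-1"]
      by (simp add: D_def[abs_def])
  qed
  have W1: "(\<lambda>x. (A x *\<^sub>R D x - \<eta> *\<^sub>R G' x) + Z x) \<in> L2 lebesgue"
    and W2: "(\<lambda>x. (A x *\<^sub>R G' x + \<eta> *\<^sub>R D x) + \<eta> *\<^sub>R V x) \<in> L2 lebesgue"
    by (intro L2_add L2_diff L2_scaleR LA DL L Z)+
  have e1: "(LINT x|lebesgue. ((A x *\<^sub>R D x - \<eta> *\<^sub>R G' x) + Z x) \<bullet> G' x) = 0"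
  proof (rule gradient_limit_extend[OF G(2) W1])
    fix \<phi> assume \<phi>: "test_function \<phi>"
    have i: "integrable lebesgue (\<lambda>x. (A x *\<^sub>R G x - \<eta> *\<^sub>R G' x) \<bullet> grad \<phi> x)"
      "integrable lebesgue (\<lambda>x. (A x *\<^sub>R V x - Z x) \<bullet> grad \<phi> x)"
      by (intro L2_inner_integrable L2_diff L2_scaleR LA L Z L2_grad \<phi>)+
    have "(LINT x|lebesgue. ((A x *\<^sub>R D x - \<eta> *\<^sub>R G' x) + Z x) \<bullet> grad \<phi> x)
      = (LINT x|lebesgue. (A x *\<^sub>R G x - \<eta> *\<^sub>R G' x) \<bullet> grad \<phi> x - (A x *\<^sub>R V x - Z x) \<bullet> grad \<phi> x)"
      by (intro Bochner_Integration.integral_cong refl) (simp add: D_def algebra_simps)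
    also have "\<dots> = 0" using i re[OF \<phi>] by simp
    finally show "(LINT x|lebesgue. ((A x *\<^sub>R D x - \<eta> *\<^sub>R G' x) + Z x) \<bullet> grad \<phi> x) = 0" .
  qed
  have e2: "(LINT x|lebesgue. ((A x *\<^sub>R G' x + \<eta> *\<^sub>R D x) + \<eta> *\<^sub>R V x) \<bullet> D x) = 0"
  proof (rule gradient_limit_extend[OF Dg W2])
    fix \<phi> assume \<phi>: "test_function \<phi>"
    have "((A x *\<^sub>R G' x + \<eta> *\<^sub>R D x) + \<eta> *\<^sub>R V x) = A x *\<^sub>R G' x + \<eta> *\<^sub>R G x" for x
      by (simp add: D_def algebra_simps)
    then show "(LINT x|lebesgue. ((A x *\<^sub>R G' x + \<eta> *\<^sub>R D x) + \<eta> *\<^sub>R V x) \<bullet> grad \<phi> x) = 0"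
      by (simp only: im[OF \<phi>])
  qed
  \<comment> \<open>The second equation tested with D minus the first tested with G': the terms with
    A cancel whatever its sign, and only terms with \<eta> and the errors from V and Z
    remain.\<close>
  have "0 = (LINT x|lebesgue. ((A x *\<^sub>R G' x + \<eta> *\<^sub>R D x) + \<eta> *\<^sub>R V x) \<bullet> D x - ((A x *\<^sub>R D x - \<eta> *\<^sub>R G' x) + Z x) \<bullet> G' x)"
    using e1 e2 L2_inner_integrable[OF W1 L(2)] L2_inner_integrable[OF W2 DL] by simp
  also have "\<dots> = (LINT x|lebesgue. \<eta> * (norm (D x))\<^sup>2 + \<eta> * (norm (G' x))\<^sup>2 + \<eta> * (V x \<bullet> D x) - Z x \<bullet> G' x)"
    by (intro Bochner_Integration.integral_cong refl)
      (simp add: power2_norm_eq_inner inner_add_left inner_diff_left inner_commute[of "D _" "G' _"])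
  also have "\<dots> = \<eta> * nsq lebesgue D + \<eta> * nsq lebesgue G' + \<eta> * (LINT x|lebesgue. V x \<bullet> D x) - (LINT x|lebesgue. Z x \<bullet> G' x)"
    using L2_integrable_norm[OF DL] L2_integrable_norm[OF L(2)] L2_inner_integrable[OF L(3) DL] L2_inner_integrable[OF Z L(2)]
    by simp
  finally have id: "\<eta> * nsq lebesgue D + \<eta> * nsq lebesgue G' = (LINT x|lebesgue. Z x \<bullet> G' x) - \<eta> * (LINT x|lebesgue. V x \<bullet> D x)"
    by simp
  \<comment> \<open>Both mixed terms are split by completing a square, with equal weights for V and
    D and with weight \<eta> on G', so that half of the left side absorbs them.\<close>
  have "0 \<le> nsq lebesgue (\<lambda>x. V x - (-1) *\<^sub>R D x)" by simp
  then have "0 \<le> nsq lebesgue V + 2 * (LINT x|lebesgue. V x \<bullet> D x) + nsq lebesgue D"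
    unfolding nsq_diff_scaleR[OF L(3) DL] by simp
  then have VD: "\<eta> * (- 2 * (LINT x|lebesgue. V x \<bullet> D x)) \<le> \<eta> * (nsq lebesgue V + nsq lebesgue D)"
    using \<eta> by (intro mult_left_mono) auto
  have "0 \<le> nsq lebesgue (\<lambda>x. Z x - \<eta> *\<^sub>R G' x)" by simp
  then have "2 * \<eta> * (LINT x|lebesgue. Z x \<bullet> G' x) \<le> nsq lebesgue Z + \<eta>\<^sup>2 * nsq lebesgue G'"
    unfolding nsq_diff_scaleR[OF Z L(2)] by simp
  then have "2 * (LINT x|lebesgue. Z x \<bullet> G' x) \<le> nsq lebesgue Z / \<eta> + \<eta> * nsq lebesgue G'"
    using \<eta> by (simp add: field_simps power2_eq_square)
  with id VD have D: "\<eta> * nsq lebesgue D + \<eta> * nsq lebesgue G' \<le> \<eta> * nsq lebesgue V + nsq lebesgue Z / \<eta>"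
    by (simp add: algebra_simps)
  have "nsq lebesgue G = nsq lebesgue (\<lambda>x. D x + V x)" by (simp add: D_def)
  also have "\<dots> \<le> 2 * nsq lebesgue D + 2 * nsq lebesgue V" by (rule nsq_add_le[OF DL L(3)])
  finally have "\<eta> * nsq lebesgue G \<le> \<eta> * (2 * nsq lebesgue D + 2 * nsq lebesgue V)"
    using \<eta> by (intro mult_left_mono) auto
  moreover have "0 \<le> \<eta> * nsq lebesgue G'" using \<eta> by simp
  ultimately show ?thesis using D by (simp add: algebra_simps)
qed

section \<open>Reflection of harmonic polynomials\<close>

lemma lipschitz_on_ballsI:
  assumes "\<And>\<rho>. 0 \<le> \<rho> \<Longrightarrow> \<exists>L\<ge>0. \<forall>x y. norm x \<le> \<rho> \<longrightarrow> norm y \<le> \<rho> \<longrightarrow> \<bar>s x - s y\<bar> \<le> L * norm (x - y)"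
  shows "lipschitz_on_balls s"
  unfolding lipschitz_on_balls_def
proof
  fix \<rho> :: real
  obtain L where L: "L \<ge> 0" "\<forall>x y. norm x \<le> \<bar>\<rho>\<bar> \<longrightarrow> norm y \<le> \<bar>\<rho>\<bar> \<longrightarrow> \<bar>s x - s y\<bar> \<le> L * norm (x - y)"
    using assms[of "\<bar>\<rho>\<bar>"] by auto
  have "L-lipschitz_on (cball 0 \<rho>) s"
    by (rule lipschitz_onI) (use L in \<open>auto simp: dist_norm\<close>)
  then show "\<exists>L. L-lipschitz_on (cball 0 \<rho>) s" ..
qed

lemma holomorphic_real_derivatives:
  assumes "(F has_field_derivative d) (at (cplx x))"
  shows "((\<lambda>x. Re (F (cplx x))) has_derivative (\<lambda>v. gvec d \<bullet> v)) (at x)"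
    and "((\<lambda>x. Im (F (cplx x))) has_derivative (\<lambda>v. gvec (- \<i> * d) \<bullet> v)) (at x)"
proof -
  have F: "((\<lambda>x. F (cplx x)) has_derivative (\<lambda>v. d * cplx v)) (at x)"
    by (rule has_derivative_compose[OF bounded_linear_imp_has_derivative[OF bounded_linear_cplx] assms[unfolded has_field_derivative_def]])
  show "((\<lambda>x. Re (F (cplx x))) has_derivative (\<lambda>v. gvec d \<bullet> v)) (at x)"
    using has_derivative_Re[OF F] by (simp only: inner_gvec)
  have "Re (- \<i> * d * z) = Im (d * z)" for z by simp
  then show "((\<lambda>x. Im (F (cplx x))) has_derivative (\<lambda>v. gvec (- \<i> * d) \<bullet> v)) (at x)"
    using has_derivative_Im[OF F] by (simp only: inner_gvec)
qed

lemma L2_bounded_on_ball: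
  fixes Y :: "real^2 \<Rightarrow> real^2"
  assumes Y: "Y \<in> borel_measurable lebesgue" and M: "AE x in lebesgue. norm (Y x) \<le> M * indicator (ball 0 R) x"
  shows "Y \<in> L2 lebesgue" "nsq lebesgue Y \<le> M\<^sup>2 * measure lebesgue (ball (0::real^2) R)"
proof -
  have fin: "emeasure lebesgue (ball (0::real^2) R) < \<infinity>"
    using emeasure_bounded_finite[OF bounded_ball, of 0 R] by (simp add: emeasure_completion)
  have int: "integrable lebesgue (\<lambda>x::real^2. M\<^sup>2 * indicator (ball 0 R) x)"
    using fin by (intro integrable_mult_right integrable_real_indicator) auto
  have le: "AE x in lebesgue. (norm (Y x))\<^sup>2 \<le> M\<^sup>2 * indicator (ball 0 R) x"
    using M
  proof (rule eventually_mono)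
    fix x assume "norm (Y x) \<le> M * indicator (ball 0 R) x"
    then have "(norm (Y x))\<^sup>2 \<le> (M * indicator (ball 0 R) x)\<^sup>2" by (intro power_mono) auto
    then show "(norm (Y x))\<^sup>2 \<le> M\<^sup>2 * indicator (ball 0 R) x"
      by (auto simp: indicator_def split: if_splits)
  qed
  show L: "Y \<in> L2 lebesgue" by (rule L2_bound[OF Y int le])
  have "nsq lebesgue Y \<le> (LINT x|lebesgue. M\<^sup>2 * indicator (ball (0::real^2) R) x)"
    by (rule integral_mono_AE[OF L2_integrable_norm[OF L] int le])
  then show "nsq lebesgue Y \<le> M\<^sup>2 * measure lebesgue (ball (0::real^2) R)" by simp
qed

section \<open>The reflected potential and its two corrections\<close>

locale reflection =
  fixes R :: real and b :: "nat \<Rightarrow> complex" and K :: nat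
  assumes R: "1 < R"
begin

definition dpoly :: "complex \<Rightarrow> complex" where
  "dpoly z = (\<Sum>k<K. b k * z ^ k)"

text \<open>The antiderivative of \<open>dpoly\<close> vanishing at 0. The reflection acts on this
  potential and not on the field, so the results are gradients by construction.\<close>

definition prim :: "complex \<Rightarrow> complex" where
  "prim z = (\<Sum>k<K. b k / of_nat (Suc k) * z ^ Suc k)"

lemma prim_derivative: "(prim has_field_derivative dpoly z) (at z within S)"
proof -
  have "((\<lambda>z. b k / of_nat (Suc k) * z ^ Suc k) has_field_derivative b k * z ^ k) (at z within S)" for k
    by (rule DERIV_cong[OF DERIV_cmult[OF DERIV_power[OF DERIV_ident]]]) (simp del: of_nat_Suc)
  then show ?thesis unfolding prim_def[abs_def] dpoly_def by (intro DERIV_sum)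
qed

lemma continuous_on_dpoly: "continuous_on S dpoly"
  unfolding dpoly_def[abs_def] by (intro continuous_intros)

lemma borel_dpoly [measurable]: "dpoly \<in> borel_measurable borel"
  by (intro borel_measurable_continuous_onI continuous_on_dpoly)

lemma prim_lipschitz:
  "\<exists>L\<ge>0. \<forall>z w. cmod z \<le> \<rho> \<longrightarrow> cmod w \<le> \<rho> \<longrightarrow> cmod (prim z - prim w) \<le> L * cmod (z - w)"
proof -
  have "bounded (dpoly ` cball 0 \<rho>)"
    by (intro compact_imp_bounded compact_continuous_image continuous_on_dpoly compact_cball)
  then obtain B where B: "0 < B" "\<And>z. cmod z \<le> \<rho> \<Longrightarrow> cmod (dpoly z) \<le> B"
    unfolding bounded_pos by auto
  show ?thesis
  proof (intro exI[of _ B] conjI allI impI)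
    fix z w assume "cmod z \<le> \<rho>" "cmod w \<le> \<rho>"
    then show "cmod (prim z - prim w) \<le> B * cmod (z - w)"
      by (intro field_differentiable_bound[OF convex_cball[of 0 \<rho>] prim_derivative]) (auto intro: B)
  qed (use B in simp)
qed

text \<open>
  The map \<open>reflect\<close> is the dilation by \<open>R\<^sup>2\<close> in the core, the inversion in the circle of radius \<open>R\<close> in
  the shell and the identity outside.
\<close>

definition dilation :: "real \<Rightarrow> real" where
  "dilation s = max 1 (R\<^sup>2 / (max 1 s)\<^sup>2)"

definition reflect :: "complex \<Rightarrow> complex" where
  "reflect z = dilation (cmod z) *\<^sub>R z"

lemma dilation_bounds: "1 \<le> dilation s" "dilation s \<le> R\<^sup>2"
proof -
  have "1 \<le> R\<^sup>2" using R by simp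
  moreover have "1 \<le> (max 1 s)\<^sup>2" by simp
  then have "R\<^sup>2 / (max 1 s)\<^sup>2 \<le> R\<^sup>2 / 1" by (intro divide_left_mono) auto
  ultimately show "1 \<le> dilation s" "dilation s \<le> R\<^sup>2" by (simp_all add: dilation_def)
qed

text \<open>The three regimes are glued by \<open>max\<close>, which is nonexpansive, and s^-2 has
  slope at most 2 for s >= 1; crossing either circle thus needs no case distinction.\<close>

lemma dilation_lipschitz: "\<bar>dilation s - dilation t\<bar> \<le> 2 * R\<^sup>2 * \<bar>s - t\<bar>"
proof -
  define p q where "p = max 1 s" and "q = max 1 t"
  have pq: "1 \<le> p" "1 \<le> q" by (simp_all add: p_def q_def)
  have "\<bar>1 / p\<^sup>2 - 1 / q\<^sup>2\<bar> \<le> 2 * \<bar>p - q\<bar>"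
  proof -
    have "1 / p\<^sup>2 - 1 / q\<^sup>2 = (q - p) * (1 / (p\<^sup>2 * q) + 1 / (p * q\<^sup>2))"
      using pq by (simp add: field_simps power2_eq_square)
    moreover have "1 / (p\<^sup>2 * q) + 1 / (p * q\<^sup>2) \<le> 2"
    proof -
      have "1 \<le> p\<^sup>2 * q" "1 \<le> p * q\<^sup>2"
        using pq mult_ge1_I[of "p\<^sup>2" q] mult_ge1_I[of p "q\<^sup>2"] by simp_all
      then have "1 / (p\<^sup>2 * q) \<le> 1" "1 / (p * q\<^sup>2) \<le> 1" by simp_all
      then show ?thesis by linarith
    qed
    moreover have "0 \<le> 1 / (p\<^sup>2 * q) + 1 / (p * q\<^sup>2)" using pq by simp
    ultimately have "\<bar>1 / p\<^sup>2 - 1 / q\<^sup>2\<bar> \<le> \<bar>q - p\<bar> * 2"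
      by (simp only: abs_mult) (intro mult_left_mono, auto)
    then show ?thesis by (simp add: abs_minus_commute)
  qed
  also have "\<dots> \<le> 2 * \<bar>s - t\<bar>" by (simp add: p_def q_def max_def)
  finally have "\<bar>1 / p\<^sup>2 - 1 / q\<^sup>2\<bar> \<le> 2 * \<bar>s - t\<bar>" .
  then have "R\<^sup>2 * \<bar>1 / p\<^sup>2 - 1 / q\<^sup>2\<bar> \<le> R\<^sup>2 * (2 * \<bar>s - t\<bar>)" by (intro mult_left_mono) auto
  moreover have "R\<^sup>2 / p\<^sup>2 - R\<^sup>2 / q\<^sup>2 = R\<^sup>2 * (1 / p\<^sup>2 - 1 / q\<^sup>2)"
    by (simp add: right_diff_distrib)
  ultimately have "\<bar>R\<^sup>2 / p\<^sup>2 - R\<^sup>2 / q\<^sup>2\<bar> \<le> 2 * R\<^sup>2 * \<bar>s - t\<bar>"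
    by (simp add: abs_mult)
  moreover have "\<bar>max 1 a - max 1 c\<bar> \<le> \<bar>a - c\<bar>" for a c :: real by (simp add: max_def)
  ultimately show ?thesis unfolding dilation_def p_def q_def by (rule order_trans[rotated])
qed

lemma reflect_norm: "cmod (reflect z) \<le> R\<^sup>2 * cmod z"
  using dilation_bounds[of "cmod z"] by (simp add: reflect_def mult_right_mono)

lemma reflect_lipschitz:
  assumes "cmod w \<le> \<rho>"
  shows "cmod (reflect z - reflect w) \<le> (R\<^sup>2 + 2 * R\<^sup>2 * \<rho>) * cmod (z - w)"
proof -
  have "reflect z - reflect w = dilation (cmod z) *\<^sub>R (z - w) + (dilation (cmod z) - dilation (cmod w)) *\<^sub>R w"
    by (simp add: reflect_def algebra_simps)
  then have "cmod (reflect z - reflect w) \<le> \<bar>dilation (cmod z)\<bar> * cmod (z - w) + \<bar>dilation (cmod z) - dilation (cmod w)\<bar> * cmod w"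
    using norm_triangle_ineq[of "dilation (cmod z) *\<^sub>R (z - w)" "(dilation (cmod z) - dilation (cmod w)) *\<^sub>R w"] by simp
  also have "\<dots> \<le> R\<^sup>2 * cmod (z - w) + (2 * R\<^sup>2 * cmod (z - w)) * \<rho>"
  proof (intro add_mono mult_mono)
    show "\<bar>dilation (cmod z)\<bar> \<le> R\<^sup>2" using dilation_bounds[of "cmod z"] by simp
    have "\<bar>dilation (cmod z) - dilation (cmod w)\<bar> \<le> 2 * R\<^sup>2 * \<bar>cmod z - cmod w\<bar>" by (rule dilation_lipschitz)
    also have "\<dots> \<le> 2 * R\<^sup>2 * cmod (z - w)"
      by (intro mult_left_mono norm_triangle_ineq3) auto
    finally show "\<bar>dilation (cmod z) - dilation (cmod w)\<bar> \<le> 2 * R\<^sup>2 * cmod (z - w)" .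
  qed (use assms in auto)
  also have "\<dots> = (R\<^sup>2 + 2 * R\<^sup>2 * \<rho>) * cmod (z - w)" by (simp add: algebra_simps)
  finally show ?thesis .
qed

lemma reflect_core: "cmod z < 1 \<Longrightarrow> reflect z = of_real (R\<^sup>2) * z"
  using R by (simp add: reflect_def dilation_def max_def scaleR_conv_of_real)

lemma reflect_shell:
  assumes "1 < cmod z" "cmod z < R" shows "reflect z = of_real (R\<^sup>2) / cnj z"
proof -
  have "1 \<le> R\<^sup>2 / (cmod z)\<^sup>2"
    using assms power_mono[of "cmod z" R 2] by (subst le_divide_eq) auto
  then have "reflect z = of_real (R\<^sup>2) * (z / of_real ((cmod z)\<^sup>2))"
    using assms by (simp add: reflect_def dilation_def max_def scaleR_conv_of_real)
  also have "z / of_real ((cmod z)\<^sup>2) = 1 / cnj z"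
    using assms by (subst complex_norm_square) (auto simp: field_simps)
  finally show ?thesis by simp
qed

lemma reflect_outside:
  assumes "R < cmod z" shows "reflect z = z"
proof -
  have "R\<^sup>2 / (max 1 (cmod z))\<^sup>2 \<le> 1"
    using assms R power_mono[of R "cmod z" 2] by (subst divide_le_eq_1_pos) auto
  then show ?thesis by (simp add: reflect_def dilation_def)
qed

text \<open>In the shell \<open>prim (reflect z)\<close> is antiholomorphic; its conjugate is
  holomorphic with derivative \<open>- mirror z\<close>, as in the Schwarz reflection
  principle.\<close>

definition mirror :: "complex \<Rightarrow> complex" where
  "mirror z = of_real (R\<^sup>2) / z\<^sup>2 * cnj (dpoly (of_real (R\<^sup>2) / cnj z))"

text \<open>The sign -1 belongs to the gradient of Re \<Phi>, the sign 1 to that of Im \<Phi> after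
  a quarter turn. They differ only in the shell, where A reverses the reflected part. Subtracting
  \<open>dpoly\<close> removes the truncated part of the original field.\<close>

definition corrector :: "real \<Rightarrow> real^2 \<Rightarrow> complex" where
  "corrector \<sigma> x = (if norm x < 1 then of_real (R\<^sup>2) * dpoly (of_real (R\<^sup>2) * cplx x) - dpoly (cplx x)
     else if norm x < R then of_real \<sigma> * mirror (cplx x) - dpoly (cplx x) else 0)"

lemma corrector_measurable: "(\<lambda>x. gvec (c * corrector \<sigma> x)) \<in> borel_measurable lebesgue"
proof (rule measurable_lebesgueI)
  show "(\<lambda>x. gvec (c * corrector \<sigma> x)) \<in> borel_measurable borel"
    unfolding corrector_def mirror_def by measurable
qed

text \<open>Outside the ball of radius R the map \<open>reflect\<close> is the identity, so this
  potential vanishes there without a cutoff.\<close>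

definition \<Phi> :: "real^2 \<Rightarrow> complex" where
  "\<Phi> x = prim (reflect (cplx x)) - prim (cplx x)"

lemma \<Phi>_lipschitz:
  assumes "0 \<le> \<rho>"
  shows "\<exists>L\<ge>0. \<forall>x y. norm x \<le> \<rho> \<longrightarrow> norm y \<le> \<rho> \<longrightarrow> cmod (\<Phi> x - \<Phi> y) \<le> L * norm (x - y)"
proof -
  obtain L1 where L1: "0 \<le> L1" "\<And>z w. cmod z \<le> R\<^sup>2 * \<rho> \<Longrightarrow> cmod w \<le> R\<^sup>2 * \<rho> \<Longrightarrow> cmod (prim z - prim w) \<le> L1 * cmod (z - w)"
    using prim_lipschitz[of "R\<^sup>2 * \<rho>"] by auto
  obtain L2 where L2: "0 \<le> L2" "\<And>z w. cmod z \<le> \<rho> \<Longrightarrow> cmod w \<le> \<rho> \<Longrightarrow> cmod (prim z - prim w) \<le> L2 * cmod (z - w)"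
    using prim_lipschitz[of \<rho>] by auto
  define L where "L = L1 * (R\<^sup>2 + 2 * R\<^sup>2 * \<rho>) + L2"
  have "cmod (\<Phi> x - \<Phi> y) \<le> L * norm (x - y)" if x: "norm x \<le> \<rho>" and y: "norm y \<le> \<rho>" for x y
  proof -
    let ?z = "cplx x" and ?w = "cplx y"
    have b: "cmod (reflect ?z) \<le> R\<^sup>2 * \<rho>" "cmod (reflect ?w) \<le> R\<^sup>2 * \<rho>"
      using x y by (auto intro!: order_trans[OF reflect_norm] mult_left_mono)
    have "cmod (\<Phi> x - \<Phi> y) \<le> cmod (prim (reflect ?z) - prim (reflect ?w)) + cmod (prim ?z - prim ?w)"
      using norm_triangle_ineq4[of "prim (reflect ?z) - prim (reflect ?w)" "prim ?z - prim ?w"] by (simp add: \<Phi>_def algebra_simps)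
    also have "\<dots> \<le> L1 * cmod (reflect ?z - reflect ?w) + L2 * cmod (?z - ?w)"
      using x y b by (intro add_mono L1 L2) auto
    also have "\<dots> \<le> L1 * ((R\<^sup>2 + 2 * R\<^sup>2 * \<rho>) * cmod (?z - ?w)) + L2 * cmod (?z - ?w)"
      using y L1 by (intro add_right_mono mult_left_mono reflect_lipschitz) auto
    also have "\<dots> = L * norm (x - y)"
      by (simp add: L_def cplx_diff[symmetric] algebra_simps)
    finally show ?thesis .
  qed
  moreover have "0 \<le> L" using L1 L2 assms by (simp add: L_def)
  ultimately show ?thesis by blast
qed

lemma \<Phi>_lipschitz_on_balls:
  "lipschitz_on_balls (\<lambda>x. Re (\<Phi> x))" "lipschitz_on_balls (\<lambda>x. Im (\<Phi> x))"
proof -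
  have le: "\<bar>Re (\<Phi> x) - Re (\<Phi> y)\<bar> \<le> cmod (\<Phi> x - \<Phi> y)" "\<bar>Im (\<Phi> x) - Im (\<Phi> y)\<bar> \<le> cmod (\<Phi> x - \<Phi> y)" for x y
    using abs_Re_le_cmod[of "\<Phi> x - \<Phi> y"] abs_Im_le_cmod[of "\<Phi> x - \<Phi> y"] by simp_all
  have ex: "\<exists>L\<ge>0. \<forall>x y. norm x \<le> \<rho> \<longrightarrow> norm y \<le> \<rho> \<longrightarrow> \<bar>s x - s y\<bar> \<le> L * norm (x - y)"
    if \<rho>: "0 \<le> \<rho>" and s: "\<And>x y. \<bar>s x - s y\<bar> \<le> cmod (\<Phi> x - \<Phi> y)" for \<rho> and s :: "real^2 \<Rightarrow> real"
  proof -
    obtain L where "0 \<le> L" "\<And>x y. norm x \<le> \<rho> \<Longrightarrow> norm y \<le> \<rho> \<Longrightarrow> cmod (\<Phi> x - \<Phi> y) \<le> L * norm (x - y)"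
      using \<Phi>_lipschitz[OF \<rho>] by auto
    then show ?thesis by (intro exI[of _ L] conjI allI impI order_trans[OF s])
  qed
  show "lipschitz_on_balls (\<lambda>x. Re (\<Phi> x))" "lipschitz_on_balls (\<lambda>x. Im (\<Phi> x))"
    by (intro lipschitz_on_ballsI ex le; assumption)+
qed

lemma mirror_derivative:
  assumes "z \<noteq> 0"
  shows "((\<lambda>z. cnj (prim (of_real (R\<^sup>2) / cnj z))) has_field_derivative - mirror z) (at z)"
proof -
  have "((cnj \<circ> prim \<circ> cnj) has_field_derivative cnj (dpoly (cnj (of_real (R\<^sup>2) / z)))) (at (of_real (R\<^sup>2) / z))"
    by (rule has_field_derivative_cnj_cnj[OF prim_derivative])
  moreover have "((\<lambda>z. of_real (R\<^sup>2) / z) has_field_derivative - of_real (R\<^sup>2) / z\<^sup>2) (at z)"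
    using assms by (auto intro!: derivative_eq_intros simp: power2_eq_square)
  ultimately have "((\<lambda>z. (cnj \<circ> prim \<circ> cnj) (of_real (R\<^sup>2) / z)) has_field_derivative
      cnj (dpoly (cnj (of_real (R\<^sup>2) / z))) * (- of_real (R\<^sup>2) / z\<^sup>2)) (at z)"
    by (rule DERIV_chain2)
  then show ?thesis by (simp add: mirror_def mult.commute)
qed

text \<open>In the shell the first term of \<Phi> is antiholomorphic. Its real part is that of its
  conjugate and its imaginary part that of minus its conjugate; both are holomorphic, which is where
  the two signs of \<open>corrector\<close> come from.\<close>

lemma \<Phi>_derivative:
  assumes x: "norm x \<noteq> 1" "norm x \<noteq> R"
  shows "((\<lambda>x. Re (\<Phi> x)) has_derivative (\<lambda>v. gvec (corrector (-1) x) \<bullet> v)) (at x)"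
    and "((\<lambda>x. Im (\<Phi> x)) has_derivative (\<lambda>v. gvec (- \<i> * corrector 1 x) \<bullet> v)) (at x)"
proof -
  have "((\<lambda>x. Re (\<Phi> x)) has_derivative (\<lambda>v. gvec (corrector (-1) x) \<bullet> v)) (at x) \<and>
    ((\<lambda>x. Im (\<Phi> x)) has_derivative (\<lambda>v. gvec (- \<i> * corrector 1 x) \<bullet> v)) (at x)"
  proof -
    consider "norm x < 1" | "1 < norm x" "norm x < R" | "R < norm x" using x by linarith
    then show ?thesis
    proof cases
      case 1
      let ?F = "\<lambda>z. prim (of_real (R\<^sup>2) * z) - prim z"
      have "(?F has_field_derivative of_real (R\<^sup>2) * dpoly (of_real (R\<^sup>2) * cplx x) - dpoly (cplx x)) (at (cplx x))"
        by (rule DERIV_cong[OF DERIV_diff[OF DERIV_chain2[OF prim_derivative DERIV_cmult_Id] prim_derivative]]) simp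
      note D = holomorphic_real_derivatives[OF this]
      have eq: "Re (?F (cplx y)) = Re (\<Phi> y)" "Im (?F (cplx y)) = Im (\<Phi> y)" if "y \<in> ball 0 1" for y
        using that by (simp_all add: \<Phi>_def reflect_core)
      show ?thesis
        using has_derivative_transform_within_open[OF D(1) open_ball, of 0 1 "\<lambda>x. Re (\<Phi> x)"]
          has_derivative_transform_within_open[OF D(2) open_ball, of 0 1 "\<lambda>x. Im (\<Phi> x)"] eq 1
        by (simp add: corrector_def)
    next
      case 2
      let ?S = "{y :: real^2. 1 < norm y \<and> norm y < R}"
      have S: "open ?S" by (intro open_Collect_conj open_Collect_less continuous_intros)
      have ne: "cplx x \<noteq> 0" using 2 by (metis cmod_cplx norm_zero not_one_less_zero)
      let ?k = "\<lambda>z. cnj (prim (of_real (R\<^sup>2) / cnj z))"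
      have D1: "((\<lambda>z. ?k z - prim z) has_field_derivative - mirror (cplx x) - dpoly (cplx x)) (at (cplx x))"
        and D2: "((\<lambda>z. - ?k z - prim z) has_field_derivative - (- mirror (cplx x)) - dpoly (cplx x)) (at (cplx x))"
        by (intro DERIV_diff DERIV_minus mirror_derivative prim_derivative ne)+
      have eq: "Re (?k (cplx y) - prim (cplx y)) = Re (\<Phi> y)" "Im (- ?k (cplx y) - prim (cplx y)) = Im (\<Phi> y)" if "y \<in> ?S" for y
        using that by (simp_all add: \<Phi>_def reflect_shell)
      show ?thesis
        using has_derivative_transform_within_open[OF holomorphic_real_derivatives(1)[OF D1] S, of "\<lambda>x. Re (\<Phi> x)"]
          has_derivative_transform_within_open[OF holomorphic_real_derivatives(2)[OF D2] S, of "\<lambda>x. Im (\<Phi> x)"] eq 2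
        by (simp add: corrector_def)
    next
      case 3
      let ?S = "{y :: real^2. R < norm y}"
      have S: "open ?S" by (intro open_Collect_less continuous_intros)
      have D: "((\<lambda>x. 0) has_derivative (\<lambda>v. gvec 0 \<bullet> v)) (at x)" by (simp add: inner_gvec)
      have eq: "\<Phi> y = 0" if "y \<in> ?S" for y using that by (simp add: \<Phi>_def reflect_outside)
      show ?thesis
        using has_derivative_transform_within_open[OF D S, of "\<lambda>x. Re (\<Phi> x)"]
          has_derivative_transform_within_open[OF D S, of "\<lambda>x. Im (\<Phi> x)"] eq 3 R
        by (simp add: corrector_def)
    qed
  qed
  then show "((\<lambda>x. Re (\<Phi> x)) has_derivative (\<lambda>v. gvec (corrector (-1) x) \<bullet> v)) (at x)"
    and "((\<lambda>x. Im (\<Phi> x)) has_derivative (\<lambda>v. gvec (- \<i> * corrector 1 x) \<bullet> v)) (at x)" by auto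
qed

lemma AE_off_interfaces: "AE x in lebesgue. norm (x::real^2) \<noteq> 1 \<and> norm x \<noteq> R"
proof -
  have "AE x in lebesgue. x \<notin> sphere (0::real^2) 1" "AE x in lebesgue. x \<notin> sphere (0::real^2) R"
    by (intro AE_not_in, simp add: negligible_sphere flip: negligible_iff_null_sets)+
  then show ?thesis by eventually_elim (simp add: dist_norm)
qed

lemma corrector_curl_free: "curl_free (\<lambda>x. gvec (corrector (-1) x))"
proof (rule curl_free_lipschitz)
  show "lipschitz_on_balls (\<lambda>x. Re (\<Phi> x))" by (rule \<Phi>_lipschitz_on_balls)
  show "AE x in lebesgue. ((\<lambda>x. Re (\<Phi> x)) has_derivative (\<lambda>v. gvec (corrector (-1) x) \<bullet> v)) (at x)"
    using AE_off_interfaces by (rule eventually_mono) (intro \<Phi>_derivative, auto)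
  show "(\<lambda>x. gvec (corrector (-1) x)) \<in> borel_measurable lebesgue"
    using corrector_measurable[of 1] by simp
qed

text \<open>As \<open>gvec (- \<i> * d)\<close> equals \<open>perp (gvec d)\<close>, this is the
  curl condition for the gradient of Im \<Phi>, read after a quarter turn.\<close>

lemma corrector_divergence_free:
  assumes \<phi>: "test_function \<phi>"
  shows "(LINT x|lebesgue. gvec (corrector 1 x) \<bullet> grad \<phi> x) = 0"
proof -
  have "curl_free (\<lambda>x. gvec (- \<i> * corrector 1 x))"
  proof (rule curl_free_lipschitz)
    show "lipschitz_on_balls (\<lambda>x. Im (\<Phi> x))" by (rule \<Phi>_lipschitz_on_balls)
    show "AE x in lebesgue. ((\<lambda>x. Im (\<Phi> x)) has_derivative (\<lambda>v. gvec (- \<i> * corrector 1 x) \<bullet> v)) (at x)"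
      using AE_off_interfaces by (rule eventually_mono) (intro \<Phi>_derivative, auto)
  qed (rule corrector_measurable)
  then have "(LINT x|lebesgue. - (gvec (corrector 1 x) \<bullet> grad \<phi> x)) = 0"
    using \<phi> by (simp add: curl_free_def inner_vec_def sum_2)
  then show ?thesis by simp
qed

text \<open>For r < R^2 the geometric sum has ratio above 1 and is controlled by its K-th power. R^2
  is the largest modulus that the reflection produces from core and shell.\<close>

lemma dpoly_bound:
  assumes b: "\<And>k. cmod (b k) \<le> C / r ^ k" and C: "0 \<le> C" and r: "0 < r" "r < R\<^sup>2" and z: "cmod z \<le> R\<^sup>2"
  shows "cmod (dpoly z) \<le> C * (R\<^sup>2 / r) ^ K / (R\<^sup>2 / r - 1)"
proof -
  have "cmod (dpoly z) \<le> (\<Sum>k<K. C * (R\<^sup>2 / r) ^ k)"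
    unfolding dpoly_def
  proof (rule order_trans[OF norm_sum sum_mono])
    fix k
    have "cmod (b k * z ^ k) \<le> (C / r ^ k) * (R\<^sup>2) ^ k"
      unfolding norm_mult norm_power using b z C r by (intro mult_mono power_mono) auto
    then show "cmod (b k * z ^ k) \<le> C * (R\<^sup>2 / r) ^ k" by (simp add: power_divide)
  qed
  also have "\<dots> = C * (((R\<^sup>2 / r) ^ K - 1) / (R\<^sup>2 / r - 1))"
    using r by (subst sum_distrib_left[symmetric], subst geometric_sum) auto
  also have "\<dots> \<le> C * ((R\<^sup>2 / r) ^ K / (R\<^sup>2 / r - 1))"
    using C r by (intro mult_left_mono divide_right_mono) auto
  finally show ?thesis by simp
qed

text \<open>In core and shell all arguments of \<open>dpoly\<close> have modulus at most R^2, and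
  the factor in front of the reflected term is at most R^2; the other summand accounts for the
  1.\<close>

lemma corrector_bound:
  assumes b: "\<And>k. cmod (b k) \<le> C / r ^ k" and C: "0 \<le> C" and r: "0 < r" "r < R\<^sup>2" and \<sigma>: "\<bar>\<sigma>\<bar> = 1"
  shows "cmod (corrector \<sigma> x) \<le> (R\<^sup>2 + 1) * (C * (R\<^sup>2 / r) ^ K / (R\<^sup>2 / r - 1)) * indicator (ball 0 R) x"
proof -
  define M where "M = C * (R\<^sup>2 / r) ^ K / (R\<^sup>2 / r - 1)"
  have M: "0 \<le> M" unfolding M_def using C r by simp
  have d: "cmod (dpoly z) \<le> M" if "cmod z \<le> R\<^sup>2" for z
    unfolding M_def by (rule dpoly_bound[OF b C r that])
  have RR: "1 \<le> R\<^sup>2" "R \<le> R\<^sup>2" using R by (simp_all add: self_le_power)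
  consider "norm x < 1" | "1 \<le> norm x" "norm x < R" | "R \<le> norm x" by linarith
  then have "cmod (corrector \<sigma> x) \<le> (R\<^sup>2 + 1) * M * indicator (ball 0 R) x"
  proof cases
    case 1
    have "cmod (of_real (R\<^sup>2) * cplx x) \<le> R\<^sup>2" using 1 RR by (simp add: norm_mult norm_power mult_left_le)
    then have "cmod (of_real (R\<^sup>2) * dpoly (of_real (R\<^sup>2) * cplx x)) \<le> R\<^sup>2 * M"
      unfolding norm_mult by (intro mult_mono d) (auto simp: norm_power norm_mult)
    moreover have "cmod (dpoly (cplx x)) \<le> M" using 1 RR by (intro d) simp
    ultimately have "cmod (corrector \<sigma> x) \<le> R\<^sup>2 * M + M"
      using 1 norm_triangle_ineq4[of "of_real (R\<^sup>2) * dpoly (of_real (R\<^sup>2) * cplx x)" "dpoly (cplx x)"]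
      by (simp add: corrector_def)
    then show ?thesis using 1 R by (simp add: distrib_right)
  next
    case 2
    have le: "R\<^sup>2 / t \<le> R\<^sup>2" if "1 \<le> t" for t
      using that divide_left_mono[of 1 t "R\<^sup>2"] by simp
    have "cmod (of_real (R\<^sup>2) / cnj (cplx x)) \<le> R\<^sup>2"
      using le[of "norm x"] 2 by (simp add: norm_divide norm_power)
    then have "cmod (cnj (dpoly (of_real (R\<^sup>2) / cnj (cplx x)))) \<le> M" by (simp only: complex_mod_cnj d)
    moreover have "cmod (of_real (R\<^sup>2) / (cplx x)\<^sup>2) \<le> R\<^sup>2"
      using le[of "(norm x)\<^sup>2"] 2 by (simp add: norm_divide norm_power)
    ultimately have "cmod (mirror (cplx x)) \<le> R\<^sup>2 * M"
      unfolding mirror_def norm_mult by (intro mult_mono) (auto simp: M)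
    then have "cmod (of_real \<sigma> * mirror (cplx x)) \<le> R\<^sup>2 * M" using \<sigma> by (simp add: norm_mult)
    moreover have "cmod (dpoly (cplx x)) \<le> M" using 2 RR by (intro d) simp
    ultimately have "cmod (corrector \<sigma> x) \<le> R\<^sup>2 * M + M"
      using 2 norm_triangle_ineq4[of "of_real \<sigma> * mirror (cplx x)" "dpoly (cplx x)"] by (simp add: corrector_def)
    then show ?thesis using 2 by (simp add: distrib_right)
  next
    case 3
    then show ?thesis using R by (simp add: corrector_def)
  qed
  then show ?thesis unfolding M_def .
qed

end

section \<open>Non-resonance\<close>

lemma L2_mult_nth_integrable:
  fixes f :: "'a \<Rightarrow> real^'c" and g :: "'a \<Rightarrow> real^'d"
  assumes "f \<in> L2 M" "g \<in> L2 M"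
  shows "integrable M (\<lambda>x. f x $ i * g x $ j)"
proof (rule Bochner_Integration.integrable_bound)
  show "integrable M (\<lambda>x. (norm (f x))\<^sup>2 + (norm (g x))\<^sup>2)"
    using assms by (simp add: L2_def)
  have m: "(\<lambda>x. f x $ i) \<in> borel_measurable M" "(\<lambda>x. g x $ j) \<in> borel_measurable M"
    by (rule measurable_compose[OF L2_measurable[OF assms(1)]], simp add: borel_measurable_continuous_onI continuous_intros)
      (rule measurable_compose[OF L2_measurable[OF assms(2)]], simp add: borel_measurable_continuous_onI continuous_intros)
  show "(\<lambda>x. f x $ i * g x $ j) \<in> borel_measurable M" by (intro borel_measurable_times m)
  have "norm (u $ i * v $ j) \<le> norm ((norm u)\<^sup>2 + (norm v)\<^sup>2)" for u :: "real^'c" and v :: "real^'d"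
  proof -
    have "\<bar>u $ i * v $ j\<bar> \<le> norm u * norm v"
      unfolding abs_mult by (intro mult_mono component_le_norm_cart) auto
    also have "\<dots> \<le> 2 * (norm u * norm v)" by simp
    also have "\<dots> \<le> (norm u)\<^sup>2 + (norm v)\<^sup>2"
      using sum_squares_bound[of "norm u" "norm v"] by (simp add: mult.assoc)
    finally show ?thesis by simp
  qed
  then show "AE x in M. norm (f x $ i * g x $ j) \<le> norm ((norm (f x))\<^sup>2 + (norm (g x))\<^sup>2)" by simp
qed

section \<open>Real and imaginary fields of a weak solution\<close>

definition re_field :: "(real^2 \<Rightarrow> complex^2) \<Rightarrow> real^2 \<Rightarrow> real^2" where
  "re_field w x = (\<chi> i. Re (w x $ i))"

definition im_field :: "(real^2 \<Rightarrow> complex^2) \<Rightarrow> real^2 \<Rightarrow> real^2" where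
  "im_field w x = (\<chi> i. Im (w x $ i))"

lemma L2_re_im_field:
  assumes w: "w \<in> L2 lebesgue"
  shows "re_field w \<in> L2 lebesgue" "im_field w \<in> L2 lebesgue"
    and "nsq lebesgue w = nsq lebesgue (re_field w) + nsq lebesgue (im_field w)"
proof -
  have eq: "(norm (w x))\<^sup>2 = (norm (re_field w x))\<^sup>2 + (norm (im_field w x))\<^sup>2" for x
    by (simp add: norm_vec_def L2_set_def sum_2 re_field_def im_field_def cmod_power2)
  have "(\<lambda>z::complex^2. \<chi> i. Re (z $ i)) \<in> borel_measurable borel" "(\<lambda>z::complex^2. \<chi> i. Im (z $ i)) \<in> borel_measurable borel"
    by (intro borel_measurable_continuous_onI continuous_intros)+
  from this[THEN measurable_compose[OF L2_measurable[OF w]]]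
  have m: "re_field w \<in> borel_measurable lebesgue" "im_field w \<in> borel_measurable lebesgue"
    by (simp_all add: re_field_def[abs_def] im_field_def[abs_def])
  show L: "re_field w \<in> L2 lebesgue" "im_field w \<in> L2 lebesgue"
    by (intro L2_bound[OF _ L2_integrable_norm[OF w]] m AE_I2, simp add: eq)+
  show "nsq lebesgue w = nsq lebesgue (re_field w) + nsq lebesgue (im_field w)"
    unfolding eq using L2_integrable_norm[OF L(1)] L2_integrable_norm[OF L(2)] by simp
qed

text \<open>Testing the weak gradient with partial derivatives of \<phi> turns both components into
  u against the same mixed second derivative.\<close>

lemma weak_gradient_curl_free:
  assumes u: "has_weak_gradient u w" and w: "w \<in> L2 lebesgue"
  shows "curl_free (re_field w)" "curl_free (im_field w)"
proof -
  have "(LINT x|lebesgue. re_field w x $ 1 * grad \<phi> x $ 2 - re_field w x $ 2 * grad \<phi> x $ 1) = 0 \<and>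
    (LINT x|lebesgue. im_field w x $ 1 * grad \<phi> x $ 2 - im_field w x $ 2 * grad \<phi> x $ 1) = 0" if \<phi>: "test_function \<phi>" for \<phi>
  proof -
    note L = L2_re_im_field[OF w]
    have W: "(LINT x|lebesgue. grad \<phi> x $ j *\<^sub>R (w x $ i))
      = of_real (LINT x|lebesgue. re_field w x $ i * grad \<phi> x $ j) + \<i> * of_real (LINT x|lebesgue. im_field w x $ i * grad \<phi> x $ j)" for i j
    proof -
      have "(LINT x|lebesgue. grad \<phi> x $ j *\<^sub>R (w x $ i))
        = (LINT x|lebesgue. of_real (re_field w x $ i * grad \<phi> x $ j) + \<i> * of_real (im_field w x $ i * grad \<phi> x $ j))"
        by (intro Bochner_Integration.integral_cong refl) (simp add: complex_eq_iff re_field_def im_field_def)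
      also have "\<dots> = (LINT x|lebesgue. of_real (re_field w x $ i * grad \<phi> x $ j)) + (LINT x|lebesgue. \<i> * of_real (im_field w x $ i * grad \<phi> x $ j))"
        by (intro Bochner_Integration.integral_add integrable_mult_right integrable_of_real
            L2_mult_nth_integrable L2_grad L \<phi>)
      finally show ?thesis by (simp only: integral_mult_right_zero integral_complex_of_real)
    qed
    have "(LINT x|lebesgue. grad (\<lambda>x. grad \<phi> x $ 2) x $ 1 *\<^sub>R u x) = (LINT x|lebesgue. grad (\<lambda>x. grad \<phi> x $ 1) x $ 2 *\<^sub>R u x)"
      by (simp add: mixed_partials_commute[OF \<phi>, of 2 _ 1])
    then have "(LINT x|lebesgue. grad \<phi> x $ 2 *\<^sub>R (w x $ 1)) = (LINT x|lebesgue. grad \<phi> x $ 1 *\<^sub>R (w x $ 2))"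
      using u test_function_grad[OF \<phi>] by (simp add: has_weak_gradient_def)
    then show ?thesis
      unfolding W using L2_mult_nth_integrable[OF L(1) L2_grad[OF \<phi>]] L2_mult_nth_integrable[OF L(2) L2_grad[OF \<phi>]]
      by (simp add: complex_eq_iff)
  qed
  then show "curl_free (re_field w)" "curl_free (im_field w)" by (auto simp: curl_free_def)
qed

text \<open>Multiplying out (A + i \<eta>) (G + i G'); the source is real, so the imaginary part has
  right side 0.\<close>

lemma weak_solution_fields:
  fixes A :: "real^2 \<Rightarrow> real" and u :: "real^2 \<Rightarrow> complex"
  defines "G \<equiv> re_field (weak_grad u)" and "G' \<equiv> im_field (weak_grad u)"
  assumes sol: "weak_solution (\<lambda>x. of_real (A x) + \<i> * of_real \<eta>) f u"
    and A: "A \<in> borel_measurable lebesgue" "\<And>x. \<bar>A x\<bar> \<le> 1"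
  shows "gradient_limit G" "gradient_limit G'" "energy \<eta> u = \<eta> / 2 * (nsq lebesgue G + nsq lebesgue G')"
    and "test_function \<phi> \<Longrightarrow> (LINT x|lebesgue. (A x *\<^sub>R G x - \<eta> *\<^sub>R G' x) \<bullet> grad \<phi> x) = - f \<phi>"
    and "test_function \<phi> \<Longrightarrow> (LINT x|lebesgue. (A x *\<^sub>R G' x + \<eta> *\<^sub>R G x) \<bullet> grad \<phi> x) = 0"
proof -
  let ?w = "weak_grad u"
  have u: "u \<in> Hdot1" using sol by (simp add: weak_solution_def)
  then have w: "?w \<in> L2 lebesgue" by (simp add: Hdot1_def)
  \<comment> \<open>\<open>weak_grad\<close> is a choice, and membership in \<open>Hdot1\<close>
    supplies the existence that makes the choice a weak gradient.\<close>
  have "\<exists>g. has_weak_gradient u g" using u by (simp add: Hdot1_def)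
  then have wg: "has_weak_gradient u ?w" unfolding weak_grad_def by (rule someI_ex)
  note L = L2_re_im_field[OF w, folded G_def G'_def]
  show "gradient_limit G" "gradient_limit G'"
    by (rule curl_free_gradient_limit[OF L(1) weak_gradient_curl_free(1)[OF wg w, folded G_def]],
        rule curl_free_gradient_limit[OF L(2) weak_gradient_curl_free(2)[OF wg w, folded G'_def]])
  show "energy \<eta> u = \<eta> / 2 * (nsq lebesgue G + nsq lebesgue G')"
    by (simp add: energy_def L(3))
  have "(LINT x|lebesgue. (A x *\<^sub>R G x - \<eta> *\<^sub>R G' x) \<bullet> grad \<phi> x) = - f \<phi> \<and>
    (LINT x|lebesgue. (A x *\<^sub>R G' x + \<eta> *\<^sub>R G x) \<bullet> grad \<phi> x) = 0" if \<phi>: "test_function \<phi>"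
  proof -
    have i: "integrable lebesgue (\<lambda>x. (A x *\<^sub>R G x - \<eta> *\<^sub>R G' x) \<bullet> grad \<phi> x)"
      "integrable lebesgue (\<lambda>x. (A x *\<^sub>R G' x + \<eta> *\<^sub>R G x) \<bullet> grad \<phi> x)"
      by (intro L2_inner_integrable L2_add L2_diff L2_scaleR L2_bounded_mult[OF A] L L2_grad \<phi>)+
    have "- (LINT x|lebesgue. (of_real (A x) + \<i> * of_real \<eta>) * (\<Sum>i\<in>UNIV. ?w x $ i * of_real (grad \<phi> x $ i))) = of_real (f \<phi>)"
      using sol \<phi> unfolding weak_solution_def by blast
    from arg_cong[OF this, of uminus]
    have "- of_real (f \<phi>) = (LINT x|lebesgue. (of_real (A x) + \<i> * of_real \<eta>) * (\<Sum>i\<in>UNIV. ?w x $ i * of_real (grad \<phi> x $ i)))"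
      by (simp only: minus_minus)
    also have "\<dots> = (LINT x|lebesgue. of_real ((A x *\<^sub>R G x - \<eta> *\<^sub>R G' x) \<bullet> grad \<phi> x) + \<i> * of_real ((A x *\<^sub>R G' x + \<eta> *\<^sub>R G x) \<bullet> grad \<phi> x))"
      by (intro Bochner_Integration.integral_cong refl)
        (simp add: complex_eq_iff inner_vec_def sum_2 G_def G'_def re_field_def im_field_def algebra_simps)
    also have "\<dots> = of_real (LINT x|lebesgue. (A x *\<^sub>R G x - \<eta> *\<^sub>R G' x) \<bullet> grad \<phi> x) + \<i> * of_real (LINT x|lebesgue. (A x *\<^sub>R G' x + \<eta> *\<^sub>R G x) \<bullet> grad \<phi> x)"
      using i by (simp only: Bochner_Integration.integral_add[OF integrable_of_real[OF i(1)] integrable_mult_right[OF integrable_of_real[OF i(2)]]]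
          integral_mult_right_zero integral_complex_of_real)
    finally show ?thesis by (simp add: complex_eq_iff)
  qed
  then show "test_function \<phi> \<Longrightarrow> (LINT x|lebesgue. (A x *\<^sub>R G x - \<eta> *\<^sub>R G' x) \<bullet> grad \<phi> x) = - f \<phi>"
    and "test_function \<phi> \<Longrightarrow> (LINT x|lebesgue. (A x *\<^sub>R G' x + \<eta> *\<^sub>R G x) \<bullet> grad \<phi> x) = 0" by auto
qed

text \<open>Test functions that vanish outside the open disk of radius q do not see the source, so
  the projected field is divergence-free there.\<close>

lemma curve_source_eq_0:
  assumes "\<And>x. x \<in> \<Gamma> \<Longrightarrow> \<phi> x = 0" shows "curve_source \<Gamma> F \<phi> = 0"
proof -
  have "curve_source \<Gamma> F \<phi> = (LINT x|hausdorff1_on \<Gamma>. 0)"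
    unfolding curve_source_def
    by (intro Bochner_Integration.integral_cong refl) (simp add: assms space_restrict_space)
  then show ?thesis by simp
qed

section \<open>Choice of the truncation and conclusion\<close>

lemma geometric_scale:
  assumes "1 < (R::real)" "0 < \<eta>" "\<eta> < 1"
  obtains K where "\<eta> \<le> 1 / R ^ K" "1 / \<eta> \<le> R ^ Suc K"
proof -
  obtain n where n: "1 / \<eta> < R ^ n" using real_arch_pow[OF assms(1)] by blast
  \<comment> \<open>With \<open>Suc n\<close> in the exponent, minimality gives R^K < 1 / \<eta> for
    K > 0, while K = 0 is settled by \<eta> < 1.\<close>
  define K where "K = (LEAST n. 1 / \<eta> \<le> R ^ Suc n)"
  have "1 / \<eta> \<le> R ^ Suc n" using n assms by (simp add: less_imp_le order_trans[OF less_imp_le[OF n]])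
  then have K: "1 / \<eta> \<le> R ^ Suc K" unfolding K_def by (rule LeastI)
  moreover have "\<eta> \<le> 1 / R ^ K"
  proof (cases K)
    case (Suc k)
    then have "\<not> 1 / \<eta> \<le> R ^ Suc k" unfolding K_def by (metis lessI not_less_Least)
    then show ?thesis using assms Suc by (simp add: field_simps)
  qed (use assms in simp)
  ultimately show ?thesis using that by blast
qed

text \<open>
  Truncating at the frequency \<open>K\<close> with \<open>R\<^sup>-\<^sup>K \<approx> \<eta>\<close> balances the two parts of the energy; both are
  bounded exactly because \<open>R\<^sup>3 \<le> r\<^sup>2\<close>.
\<close>

lemma truncation_balance:
  fixes R r \<eta> :: real
  assumes R: "1 < R" and r: "0 < r" "R ^ 3 \<le> r\<^sup>2" and \<eta>: "0 < \<eta>" "\<eta> \<le> 1 / R ^ K" "1 / \<eta> \<le> R ^ Suc K"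
  shows "\<eta> * ((R\<^sup>2 / r) ^ K)\<^sup>2 \<le> 1" "((R / r) ^ K)\<^sup>2 / \<eta> \<le> R"
proof -
  have le: "(R ^ 3 / r\<^sup>2) ^ K \<le> 1"
    using R r by (intro power_le_one) (auto simp: divide_le_eq)
  have "\<eta> * ((R\<^sup>2 / r) ^ K)\<^sup>2 \<le> (1 / R ^ K) * ((R\<^sup>2 / r) ^ K)\<^sup>2" using \<eta> by (intro mult_right_mono) auto
  also have "\<dots> = (1 / R * (R\<^sup>2 / r)\<^sup>2) ^ K"
    by (simp add: power_mult_distrib power_divide flip: power_mult) (simp add: mult.commute)
  also have "1 / R * (R\<^sup>2 / r)\<^sup>2 = R ^ 3 / r\<^sup>2"
    using R by (simp add: power_divide power2_eq_square power3_eq_cube)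
  finally show "\<eta> * ((R\<^sup>2 / r) ^ K)\<^sup>2 \<le> 1" using le by linarith
  have "((R / r) ^ K)\<^sup>2 / \<eta> \<le> ((R / r) ^ K)\<^sup>2 * R ^ Suc K"
    using mult_left_mono[OF \<eta>(3), of "((R / r) ^ K)\<^sup>2"] by simp
  also have "\<dots> = R * ((R / r)\<^sup>2 * R) ^ K"
    by (simp add: power_mult_distrib flip: power_mult) (simp add: mult.commute)
  also have "(R / r)\<^sup>2 * R = R ^ 3 / r\<^sup>2"
    by (simp add: power_divide power2_eq_square power3_eq_cube)
  also have "R * (R ^ 3 / r\<^sup>2) ^ K \<le> R * 1" using le R by (intro mult_left_mono) auto
  finally show "((R / r) ^ K)\<^sup>2 / \<eta> \<le> R" by simp
qed

theorem proposition4p1: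
  fixes R q :: real and A F :: "real^2 \<Rightarrow> real"
  assumes "R > 1"
    and "\<And>x. x \<notin> ball 0 R \<Longrightarrow> A x = 1"
    and "\<And>x. x \<in> ball 0 R - ball 0 1 \<Longrightarrow> A x = -1"
    and "\<And>x. x \<in> ball 0 1 \<Longrightarrow> A x = 1"
    and "q > R powr (3/2)"
    and "F \<in> L2 (hausdorff1_on (sphere 0 q))"
    and "(LINT x|hausdorff1_on (sphere 0 q). F x) = 0"
  shows "\<not> resonant A (curve_source (sphere 0 q) F)"
proof
  let ?f = "curve_source (sphere 0 q) F"
  assume "resonant A ?f"
  then obtain u where u: "\<And>\<eta>. 0 < \<eta> \<Longrightarrow> weak_solution (\<lambda>x. of_real (A x) + \<i> * of_real \<eta>) ?f (u \<eta>)"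
    and lim: "Limsup (at_right 0) (\<lambda>\<eta>. ereal (energy \<eta> (u \<eta>))) = \<infinity>"
    unfolding resonant_def by auto
  note R = \<open>R > 1\<close>
  have A_eq: "A x = (if x \<in> ball 0 R - ball 0 1 then -1 else 1)" for x
    using assms(2-4)[of x] by auto
  have A: "A \<in> borel_measurable lebesgue" "\<And>x. \<bar>A x\<bar> \<le> 1"
  proof -
    have "(\<lambda>x. if x \<in> ball 0 R - ball 0 1 then -1 else 1) \<in> borel_measurable borel"
      by (intro measurable_If_set) auto
    then show "A \<in> borel_measurable lebesgue" unfolding A_eq[abs_def] by (rule measurable_lebesgueI)
  qed (simp add: A_eq)
  define G where "G \<eta> = re_field (weak_grad (u \<eta>))" for \<eta>
  define G' where "G' \<eta> = im_field (weak_grad (u \<eta>))" for \<eta>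
  note sol = weak_solution_fields[OF u A, folded G_def G'_def]
  have "R powr 1 < R powr (3/2)" "R powr (3/2) < R powr 2"
    by (rule powr_less_mono[OF _ R], simp)+
  moreover have "R powr 1 = R" "R powr 2 = R\<^sup>2" using R by simp_all
  ultimately have Rp: "R < R powr (3/2)" "R powr (3/2) < R\<^sup>2" by (simp_all only:)
  \<comment> \<open>The radius r must exceed R^(3/2) for the balance, stay below q where P is
    harmonic, and stay below R^2 for \<open>dpoly_bound\<close>. For q >= R^2 the last requirement
    merely gives up some decay of the coefficients.\<close>
  have "R powr (3/2) < min q (R\<^sup>2)" using Rp assms(5) by simp
  then obtain r where r: "R powr (3/2) < r" "r < min q (R\<^sup>2)" using dense by blast
  then have r': "R < r" "0 < r" "r < q" "r < R\<^sup>2" using Rp R by simp_all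
  have r3: "R ^ 3 \<le> r\<^sup>2"
  proof -
    have "R ^ 3 = R powr 3" using R by simp
    also have "\<dots> = (R powr (3/2))\<^sup>2" by (simp add: power2_eq_square flip: powr_add)
    also have "\<dots> \<le> r\<^sup>2" using r by (intro power_mono) auto
    finally show ?thesis .
  qed
  have L1: "G 1 \<in> L2 lebesgue" "G' 1 \<in> L2 lebesgue" using sol(1,2)[of 1] by (auto simp: gradient_limit_def)
  \<comment> \<open>The real part of (A + i) grad u at dissipation 1, a square-integrable field
    whose divergence is the source.\<close>
  have XL: "(\<lambda>x. A x *\<^sub>R G 1 x - 1 *\<^sub>R G' 1 x) \<in> L2 lebesgue"
    by (intro L2_diff L2_scaleR L2_bounded_mult[OF A] L1)
  obtain P where P: "gradient_limit P"
    and orth: "\<And>\<phi>. test_function \<phi> \<Longrightarrow> (LINT x|lebesgue. ((A x *\<^sub>R G 1 x - 1 *\<^sub>R G' 1 x) - P x) \<bullet> grad \<phi> x) = 0"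
    by (rule gradient_limit_projection[OF XL], rule that)
  have PL: "P \<in> L2 lebesgue" using P by (simp add: gradient_limit_def)
  have P_eq: "(LINT x|lebesgue. P x \<bullet> grad \<phi> x) = - ?f \<phi>" if \<phi>: "test_function \<phi>" for \<phi>
  proof -
    have "(LINT x|lebesgue. (A x *\<^sub>R G 1 x - 1 *\<^sub>R G' 1 x) \<bullet> grad \<phi> x) - (LINT x|lebesgue. P x \<bullet> grad \<phi> x) = 0"
      using orth[OF \<phi>] L2_inner_integrable[OF XL L2_grad[OF \<phi>]] L2_inner_integrable[OF PL L2_grad[OF \<phi>]]
      by (simp add: inner_diff_left[of _ "P _"])
    then show ?thesis using sol(4)[of 1, OF _ \<phi>] by simp
  qed
  obtain C b where C: "0 \<le> C" and b: "\<And>k. cmod (b k) \<le> C / r ^ k"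
    and tail: "\<And>K. AE x in lebesgue. norm x < R \<longrightarrow> norm (P x - gvec (\<Sum>k<K. b k * cplx x ^ k)) \<le> C * (R / r) ^ K"
  proof (rule harmonic_expansion[OF PL gradient_limit_curl_free[OF P], of R r q])
    show "(LINT x|lebesgue. P x \<bullet> grad \<phi> x) = 0" if "test_function \<phi>" "\<And>x. norm x \<ge> q \<Longrightarrow> \<phi> x = 0" for \<phi>
    proof -
      have "?f \<phi> = 0" by (rule curve_source_eq_0) (simp add: that(2) dist_norm)
      then show ?thesis by (simp add: P_eq that(1))
    qed
  qed (use r' R in auto)
  define vol where "vol = measure lebesgue (ball (0::real^2) R)"
  \<comment> \<open>The constants M and B are free of \<eta> and K; the powers with exponent K are
    kept apart for \<open>truncation_balance\<close>.\<close>
  define M where "M = (R\<^sup>2 + 1) * (C / (R\<^sup>2 / r - 1))"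
  define B where "B = 4 * nsq lebesgue P + 4 * M\<^sup>2 * vol + 4 * C\<^sup>2 * vol * R"
  have vol: "0 \<le> vol" by (simp add: vol_def)
  have bound: "energy \<eta> (u \<eta>) \<le> B" if \<eta>: "0 < \<eta>" "\<eta> < 1" for \<eta>
  proof -
    obtain K where K: "\<eta> \<le> 1 / R ^ K" "1 / \<eta> \<le> R ^ Suc K"
      using geometric_scale[OF R \<eta>] .
    note balance = truncation_balance[OF R r'(2) r3 \<eta>(1) K]
    interpret reflection R b K by unfold_locales (rule R)
    define g where "g \<sigma> x = gvec (corrector \<sigma> x)" for \<sigma> x
    have g: "g \<sigma> \<in> L2 lebesgue" "nsq lebesgue (g \<sigma>) \<le> (M * (R\<^sup>2 / r) ^ K)\<^sup>2 * vol" if \<sigma>: "\<bar>\<sigma>\<bar> = 1" for \<sigma>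
    proof -
      have "norm (g \<sigma> x) \<le> M * (R\<^sup>2 / r) ^ K * indicator (ball 0 R) x" for x
        using corrector_bound[OF b C r'(2) _ \<sigma>, of x] r' by (simp add: g_def M_def)
      then have le: "AE x in lebesgue. norm (g \<sigma> x) \<le> M * (R\<^sup>2 / r) ^ K * indicator (ball 0 R) x"
        by (intro AE_I2)
      have "g \<sigma> \<in> borel_measurable lebesgue"
        using corrector_measurable[of 1 \<sigma>] by (simp add: g_def[abs_def])
      from L2_bounded_on_ball[OF this le]
      show "g \<sigma> \<in> L2 lebesgue" "nsq lebesgue (g \<sigma>) \<le> (M * (R\<^sup>2 / r) ^ K)\<^sup>2 * vol"
        by (simp_all only: vol_def)
    qed
    define V where "V x = P x + g (-1) x" for x
    \<comment> \<open>In the shell A turns P into -P, whereas P itself is wanted. The two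
      corrections repair this for the truncated part \<open>dpoly\<close>, which leaves -2 times the
      tail.\<close>
    define Z where "Z x = (if x \<in> ball 0 R - ball 0 1 then - 2 *\<^sub>R (P x - gvec (dpoly (cplx x))) else 0)" for x
    have VL: "V \<in> L2 lebesgue" unfolding V_def[abs_def] by (intro L2_add PL g) simp
    have V: "gradient_limit V"
    proof (rule curl_free_gradient_limit[OF VL])
      show "curl_free V"
        unfolding V_def[abs_def]
        using curl_free_add_scaleR[OF PL g(1)[of "-1"] gradient_limit_curl_free[OF P], of 1] corrector_curl_free
        by (simp add: g_def[abs_def])
    qed
    have Z_meas: "Z \<in> borel_measurable lebesgue"
    proof -
      have "ball 0 R - ball (0::real^2) 1 \<in> sets lebesgue" by simp
      moreover have "(\<lambda>x. gvec (dpoly (cplx x))) \<in> borel_measurable lebesgue"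
        by (rule measurable_lebesgueI) measurable
      ultimately show ?thesis
        unfolding Z_def[abs_def]
        by (intro measurable_If_set borel_measurable_scaleR borel_measurable_diff L2_measurable[OF PL] borel_measurable_const) auto
    qed
    have "AE x in lebesgue. norm (Z x) \<le> 2 * (C * (R / r) ^ K) * indicator (ball 0 R) x"
      using tail[of K]
    proof (rule eventually_mono)
      fix x assume *: "norm x < R \<longrightarrow> norm (P x - gvec (\<Sum>k<K. b k * cplx x ^ k)) \<le> C * (R / r) ^ K"
      have "0 \<le> C * (R / r) ^ K" using C R r'(2) by simp
      then show "norm (Z x) \<le> 2 * (C * (R / r) ^ K) * indicator (ball 0 R) x"
        using * by (auto simp: Z_def dpoly_def indicator_def)
    qed
    from L2_bounded_on_ball[OF Z_meas this]
    have Z: "Z \<in> L2 lebesgue" "nsq lebesgue Z \<le> (2 * (C * (R / r) ^ K))\<^sup>2 * vol" by (simp_all add: vol_def)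
    \<comment> \<open>Hence A V has, up to the divergence of Z, the divergence of P, that is, the
      source.\<close>
    have AVZ: "A x *\<^sub>R V x - Z x = P x + g 1 x" for x
    proof -
      consider "norm x < 1" | "1 \<le> norm x" "norm x < R" | "R \<le> norm x" by linarith
      then show ?thesis
        using R by cases (auto simp: A_eq V_def Z_def g_def corrector_def gvec_diff gvec_scaleR[of "-1", simplified] scaleR_diff_right scaleR_2)
    qed
    have "\<eta> * (nsq lebesgue (G \<eta>) + nsq lebesgue (G' \<eta>)) \<le> 4 * \<eta> * nsq lebesgue V + 2 / \<eta> * nsq lebesgue Z"
    proof (rule energy_estimate[OF sol(1,2)[OF \<eta>(1)] V Z(1) A \<eta>(1) _ sol(5)[OF \<eta>(1)]])
      fix \<phi> assume \<phi>: "test_function \<phi>"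
      have "(LINT x|lebesgue. (A x *\<^sub>R V x - Z x) \<bullet> grad \<phi> x) = (LINT x|lebesgue. P x \<bullet> grad \<phi> x) + (LINT x|lebesgue. g 1 x \<bullet> grad \<phi> x)"
        unfolding AVZ using L2_inner_integrable[OF PL L2_grad[OF \<phi>]] L2_inner_integrable[OF g(1) L2_grad[OF \<phi>], of 1]
        by (simp add: inner_add_left)
      then show "(LINT x|lebesgue. (A x *\<^sub>R G \<eta> x - \<eta> *\<^sub>R G' \<eta> x) \<bullet> grad \<phi> x) = (LINT x|lebesgue. (A x *\<^sub>R V x - Z x) \<bullet> grad \<phi> x)"
        using sol(4)[OF \<eta>(1) \<phi>] P_eq[OF \<phi>] corrector_divergence_free[OF \<phi>] by (simp add: g_def)
    qed
    then have "energy \<eta> (u \<eta>) \<le> 2 * \<eta> * nsq lebesgue V + nsq lebesgue Z / \<eta>"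
      unfolding sol(3)[OF \<eta>(1)] by (simp add: mult.commute[of _ 2] mult.assoc)
    also have "\<dots> \<le> 2 * \<eta> * (2 * nsq lebesgue P + 2 * ((M * (R\<^sup>2 / r) ^ K)\<^sup>2 * vol)) + (2 * (C * (R / r) ^ K))\<^sup>2 * vol / \<eta>"
    proof (intro add_mono mult_left_mono divide_right_mono Z(2))
      have "nsq lebesgue V \<le> 2 * nsq lebesgue P + 2 * nsq lebesgue (g (-1))"
        unfolding V_def using nsq_add_le[OF PL g(1), of "-1"] by simp
      then show "nsq lebesgue V \<le> 2 * nsq lebesgue P + 2 * ((M * (R\<^sup>2 / r) ^ K)\<^sup>2 * vol)"
        using g(2)[of "-1"] by simp
    qed (use \<eta> in auto)
    also have "\<dots> = 4 * \<eta> * nsq lebesgue P + 4 * M\<^sup>2 * vol * (\<eta> * ((R\<^sup>2 / r) ^ K)\<^sup>2) + 4 * C\<^sup>2 * vol * (((R / r) ^ K)\<^sup>2 / \<eta>)"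
      by (simp add: power_mult_distrib algebra_simps)
    also have "\<dots> \<le> 4 * 1 * nsq lebesgue P + 4 * M\<^sup>2 * vol * 1 + 4 * C\<^sup>2 * vol * R"
      using \<eta> vol balance by (intro add_mono mult_mono) auto
    finally show ?thesis by (simp add: B_def)
  qed
  have "Limsup (at_right 0) (\<lambda>\<eta>. ereal (energy \<eta> (u \<eta>))) \<le> ereal B"
  proof (rule Limsup_bounded)
    have "\<forall>\<^sub>F \<eta> in at_right 0. \<eta> \<in> {0<..<1::real}" by (rule eventually_at_right_real) simp
    then show "\<forall>\<^sub>F \<eta> in at_right 0. ereal (energy \<eta> (u \<eta>)) \<le> ereal B"
      by (rule eventually_mono) (use bound in auto)
  qed
  with lim show False by simp
qed

end
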